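(* Let $n\ge1$. The map $\mathcal I:\mathcal F_{\mathcal K}\bowtie\mathcal U(V)\to\mathcal K_n^{\rm cop}$, $\mathcal I(f\bowtie u)=fu$, is an isomorphism of bialgebras.
   Context: Repeated indices are summed; $H^{\rm cop}$ is $H$ with opposite coproduct. $\mathbf G$ is the discrete group of orientation preserving diffeomorphisms of $\mathbb R^n$; $\mathcal A=C_c^\infty(\mathbb R^n)\rtimes\mathbf G$ consists of finite sums $\sum f_iU^*_{\varphi_i}$ with $fU^*_\varphi\,gU^*_\psi=f(g\circ\varphi)U^*_{\psi\varphi}$. Operators on $\mathcal A$: $X_k(fU^*_\varphi)=\partial_k(f)U^*_\varphi$, $\sigma^i_{j_1,\ldots,j_r}(fU^*_\varphi)=\partial_{j_r}\cdots\partial_{j_1}(\varphi^i)fU^*_\varphi$, $\sigma^{\pm1}(fU^*_\varphi)=\det(\varphi')^{\pm1}fU^*_\varphi$. $\mathcal K_n$ is the unital algebra of operators generated by $X_k,\sigma^i_j,\sigma^{-1}$; it contains all $\sigma^i_{j_1,\ldots,j_r}$ since $[X_\ell,\sigma^i_{j_1,\ldots,j_r}]=\sigma^i_{j_1,\ldots,j_r,\ell}$. It is a bialgebra with coproduct determined by $k(ab)=k_{(1)}(a)k_{(2)}(b)$ ($a,b\in\mathcal A$) and counit by $k(1)=\varepsilon(k)1$; e.g. $\Delta(X_\ell)=X_\ell\otimes1+\sigma^k_\ell\otimes X_k$, $\Delta(\sigma^i_j)=\sigma^k_j\otimes\sigma^i_k$. $\mathcal K_{\rm ab}$ is the commutative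 subalgebra generated by all $\sigma^i_{j_1,\ldots,j_r}$ and $\sigma^{-1}$, which is a Hopf algebra; $\mathcal F_{\mathcal K}=\mathcal K_{\rm ab}^{\rm cop}$. $V$ is the commutative Lie algebra spanned by $X_1,\ldots,X_n$, with enveloping algebra $\mathcal U(V)$. $V$ acts on $\mathcal F_{\mathcal K}$ by $X\triangleright f=[X,f]$, and $\mathcal F_{\mathcal K}$ coacts on $V$ by $X_\ell\mapsto X_k\otimes\sigma^k_\ell$; this extends to a map $u\mapsto u_{\langle0\rangle}\otimes u_{\langle1\rangle}$ on $\mathcal U(V)$ by $1\mapsto1\otimes1$, $uv\mapsto u_{(1)\langle0\rangle}v_{\langle0\rangle}\otimes u_{(1)\langle1\rangle}(u_{(2)}\triangleright v_{\langle1\rangle})$. The bicrossed product Hopf algebra $\mathcal F_{\mathcal K}\bowtie\mathcal U(V)$ is $\mathcal F_{\mathcal K}\otimes\mathcal U(V)$ with product $(f\bowtie u)(g\bowtie v)=f(u_{(1)}\triangleright g)\bowtie u_{(2)}v$, unit $1\bowtie1$, coproduct $\Delta(f\bowtie u)=(f_{(1)}\bowtie u_{(1)\langle0\rangle})\otimes(f_{(2)}u_{(1)\langle1\rangle}\bowtie u_{(2)})$, counit $\varepsilon\otimes\varepsilon$. *)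

theory Defs
  imports "HOL-Analysis.Analysis" "HOL-Library.Poly_Mapping"
begin

section \<open>Complex vector spaces and algebras\<close>

class complex_vector = ab_group_add +
  fixes scaleC :: "complex \<Rightarrow> 'a \<Rightarrow> 'a"  (infixr \<open>*\<^sub>C\<close> 75)
  assumes scaleC_add_right: "c *\<^sub>C (x + y) = c *\<^sub>C x + c *\<^sub>C y"
    and scaleC_add_left: "(c + d) *\<^sub>C x = c *\<^sub>C x + d *\<^sub>C x"
    and scaleC_scaleC: "c *\<^sub>C d *\<^sub>C x = (c * d) *\<^sub>C x"
    and scaleC_one: "1 *\<^sub>C x = x"

global_interpretation complex_vector: vector_space "scaleC :: complex \<Rightarrow> 'a \<Rightarrow> 'a::complex_vector"
  by unfold_locales (simp_all add: scaleC_add_right scaleC_add_left scaleC_scaleC scaleC_one)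

text \<open>Unital algebras; unlike in the library class \<^class>\<open>ring_1\<close>, \<open>0 = 1\<close> is not excluded.\<close>

class complex_algebra_1 = complex_vector + ring + monoid_mult +
  assumes scaleC_mult_left: "(c *\<^sub>C x) * y = c *\<^sub>C (x * y)"
    and scaleC_mult_right: "x * (c *\<^sub>C y) = c *\<^sub>C (x * y)"

instantiation complex :: complex_algebra_1
begin
definition scaleC_complex :: "complex \<Rightarrow> complex \<Rightarrow> complex" where "scaleC_complex = (*)"
instance by standard (simp_all add: scaleC_complex_def algebra_simps)
end

abbreviation clinear :: "('a::complex_vector \<Rightarrow> 'b::complex_vector) \<Rightarrow> bool" where
  "clinear \<equiv> Vector_Spaces.linear scaleC scaleC"

lemma clinear_iff: "clinear f \<longleftrightarrow> (\<forall>x y. f (x + y) = f x + f y) \<and> (\<forall>c x. f (c *\<^sub>C x) = c *\<^sub>C f x)"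
  by (simp add: Vector_Spaces.linear_iff complex_vector.vector_space_axioms)

lemma clinearI:
  assumes "\<And>x y. f (x + y) = f x + f y" and "\<And>c x. f (c *\<^sub>C x) = c *\<^sub>C f x"
  shows "clinear f"
  using assms by (simp add: clinear_iff)

definition cbilinear :: "('a::complex_vector \<Rightarrow> 'b::complex_vector \<Rightarrow> 'c::complex_vector) \<Rightarrow> bool" where
  "cbilinear f \<longleftrightarrow> (\<forall>x. clinear (f x)) \<and> (\<forall>y. clinear (\<lambda>x. f x y))"

lemma cbilinearI:
  assumes "\<And>x y z. f (x + y) z = f x z + f y z" "\<And>x y z. f x (y + z) = f x y + f x z"
    and "\<And>c x y. f (c *\<^sub>C x) y = c *\<^sub>C f x y" "\<And>c x y. f x (c *\<^sub>C y) = c *\<^sub>C f x y"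
  shows "cbilinear f"
  using assms by (simp add: cbilinear_def clinear_iff)

lemma cbilinearD:
  assumes "cbilinear f"
  shows "f (x + y) z = f x z + f y z" "f u (v + w) = f u v + f u w"
    and "f (c *\<^sub>C x) z = c *\<^sub>C f x z" "f u (c *\<^sub>C v) = c *\<^sub>C f u v"
  using assms by (simp_all add: cbilinear_def clinear_iff)

text \<open>The vector space with basis \<^typ>\<open>'a\<close> is \<^typ>\<open>'a \<Rightarrow>\<^sub>0 complex\<close>.\<close>

instantiation poly_mapping :: (type, complex_vector) complex_vector
begin
lift_definition scaleC_poly_mapping :: "complex \<Rightarrow> ('a \<Rightarrow>\<^sub>0 'b) \<Rightarrow> ('a \<Rightarrow>\<^sub>0 'b)"
  is "\<lambda>c f k. c *\<^sub>C f k"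
proof -
  fix c :: complex and f :: "'a \<Rightarrow> 'b"
  assume "finite {k. f k \<noteq> 0}"
  then show "finite {k. c *\<^sub>C f k \<noteq> 0}" by (rule rev_finite_subset) auto
qed
instance
  by standard (transfer; simp add: fun_eq_iff scaleC_add_right scaleC_add_left scaleC_scaleC scaleC_one)+
end

lemma lookup_scaleC: "Poly_Mapping.lookup (c *\<^sub>C p) k = c *\<^sub>C Poly_Mapping.lookup p k"
  by transfer simp

definition linear_extension :: "('a \<Rightarrow> 'b::complex_vector) \<Rightarrow> ('a \<Rightarrow>\<^sub>0 complex) \<Rightarrow> 'b" where
  "linear_extension f p = (\<Sum>k\<in>Poly_Mapping.keys p. Poly_Mapping.lookup p k *\<^sub>C f k)"

lemma linear_extension_superset:
  assumes "finite S" "Poly_Mapping.keys p \<subseteq> S"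
  shows "linear_extension f p = (\<Sum>k\<in>S. Poly_Mapping.lookup p k *\<^sub>C f k)"
  unfolding linear_extension_def using assms
  by (intro sum.mono_neutral_left) (auto simp: in_keys_iff)

lemma clinear_linear_extension: "clinear (linear_extension f)"
proof (rule clinearI)
  fix p q :: "'a \<Rightarrow>\<^sub>0 complex" and c :: complex
  let ?S = "Poly_Mapping.keys p \<union> Poly_Mapping.keys q"
  have "linear_extension f (p + q) = (\<Sum>k\<in>?S. Poly_Mapping.lookup (p + q) k *\<^sub>C f k)"
    using Poly_Mapping.keys_add[of p q] by (intro linear_extension_superset) auto
  also have "\<dots> = linear_extension f p + linear_extension f q"
    by (simp add: linear_extension_superset[of ?S] lookup_add scaleC_add_left sum.distrib)
  finally show "linear_extension f (p + q) = linear_extension f p + linear_extension f q" .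
  have "linear_extension f (c *\<^sub>C p) = (\<Sum>k\<in>Poly_Mapping.keys p. Poly_Mapping.lookup (c *\<^sub>C p) k *\<^sub>C f k)"
    by (intro linear_extension_superset) (auto simp: in_keys_iff lookup_scaleC)
  then show "linear_extension f (c *\<^sub>C p) = c *\<^sub>C linear_extension f p"
    by (simp add: linear_extension_def lookup_scaleC complex_vector.scale_sum_right
        scaleC_complex_def scaleC_scaleC)
qed

lemma linear_extension_single: "linear_extension f (Poly_Mapping.single k c) = c *\<^sub>C f k"
  by (cases "c = 0") (simp_all add: linear_extension_def)

lemma linear_extension_decomp: "p = linear_extension (\<lambda>k. Poly_Mapping.single k 1) p"
proof (rule poly_mapping_eqI)
  fix k
  have "(\<Sum>j\<in>Poly_Mapping.keys p. Poly_Mapping.lookup p j * (1 when j = k)) = (\<Sum>j\<in>Poly_Mapping.keys p. if j = k then Poly_Mapping.lookup p k else 0)"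
    by (intro sum.cong) (auto simp: when_def)
  also have "\<dots> = Poly_Mapping.lookup p k" by (simp add: in_keys_iff)
  finally show "Poly_Mapping.lookup p k = Poly_Mapping.lookup (linear_extension (\<lambda>k. Poly_Mapping.single k 1) p) k"
    by (simp add: linear_extension_def lookup_sum lookup_scaleC lookup_single scaleC_complex_def)
qed

section \<open>Tensor products\<close>

text \<open>The quotient of the free vector space on \<^typ>\<open>'a \<times> 'b\<close> by the bilinearity relations.\<close>

inductive_set tensor_relators :: "('a::complex_vector \<times> 'b::complex_vector \<Rightarrow>\<^sub>0 complex) set" where
  "Poly_Mapping.single (x + x', y) 1 - Poly_Mapping.single (x, y) 1 - Poly_Mapping.single (x', y) 1 \<in> tensor_relators"
| "Poly_Mapping.single (x, y + y') 1 - Poly_Mapping.single (x, y) 1 - Poly_Mapping.single (x, y') 1 \<in> tensor_relators"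
| "Poly_Mapping.single (c *\<^sub>C x, y) 1 - c *\<^sub>C Poly_Mapping.single (x, y) 1 \<in> tensor_relators"
| "Poly_Mapping.single (x, c *\<^sub>C y) 1 - c *\<^sub>C Poly_Mapping.single (x, y) 1 \<in> tensor_relators"

definition tensor_null :: "('a::complex_vector \<times> 'b::complex_vector \<Rightarrow>\<^sub>0 complex) set" where
  "tensor_null = complex_vector.span tensor_relators"

quotient_type (overloaded) ('a, 'b) tensor =
  "('a::complex_vector \<times> 'b::complex_vector) \<Rightarrow>\<^sub>0 complex" / "\<lambda>s t. s - t \<in> tensor_null"
proof (rule equivpI)
  show "reflp (\<lambda>s t. s - t \<in> (tensor_null :: ('a \<times> 'b \<Rightarrow>\<^sub>0 complex) set))"
    by (simp add: reflp_def tensor_null_def complex_vector.span_zero)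
  show "symp (\<lambda>s t. s - t \<in> (tensor_null :: ('a \<times> 'b \<Rightarrow>\<^sub>0 complex) set))"
  proof (rule sympI)
    fix s t :: "'a \<times> 'b \<Rightarrow>\<^sub>0 complex"
    assume "s - t \<in> tensor_null"
    then have "- (s - t) \<in> tensor_null" unfolding tensor_null_def by (rule complex_vector.span_neg)
    then show "t - s \<in> tensor_null" by simp
  qed
  show "transp (\<lambda>s t. s - t \<in> (tensor_null :: ('a \<times> 'b \<Rightarrow>\<^sub>0 complex) set))"
  proof (rule transpI)
    fix s t u :: "'a \<times> 'b \<Rightarrow>\<^sub>0 complex"
    assume "s - t \<in> tensor_null" "t - u \<in> tensor_null"
    then have "(s - t) + (t - u) \<in> tensor_null" unfolding tensor_null_def by (rule complex_vector.span_add)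
    then show "s - u \<in> tensor_null" by simp
  qed
qed

lemma tensor_null_eqI: "s = t \<Longrightarrow> s - t \<in> tensor_null"
  by (simp add: tensor_null_def complex_vector.span_zero)

instantiation tensor :: (complex_vector, complex_vector) complex_vector
begin
lift_definition zero_tensor :: "('a, 'b) tensor" is 0 .
lift_definition plus_tensor :: "('a, 'b) tensor \<Rightarrow> ('a, 'b) tensor \<Rightarrow> ('a, 'b) tensor" is "(+)"
  unfolding tensor_null_def by (simp add: add_diff_add complex_vector.span_add)
lift_definition minus_tensor :: "('a, 'b) tensor \<Rightarrow> ('a, 'b) tensor \<Rightarrow> ('a, 'b) tensor" is "(-)"
proof -
  fix a b c d :: "('a \<times> 'b) \<Rightarrow>\<^sub>0 complex"
  assume "a - b \<in> tensor_null" "c - d \<in> tensor_null"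
  then have "(a - b) - (c - d) \<in> tensor_null"
    unfolding tensor_null_def by (rule complex_vector.span_diff)
  then show "a - c - (b - d) \<in> tensor_null" by (simp add: algebra_simps)
qed
lift_definition uminus_tensor :: "('a, 'b) tensor \<Rightarrow> ('a, 'b) tensor" is "uminus"
proof -
  fix a b :: "('a \<times> 'b) \<Rightarrow>\<^sub>0 complex"
  assume "a - b \<in> tensor_null"
  then have "- (a - b) \<in> tensor_null" unfolding tensor_null_def by (rule complex_vector.span_neg)
  then show "- a - - b \<in> tensor_null" by simp
qed
lift_definition scaleC_tensor :: "complex \<Rightarrow> ('a, 'b) tensor \<Rightarrow> ('a, 'b) tensor" is "scaleC"
  unfolding tensor_null_def by (simp add: complex_vector.span_scale flip: complex_vector.scale_right_diff_distrib)
instance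
  by standard (transfer; rule tensor_null_eqI;
     simp add: scaleC_add_right scaleC_add_left scaleC_scaleC scaleC_one)+
end

lift_definition tensor_elem :: "'a::complex_vector \<Rightarrow> 'b::complex_vector \<Rightarrow> ('a, 'b) tensor"  (infixr \<open>\<otimes>\<^sub>t\<close> 72)
  is "\<lambda>x y. Poly_Mapping.single (x, y) 1" .

text \<open>
  The linear map on the tensor product induced by a bilinear map; for a bilinear \<^term>\<open>f\<close> the
  value does not depend on the representative, see \<open>tensor_lift_elem\<close>. It plays the role of
  Sweedler's summation: an expression in \<open>t\<^sub>(\<^sub>1\<^sub>)\<close>, \<open>t\<^sub>(\<^sub>2\<^sub>)\<close> is
  \<open>tensor_lift (\<lambda>t\<^sub>1 t\<^sub>2. \<dots>) t\<close>.
\<close>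

definition tensor_lift :: "('a::complex_vector \<Rightarrow> 'b::complex_vector \<Rightarrow> 'c::complex_vector) \<Rightarrow> ('a, 'b) tensor \<Rightarrow> 'c" where
  "tensor_lift f t = linear_extension (\<lambda>(x, y). f x y) (rep_tensor t)"

lemma linear_extension_tensor_null:
  assumes f: "cbilinear f" and s: "s \<in> tensor_null"
  shows "linear_extension (\<lambda>(x, y). f x y) s = 0"
proof -
  let ?L = "linear_extension (\<lambda>(x, y). f x y)"
  interpret L: Vector_Spaces.linear scaleC scaleC ?L by (rule clinear_linear_extension)
  have "?L r = 0" if "r \<in> tensor_relators" for r
    using that by cases (simp_all add: L.diff L.scale linear_extension_single scaleC_one cbilinearD[OF f])
  then show ?thesis
    using s unfolding tensor_null_def by (rule L.eq_0_on_span)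
qed

lemma tensor_lift_abs:
  assumes f: "cbilinear f"
  shows "tensor_lift f (abs_tensor s) = linear_extension (\<lambda>(x, y). f x y) s"
proof -
  interpret L: Vector_Spaces.linear scaleC scaleC "linear_extension (\<lambda>(x, y). f x y)"
    by (rule clinear_linear_extension)
  have "s - rep_tensor (abs_tensor s) \<in> tensor_null"
    by (rule rep_abs_rsp[OF Quotient3_tensor]) (rule tensor_null_eqI, rule refl)
  from linear_extension_tensor_null[OF f this] show ?thesis
    by (simp add: tensor_lift_def L.diff)
qed

lemma tensor_lift_elem: "cbilinear f \<Longrightarrow> tensor_lift f (x \<otimes>\<^sub>t y) = f x y"
  by (simp add: tensor_elem.abs_eq tensor_lift_abs linear_extension_single scaleC_one)

lemma clinear_tensor_lift:
  assumes f: "cbilinear f"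
  shows "clinear (tensor_lift f)"
proof (rule clinearI)
  interpret L: Vector_Spaces.linear scaleC scaleC "linear_extension (\<lambda>(x, y). f x y)"
    by (rule clinear_linear_extension)
  fix s t :: "('a, 'b) tensor" and c
  obtain p q where p: "s = abs_tensor p" and q: "t = abs_tensor q"
    using Quotient3_abs_rep[OF Quotient3_tensor] by metis
  show "tensor_lift f (s + t) = tensor_lift f s + tensor_lift f t"
    by (simp add: p q plus_tensor.abs_eq tensor_lift_abs[OF f] L.add)
  show "tensor_lift f (c *\<^sub>C s) = c *\<^sub>C tensor_lift f s"
    by (simp add: p scaleC_tensor.abs_eq tensor_lift_abs[OF f] L.scale)
qed

lemma cbilinear_tensor_elem: "cbilinear (\<otimes>\<^sub>t)"
  by (rule cbilinearI; transfer; unfold tensor_null_def diff_diff_eq[symmetric];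
      rule complex_vector.span_base; rule tensor_relators.intros)

lemma tensor_decomp: "t = linear_extension (\<lambda>(x, y). x \<otimes>\<^sub>t y) (rep_tensor t)"
proof -
  have "abs_tensor p = linear_extension (\<lambda>(x, y). x \<otimes>\<^sub>t y) p" for p :: "('a \<times> 'b) \<Rightarrow>\<^sub>0 complex"
  proof -
    have abs: "clinear (abs_tensor :: ('a \<times> 'b \<Rightarrow>\<^sub>0 complex) \<Rightarrow> _)"
      by (rule clinearI) (simp_all add: plus_tensor.abs_eq scaleC_tensor.abs_eq)
    interpret L: Vector_Spaces.linear scaleC scaleC "abs_tensor :: ('a \<times> 'b \<Rightarrow>\<^sub>0 complex) \<Rightarrow> _"
      by (rule abs)
    have "abs_tensor p = abs_tensor (linear_extension (\<lambda>k. Poly_Mapping.single k 1) p)"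
      using linear_extension_decomp[of p] by simp
    also have "\<dots> = linear_extension (\<lambda>(x, y). x \<otimes>\<^sub>t y) p"
      unfolding linear_extension_def
      by (simp add: L.sum L.scale tensor_elem.abs_eq case_prod_unfold)
    finally show ?thesis .
  qed
  from this[of "rep_tensor t"] show ?thesis
    using Quotient3_abs_rep[OF Quotient3_tensor, of t] by simp
qed

lemma tensor_induct [case_names elem add]:
  assumes elem: "\<And>x y. P (x \<otimes>\<^sub>t y)" and add: "\<And>s t. P s \<Longrightarrow> P t \<Longrightarrow> P (s + t)"
  shows "P t"
proof -
  have zero: "P 0"
    using elem[of 0 0] cbilinearD(3)[OF cbilinear_tensor_elem, of 0 0 0] by (metis complex_vector.scale_zero_left)
  have "P (\<Sum>k\<in>A. c k *\<^sub>C (case k of (x, y) \<Rightarrow> x \<otimes>\<^sub>t y))" if "finite A" for A and c :: "_ \<Rightarrow> complex"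
    using that
  proof (induction A)
    case (insert k A)
    have "P (c k *\<^sub>C (case k of (x, y) \<Rightarrow> x \<otimes>\<^sub>t y))"
      using elem[of "c k *\<^sub>C fst k" "snd k"]
      by (simp add: cbilinearD(3)[OF cbilinear_tensor_elem] case_prod_unfold)
    with insert show ?case by (simp add: add)
  qed (simp add: zero)
  then show ?thesis
    by (subst tensor_decomp) (simp add: linear_extension_def)
qed

lemma tensor_lift_add_fun: "tensor_lift (\<lambda>x y. f x y + g x y) t = tensor_lift f t + tensor_lift g t"
  by (simp add: tensor_lift_def linear_extension_def case_prod_unfold scaleC_add_right sum.distrib)

lemma tensor_lift_scale_fun: "tensor_lift (\<lambda>x y. c *\<^sub>C f x y) t = c *\<^sub>C tensor_lift f t"
  by (simp add: tensor_lift_def linear_extension_def case_prod_unfold complex_vector.scale_sum_right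
      scaleC_scaleC mult.commute)

definition tensor_map :: "('a \<Rightarrow> 'c) \<Rightarrow> ('b \<Rightarrow> 'd) \<Rightarrow>
  ('a::complex_vector, 'b::complex_vector) tensor \<Rightarrow> ('c::complex_vector, 'd::complex_vector) tensor" where
  "tensor_map f g = tensor_lift (\<lambda>x y. f x \<otimes>\<^sub>t g y)"

definition tensor_swap :: "('a::complex_vector, 'b::complex_vector) tensor \<Rightarrow> ('b, 'a) tensor" where
  "tensor_swap = tensor_lift (\<lambda>x y. y \<otimes>\<^sub>t x)"

definition tensor_assoc ::
  "(('a::complex_vector, 'b::complex_vector) tensor, 'c::complex_vector) tensor \<Rightarrow> ('a, ('b, 'c) tensor) tensor" where
  "tensor_assoc = tensor_lift (\<lambda>s z. tensor_lift (\<lambda>x y. x \<otimes>\<^sub>t y \<otimes>\<^sub>t z) s)"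

text \<open>The product \<open>(x \<otimes> y) (x' \<otimes> y') = m x x' \<otimes> m' y y'\<close> on a tensor product of algebras.\<close>

definition tensor_mult :: "('a \<Rightarrow> 'a \<Rightarrow> 'a) \<Rightarrow> ('b \<Rightarrow> 'b \<Rightarrow> 'b) \<Rightarrow>
  ('a::complex_vector, 'b::complex_vector) tensor \<Rightarrow> ('a, 'b) tensor \<Rightarrow> ('a, 'b) tensor" where
  "tensor_mult m m' s t = tensor_lift (\<lambda>x y. tensor_lift (\<lambda>x' y'. m x x' \<otimes>\<^sub>t m' y y') t) s"

lemma
  assumes m: "cbilinear m" and m': "cbilinear m'"
  shows cbilinear_tensor_mult: "cbilinear (tensor_mult m m')"
    and tensor_mult_elem: "tensor_mult m m' (x \<otimes>\<^sub>t y) (x' \<otimes>\<^sub>t y') = m x x' \<otimes>\<^sub>t m' y y'"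
proof -
  note bil = cbilinearD[OF m] cbilinearD[OF m'] cbilinearD[OF cbilinear_tensor_elem]
  have inner: "cbilinear (\<lambda>x' y'. m x x' \<otimes>\<^sub>t m' y y')" for x y
    by (rule cbilinearI) (simp_all add: bil)
  have outer: "cbilinear (\<lambda>x y. tensor_lift (\<lambda>x' y'. m x x' \<otimes>\<^sub>t m' y y') t)" for t
    by (rule cbilinearI) (simp_all add: bil tensor_lift_add_fun tensor_lift_scale_fun)
  note lin = clinear_tensor_lift[OF inner, unfolded clinear_iff]
    clinear_tensor_lift[OF outer, unfolded clinear_iff]
  show "cbilinear (tensor_mult m m')"
    unfolding tensor_mult_def
    by (rule cbilinearI) (simp_all add: lin tensor_lift_add_fun tensor_lift_scale_fun)
  show "tensor_mult m m' (x \<otimes>\<^sub>t y) (x' \<otimes>\<^sub>t y') = m x x' \<otimes>\<^sub>t m' y y'"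
    unfolding tensor_mult_def by (subst tensor_lift_elem[OF outer]) (rule tensor_lift_elem[OF inner])
qed

lemma cbilinear_times: "cbilinear ((*) :: 'a::complex_algebra_1 \<Rightarrow> 'a \<Rightarrow> 'a)"
  by (rule cbilinearI) (simp_all add: scaleC_mult_left scaleC_mult_right distrib_left distrib_right)

instantiation tensor :: (complex_algebra_1, complex_algebra_1) complex_algebra_1
begin
definition times_tensor :: "('a, 'b) tensor \<Rightarrow> ('a, 'b) tensor \<Rightarrow> ('a, 'b) tensor" where
  "times_tensor = tensor_mult (*) (*)"
definition one_tensor :: "('a, 'b) tensor" where
  "one_tensor = 1 \<otimes>\<^sub>t 1"
instance
proof
  have bil: "cbilinear ((*) :: ('a, 'b) tensor \<Rightarrow> _)"
    unfolding times_tensor_def by (intro cbilinear_tensor_mult cbilinear_times)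
  have elem: "(x \<otimes>\<^sub>t y) * (x' \<otimes>\<^sub>t y') = (x * x') \<otimes>\<^sub>t (y * y')" for x x' :: 'a and y y' :: 'b
    unfolding times_tensor_def by (intro tensor_mult_elem cbilinear_times)
  note dist = cbilinearD[OF bil]
  fix s t u :: "('a, 'b) tensor" and c :: complex
  show "(s + t) * u = s * u + t * u" "s * (t + u) = s * t + s * u"
    "(c *\<^sub>C s) * t = c *\<^sub>C (s * t)" "s * (c *\<^sub>C t) = c *\<^sub>C (s * t)" by (fact dist)+
  show "1 * s = s" "s * 1 = s"
    by (induction s rule: tensor_induct) (simp_all add: one_tensor_def elem dist)
  show "s * t * u = s * (t * u)"
  proof (induction s rule: tensor_induct)
    case (elem x y)
    show ?case
    proof (induction t rule: tensor_induct)
      case (elem x' y')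
      show ?case
        by (induction u rule: tensor_induct) (simp_all add: \<open>\<And>x x' y y'. (x \<otimes>\<^sub>t y) * (x' \<otimes>\<^sub>t y') = _\<close> dist mult.assoc)
    qed (simp add: dist)
  qed (simp add: dist)
qed
end

section \<open>Bialgebras\<close>

record (overloaded) ('a::complex_vector) bialg =
  bmult :: "'a \<Rightarrow> 'a \<Rightarrow> 'a"
  bunit :: 'a
  bcomult :: "'a \<Rightarrow> ('a, 'a) tensor"
  bcounit :: "'a \<Rightarrow> complex"

locale bialgebra =
  fixes B :: "'a::complex_vector bialg"
  assumes cbilinear_mult: "cbilinear (bmult B)"
    and mult_assoc: "bmult B (bmult B x y) z = bmult B x (bmult B y z)"
    and unit_left: "bmult B (bunit B) x = x"
    and unit_right: "bmult B x (bunit B) = x"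
    and clinear_comult: "clinear (bcomult B)"
    and clinear_counit: "clinear (bcounit B)"
    and coassoc: "tensor_assoc (tensor_map (bcomult B) id (bcomult B x)) = tensor_map id (bcomult B) (bcomult B x)"
    and counit_left: "tensor_lift (\<lambda>y z. bcounit B y *\<^sub>C z) (bcomult B x) = x"
    and counit_right: "tensor_lift (\<lambda>y z. bcounit B z *\<^sub>C y) (bcomult B x) = x"
    and comult_mult: "bcomult B (bmult B x y) = tensor_mult (bmult B) (bmult B) (bcomult B x) (bcomult B y)"
    and comult_unit: "bcomult B (bunit B) = bunit B \<otimes>\<^sub>t bunit B"
    and counit_mult: "bcounit B (bmult B x y) = bcounit B x * bcounit B y"
    and counit_unit: "bcounit B (bunit B) = 1"

definition co_opposite :: "'a::complex_vector bialg \<Rightarrow> 'a bialg" where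
  "co_opposite B = B\<lparr>bcomult := \<lambda>x. tensor_swap (bcomult B x)\<rparr>"

locale bialgebra_iso = dom: bialgebra B + cod: bialgebra C
  for B :: "'a::complex_vector bialg" and C :: "'b::complex_vector bialg" +
  fixes h :: "'a \<Rightarrow> 'b"
  assumes clinear: "clinear h"
    and bij: "bij h"
    and mult: "h (bmult B x y) = bmult C (h x) (h y)"
    and unit: "h (bunit B) = bunit C"
    and comult: "bcomult C (h x) = tensor_map h h (bcomult B x)"
    and counit: "bcounit C (h x) = bcounit B x"

section \<open>Enveloping algebras\<close>

class complex_lie_algebra = complex_vector +
  fixes lie_bracket :: "'a \<Rightarrow> 'a \<Rightarrow> 'a"
  assumes lie_add_left: "lie_bracket (x + y) z = lie_bracket x z + lie_bracket y z"
    and lie_add_right: "lie_bracket x (y + z) = lie_bracket x y + lie_bracket x z"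
    and lie_scale_left: "lie_bracket (c *\<^sub>C x) y = c *\<^sub>C lie_bracket x y"
    and lie_scale_right: "lie_bracket x (c *\<^sub>C y) = c *\<^sub>C lie_bracket x y"
    and lie_alternating: "lie_bracket x x = 0"
    and lie_jacobi: "lie_bracket x (lie_bracket y z) + lie_bracket y (lie_bracket z x) +
      lie_bracket z (lie_bracket x y) = 0"

datatype 'a word = Word (letters: "'a list")

text \<open>
  With words as monomials, \<^typ>\<open>'a word \<Rightarrow>\<^sub>0 complex\<close> with the library's convolution product
  is the free unital associative algebra on \<^typ>\<open>'a\<close>.
\<close>

instantiation word :: (type) monoid_add
begin
definition zero_word :: "'a word" where "0 = Word []"
definition plus_word :: "'a word \<Rightarrow> 'a word \<Rightarrow> 'a word" where "v + w = Word (letters v @ letters w)"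
instance by standard (simp_all add: zero_word_def plus_word_def)
end

definition letter :: "'a \<Rightarrow> ('a word \<Rightarrow>\<^sub>0 complex)" where
  "letter x = Poly_Mapping.single (Word [x]) 1"

lemma scaleC_single: "c *\<^sub>C Poly_Mapping.single k d = Poly_Mapping.single k (c * d :: complex)"
  by (rule poly_mapping_eqI) (simp add: lookup_scaleC lookup_single scaleC_complex_def when_def)

lemma single_zero_commute:
  fixes p :: "'a::monoid_add \<Rightarrow>\<^sub>0 complex"
  shows "Poly_Mapping.single 0 c * p = p * Poly_Mapping.single 0 c"
  by (subst (1 2) linear_extension_decomp[of p])
     (simp add: linear_extension_def sum_distrib_left sum_distrib_right scaleC_single mult_single mult.commute)

lemma scaleC_eq_single_mult:
  fixes p :: "'a::monoid_add \<Rightarrow>\<^sub>0 complex"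
  shows "c *\<^sub>C p = Poly_Mapping.single 0 c * p"
  by (subst (1 2) linear_extension_decomp[of p])
     (simp add: linear_extension_def sum_distrib_left complex_vector.scale_sum_right scaleC_single mult_single)

inductive_set two_sided_ideal :: "'a::ring_1 set \<Rightarrow> 'a set" for R where
  zero: "0 \<in> two_sided_ideal R"
| add: "x \<in> two_sided_ideal R \<Longrightarrow> r \<in> R \<Longrightarrow> x + a * r * b \<in> two_sided_ideal R"

lemma two_sided_ideal_add:
  assumes "x \<in> two_sided_ideal R" "y \<in> two_sided_ideal R"
  shows "x + y \<in> two_sided_ideal R"
  using assms(2)
proof induction
  case zero
  then show ?case using assms(1) by simp
next
  case (add y r a b)
  then show ?case using two_sided_ideal.add[of "x + y"] by (simp add: add.assoc)
qed

lemma two_sided_ideal_mult: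
  assumes "x \<in> two_sided_ideal R"
  shows "c * x * d \<in> two_sided_ideal R"
  using assms
proof induction
  case (add y r a b)
  then have "c * y * d + (c * a) * r * (b * d) \<in> two_sided_ideal R"
    by (intro two_sided_ideal.add)
  then show ?case by (simp add: distrib_left distrib_right mult.assoc)
qed (simp add: two_sided_ideal.zero)

lemma two_sided_ideal_uminus: "x \<in> two_sided_ideal R \<Longrightarrow> - x \<in> two_sided_ideal R"
  using two_sided_ideal_mult[of x R "-1" 1] by simp

lemma two_sided_ideal_diff:
  "x \<in> two_sided_ideal R \<Longrightarrow> y \<in> two_sided_ideal R \<Longrightarrow> x - y \<in> two_sided_ideal R"
  using two_sided_ideal_add[of x R "- y"] two_sided_ideal_uminus[of y R] by simp

inductive_set envelope_relators :: "('a::complex_lie_algebra word \<Rightarrow>\<^sub>0 complex) set" where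
  "letter (x + y) - letter x - letter y \<in> envelope_relators"
| "letter (c *\<^sub>C x) - c *\<^sub>C letter x \<in> envelope_relators"
| "letter x * letter y - letter y * letter x - letter (lie_bracket x y) \<in> envelope_relators"

definition envelope_null :: "('a::complex_lie_algebra word \<Rightarrow>\<^sub>0 complex) set" where
  "envelope_null = two_sided_ideal envelope_relators"

lemma envelope_null_eqI: "s = t \<Longrightarrow> s - t \<in> envelope_null"
  by (simp add: envelope_null_def two_sided_ideal.zero)

quotient_type (overloaded) 'a envelope =
  "'a::complex_lie_algebra word \<Rightarrow>\<^sub>0 complex" / "\<lambda>s t. s - t \<in> envelope_null"
proof (rule equivpI)
  show "reflp (\<lambda>s t. s - t \<in> (envelope_null :: ('a word \<Rightarrow>\<^sub>0 complex) set))"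
    by (rule reflpI, rule envelope_null_eqI, rule refl)
  show "symp (\<lambda>s t. s - t \<in> (envelope_null :: ('a word \<Rightarrow>\<^sub>0 complex) set))"
  proof (rule sympI)
    fix s t :: "'a word \<Rightarrow>\<^sub>0 complex"
    assume "s - t \<in> envelope_null"
    then have "- (s - t) \<in> envelope_null" unfolding envelope_null_def by (rule two_sided_ideal_uminus)
    then show "t - s \<in> envelope_null" by simp
  qed
  show "transp (\<lambda>s t. s - t \<in> (envelope_null :: ('a word \<Rightarrow>\<^sub>0 complex) set))"
  proof (rule transpI)
    fix s t u :: "'a word \<Rightarrow>\<^sub>0 complex"
    assume "s - t \<in> envelope_null" "t - u \<in> envelope_null"
    then have "(s - t) + (t - u) \<in> envelope_null" unfolding envelope_null_def by (rule two_sided_ideal_add)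
    then show "s - u \<in> envelope_null" by simp
  qed
qed

instantiation envelope :: (complex_lie_algebra) complex_algebra_1
begin
lift_definition zero_envelope :: "'a envelope" is 0 .
lift_definition one_envelope :: "'a envelope" is 1 .
lift_definition plus_envelope :: "'a envelope \<Rightarrow> 'a envelope \<Rightarrow> 'a envelope" is "(+)"
  unfolding envelope_null_def by (simp add: add_diff_add two_sided_ideal_add)
lift_definition minus_envelope :: "'a envelope \<Rightarrow> 'a envelope \<Rightarrow> 'a envelope" is "(-)"
proof -
  fix a b c d :: "'a word \<Rightarrow>\<^sub>0 complex"
  assume "a - b \<in> envelope_null" "c - d \<in> envelope_null"
  then have "(a - b) - (c - d) \<in> envelope_null"
    unfolding envelope_null_def by (rule two_sided_ideal_diff)
  then show "a - c - (b - d) \<in> envelope_null" by (simp add: algebra_simps)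
qed
lift_definition uminus_envelope :: "'a envelope \<Rightarrow> 'a envelope" is "uminus"
proof -
  fix a b :: "'a word \<Rightarrow>\<^sub>0 complex"
  assume "a - b \<in> envelope_null"
  then have "- (a - b) \<in> envelope_null" unfolding envelope_null_def by (rule two_sided_ideal_uminus)
  then show "- a - - b \<in> envelope_null" by simp
qed
lift_definition times_envelope :: "'a envelope \<Rightarrow> 'a envelope \<Rightarrow> 'a envelope" is "(*)"
proof -
  fix a b c d :: "'a word \<Rightarrow>\<^sub>0 complex"
  assume "a - b \<in> envelope_null" "c - d \<in> envelope_null"
  then have "1 * (a - b) * c + b * (c - d) * 1 \<in> envelope_null"
    unfolding envelope_null_def by (intro two_sided_ideal_add two_sided_ideal_mult)
  then show "a * c - b * d \<in> envelope_null" by (simp add: algebra_simps)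
qed
lift_definition scaleC_envelope :: "complex \<Rightarrow> 'a envelope \<Rightarrow> 'a envelope" is "scaleC"
proof -
  fix k and a b :: "'a word \<Rightarrow>\<^sub>0 complex"
  assume "a - b \<in> envelope_null"
  then have "Poly_Mapping.single 0 k * (a - b) * 1 \<in> envelope_null"
    unfolding envelope_null_def by (rule two_sided_ideal_mult)
  then show "k *\<^sub>C a - k *\<^sub>C b \<in> envelope_null"
    by (simp add: scaleC_eq_single_mult right_diff_distrib)
qed
instance
proof
  fix x y :: "'a envelope" and c
  show "x * c *\<^sub>C y = c *\<^sub>C (x * y)"
    by (transfer, rule envelope_null_eqI) (metis mult.assoc scaleC_eq_single_mult single_zero_commute)
  show "(c *\<^sub>C x) * y = c *\<^sub>C (x * y)"
    by (transfer, rule envelope_null_eqI) (simp only: mult.assoc scaleC_eq_single_mult)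
qed (transfer; rule envelope_null_eqI;
  simp add: scaleC_add_right scaleC_add_left scaleC_scaleC scaleC_one distrib_left distrib_right mult.assoc)+
end

lift_definition envelope_of :: "'a::complex_lie_algebra \<Rightarrow> 'a envelope" is letter .

text \<open>
  Extension to the enveloping algebra of an action \<open>a\<close> of the Lie algebra on a module,
  \<open>x\<^sub>1 \<cdots> x\<^sub>r \<mapsto> a x\<^sub>1 \<circ> \<cdots> \<circ> a x\<^sub>r\<close>, and of a Lie algebra map \<open>g\<close> into an associative algebra.
  (Only for such \<open>a\<close> and \<open>g\<close> is the value independent of the representative.)
\<close>

definition envelope_act :: "('v \<Rightarrow> 'm \<Rightarrow> 'm) \<Rightarrow> 'v::complex_lie_algebra envelope \<Rightarrow> 'm \<Rightarrow> 'm::complex_vector" where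
  "envelope_act a u m = linear_extension (\<lambda>w. foldr a (letters w) m) (rep_envelope u)"

definition envelope_lift :: "('v \<Rightarrow> 'b) \<Rightarrow> 'v::complex_lie_algebra envelope \<Rightarrow> 'b::complex_algebra_1" where
  "envelope_lift g u = linear_extension (\<lambda>w. prod_list (map g (letters w))) (rep_envelope u)"

definition envelope_comult :: "'v::complex_lie_algebra envelope \<Rightarrow> ('v envelope, 'v envelope) tensor" where
  "envelope_comult = envelope_lift (\<lambda>x. envelope_of x \<otimes>\<^sub>t 1 + 1 \<otimes>\<^sub>t envelope_of x)"

definition envelope_counit :: "'v::complex_lie_algebra envelope \<Rightarrow> complex" where
  "envelope_counit = envelope_lift (\<lambda>x. 0)"

section \<open>Smooth functions and diffeomorphisms\<close>

definition partial :: "'n \<Rightarrow> (real^'n \<Rightarrow> 'b::real_normed_vector) \<Rightarrow> real^'n \<Rightarrow> 'b" where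
  "partial j f x = frechet_derivative f (at x) (axis j 1)"

text \<open>\<open>partials [j\<^sub>1, \<dots>, j\<^sub>r] f = \<partial>\<^bsub>j\<^sub>r\<^esub> \<cdots> \<partial>\<^bsub>j\<^sub>1\<^esub> f\<close>\<close>

definition partials :: "'n list \<Rightarrow> (real^'n \<Rightarrow> 'b::real_normed_vector) \<Rightarrow> real^'n \<Rightarrow> 'b" where
  "partials = fold partial"

definition smooth :: "(real^'n \<Rightarrow> 'b::real_normed_vector) \<Rightarrow> bool" where
  "smooth f \<longleftrightarrow> (\<forall>js x. partials js f differentiable at x)"

text \<open>Finite orders of differentiability, for inductive proofs of smoothness.\<close>

fun smooth_upto :: "nat \<Rightarrow> (real^'n \<Rightarrow> 'b::real_normed_vector) \<Rightarrow> bool" where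
  "smooth_upto 0 f \<longleftrightarrow> (\<forall>x. f differentiable at x)"
| "smooth_upto (Suc k) f \<longleftrightarrow> (\<forall>x. f differentiable at x) \<and> (\<forall>j. smooth_upto k (partial j f))"

lemma smooth_upto_iff:
  fixes f :: "real^'n \<Rightarrow> 'b::real_normed_vector"
  shows "smooth_upto k f \<longleftrightarrow> (\<forall>js x. length js \<le> k \<longrightarrow> partials js f differentiable at x)"
proof (induction k arbitrary: f)
  case 0
  then show ?case by (simp add: partials_def)
next
  case (Suc k)
  show ?case
  proof
    assume *: "smooth_upto (Suc k) f"
    show "\<forall>js x. length js \<le> Suc k \<longrightarrow> partials js f differentiable at x"
    proof (intro allI impI)
      fix js :: "'n list" and x assume "length js \<le> Suc k"
      then show "partials js f differentiable at x"
        using * Suc by (cases js) (auto simp: partials_def)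
    qed
  next
    assume *: "\<forall>js x. length js \<le> Suc k \<longrightarrow> partials js f differentiable at x"
    have "f differentiable at x" for x
      using *[rule_format, of "[]" x] by (simp add: partials_def)
    moreover have "partials js (partial j f) differentiable at x" if "length js \<le> k" for j js x
      using *[rule_format, of "j # js" x] that by (simp add: partials_def)
    ultimately show "smooth_upto (Suc k) f" by (simp add: Suc)
  qed
qed

lemma smooth_iff_upto: "smooth f \<longleftrightarrow> (\<forall>k. smooth_upto k f)"
  unfolding smooth_def smooth_upto_iff by blast

lemma smooth_upto_differentiable: "smooth_upto k f \<Longrightarrow> f differentiable at x"
  by (cases k) auto

lemma smooth_upto_Suc: "smooth_upto (Suc k) f \<Longrightarrow> smooth_upto k f"
  by (simp only: smooth_upto_iff) auto

lemma smooth_differentiable: "smooth f \<Longrightarrow> f differentiable at x"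
  using smooth_iff_upto smooth_upto_differentiable by blast

lemma smooth_partial: "smooth f \<Longrightarrow> smooth (partial j f)"
  unfolding smooth_iff_upto by (metis smooth_upto.simps(2))

lemma smooth_partials: "smooth f \<Longrightarrow> smooth (partials js f)"
  by (induction js arbitrary: f) (auto simp: partials_def smooth_partial)

lemma partial_eq: "(f has_derivative f') (at x) \<Longrightarrow> partial j f x = f' (axis j 1)"
  by (simp add: partial_def frechet_derivative_at[symmetric])

lemma partial_add:
  assumes "\<And>x. f differentiable at x" "\<And>x. g differentiable at x"
  shows "partial j (\<lambda>x. f x + g x) = (\<lambda>x. partial j f x + partial j g x)"
proof
  fix x
  have "(f has_derivative frechet_derivative f (at x)) (at x)"
    "(g has_derivative frechet_derivative g (at x)) (at x)"
    using assms frechet_derivative_works by blast+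
  from has_derivative_add[OF this]
  show "partial j (\<lambda>x. f x + g x) x = partial j f x + partial j g x"
    by (simp add: partial_eq) (simp add: partial_def)
qed

lemma partial_bounded_linear:
  assumes "bounded_linear L" "\<And>x. f differentiable at x"
  shows "partial j (\<lambda>x. L (f x)) = (\<lambda>x. L (partial j f x))"
proof
  fix x
  have "(f has_derivative frechet_derivative f (at x)) (at x)"
    using assms(2) frechet_derivative_works by blast
  from bounded_linear.has_derivative[OF assms(1) this]
  show "partial j (\<lambda>x. L (f x)) x = L (partial j f x)"
    by (simp add: partial_eq) (simp add: partial_def)
qed

lemma partial_bounded_bilinear:
  assumes "bounded_bilinear pr" "\<And>x. f differentiable at x" "\<And>x. g differentiable at x"
  shows "partial j (\<lambda>x. pr (f x) (g x)) = (\<lambda>x. pr (f x) (partial j g x) + pr (partial j f x) (g x))"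
proof
  fix x
  have "(f has_derivative frechet_derivative f (at x)) (at x)"
    "(g has_derivative frechet_derivative g (at x)) (at x)"
    using assms(2,3) frechet_derivative_works by blast+
  from bounded_bilinear.FDERIV[OF assms(1) this]
  show "partial j (\<lambda>x. pr (f x) (g x)) x = pr (f x) (partial j g x) + pr (partial j f x) (g x)"
    by (simp add: partial_eq) (simp add: partial_def)
qed

lemma smooth_upto_add: "smooth_upto k f \<Longrightarrow> smooth_upto k g \<Longrightarrow> smooth_upto k (\<lambda>x. f x + g x)"
  by (induction k arbitrary: f g) (auto simp: partial_add)

lemma partial_const: "partial j (\<lambda>x. c) = (\<lambda>x. 0)"
  by (rule ext) (simp add: partial_def frechet_derivative_const)

lemma smooth_upto_const: "smooth_upto k (\<lambda>x. c)"
  by (induction k arbitrary: c) (auto simp: partial_const)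

lemma smooth_upto_sum: "(\<And>i. i \<in> A \<Longrightarrow> smooth_upto k (f i)) \<Longrightarrow> smooth_upto k (\<lambda>x. \<Sum>i\<in>A. f i x)"
  by (induction A rule: infinite_finite_induct) (auto simp: smooth_upto_const smooth_upto_add)

lemma smooth_upto_bounded_linear:
  "bounded_linear L \<Longrightarrow> smooth_upto k f \<Longrightarrow> smooth_upto k (\<lambda>x. L (f x))"
  by (induction k arbitrary: f)
     (auto simp: partial_bounded_linear intro: bounded_linear_imp_differentiable differentiable_compose)

lemma smooth_upto_bounded_bilinear:
  assumes pr: "bounded_bilinear pr"
  shows "smooth_upto k f \<Longrightarrow> smooth_upto k g \<Longrightarrow> smooth_upto k (\<lambda>x. pr (f x) (g x))"
proof (induction k arbitrary: f g)
  case 0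
  then show ?case
    using bounded_bilinear.FDERIV[OF pr] unfolding smooth_upto.simps differentiable_def by blast
next
  case (Suc k)
  then have diff: "\<And>x. f differentiable at x" "\<And>x. g differentiable at x" by auto
  have "smooth_upto 0 (\<lambda>x. pr (f x) (g x))"
    using bounded_bilinear.FDERIV[OF pr] diff unfolding smooth_upto.simps differentiable_def by blast
  moreover have "smooth_upto k (partial j (\<lambda>x. pr (f x) (g x)))" for j
    unfolding partial_bounded_bilinear[OF pr diff]
    using Suc.prems by (intro smooth_upto_add Suc.IH) (auto intro: smooth_upto_Suc)
  ultimately show ?case by simp
qed

lemma smooth_upto_compose:
  fixes f :: "real^'n \<Rightarrow> 'b::real_normed_vector" and \<phi> :: "real^'n \<Rightarrow> real^'n"
  shows "smooth_upto k f \<Longrightarrow> smooth_upto k \<phi> \<Longrightarrow> smooth_upto k (\<lambda>x. f (\<phi> x))"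
proof (induction k arbitrary: f)
  case 0
  then show ?case using differentiable_chain_at unfolding smooth_upto.simps o_def by blast
next
  case (Suc k)
  then have diff: "\<And>x. f differentiable at x" "\<And>x. \<phi> differentiable at x" by auto
  then have "(\<lambda>x. f (\<phi> x)) differentiable at x" for x
    using differentiable_chain_at unfolding o_def by blast
  moreover have "partial j (\<lambda>x. f (\<phi> x)) = (\<lambda>x. \<Sum>i\<in>UNIV. (partial j \<phi> x $ i) *\<^sub>R partial i f (\<phi> x))" for j
  proof
    fix x
    have f': "(f has_derivative frechet_derivative f (at (\<phi> x))) (at (\<phi> x))"
      and \<phi>': "(\<phi> has_derivative frechet_derivative \<phi> (at x)) (at x)"
      using diff frechet_derivative_works by blast+
    interpret linear "frechet_derivative f (at (\<phi> x))"
      using f' by (rule has_derivative_linear)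
    have "partial j (\<lambda>x. f (\<phi> x)) x = frechet_derivative f (at (\<phi> x)) (partial j \<phi> x)"
      using partial_eq[OF has_derivative_compose[OF \<phi>' f']] by (simp add: partial_def)
    also have "\<dots> = frechet_derivative f (at (\<phi> x)) (\<Sum>i\<in>UNIV. (partial j \<phi> x $ i) *\<^sub>R axis i 1)"
      using basis_expansion[of "partial j \<phi> x"] by (simp add: scalar_mult_eq_scaleR)
    finally show "partial j (\<lambda>x. f (\<phi> x)) x = (\<Sum>i\<in>UNIV. (partial j \<phi> x $ i) *\<^sub>R partial i f (\<phi> x))"
      by (simp add: sum scaleR partial_def)
  qed
  moreover have "smooth_upto k (\<lambda>x. \<Sum>i\<in>UNIV. (partial j \<phi> x $ i) *\<^sub>R partial i f (\<phi> x))" for j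
    using Suc.prems
    by (intro smooth_upto_sum smooth_upto_bounded_bilinear[OF bounded_bilinear_scaleR] Suc.IH
        smooth_upto_bounded_linear[OF bounded_linear_vec_nth]) (auto intro: smooth_upto_Suc)
  ultimately show ?case by simp
qed

lemma smooth_upto_inverse:
  fixes f :: "real^'n \<Rightarrow> real"
  assumes nz: "\<And>x. f x \<noteq> 0"
  shows "smooth_upto k f \<Longrightarrow> smooth_upto k (\<lambda>x. inverse (f x))"
proof (induction k)
  case 0
  then show ?case using nz by (auto intro!: differentiable_inverse)
next
  case (Suc k)
  then have diff: "\<And>x. f differentiable at x" by auto
  have "partial j (\<lambda>x. inverse (f x)) = (\<lambda>x. (- 1) * (inverse (f x) * (partial j f x * inverse (f x))))" for j
  proof
    fix x
    have "(f has_derivative frechet_derivative f (at x)) (at x)"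
      using diff frechet_derivative_works by blast
    from Deriv.has_derivative_inverse[OF nz this]
    show "partial j (\<lambda>x. inverse (f x)) x = (- 1) * (inverse (f x) * (partial j f x * inverse (f x)))"
      by (simp add: partial_eq) (simp add: partial_def)
  qed
  moreover have "smooth_upto k (\<lambda>x. (- 1) * (inverse (f x) * (partial j f x * inverse (f x))))" for j
    using Suc by (intro smooth_upto_bounded_bilinear[OF bounded_bilinear_mult] smooth_upto_const Suc.IH)
       (auto intro: smooth_upto_Suc)
  ultimately show ?case using diff nz by (auto intro!: differentiable_inverse)
qed

lemma smooth_const: "smooth (\<lambda>x. c)"
  and smooth_add: "smooth f \<Longrightarrow> smooth g \<Longrightarrow> smooth (\<lambda>x. f x + g x)"
  and smooth_bounded_linear: "bounded_linear L \<Longrightarrow> smooth f \<Longrightarrow> smooth (\<lambda>x. L (f x))"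
  and smooth_bounded_bilinear: "bounded_bilinear pr \<Longrightarrow> smooth f \<Longrightarrow> smooth h \<Longrightarrow> smooth (\<lambda>x. pr (f x) (h x))"
  and smooth_inverse: "smooth \<rho> \<Longrightarrow> (\<And>x. \<rho> x \<noteq> (0::real)) \<Longrightarrow> smooth (\<lambda>x. inverse (\<rho> x))"
  and smooth_sum: "(\<And>i. i \<in> A \<Longrightarrow> smooth (F i)) \<Longrightarrow> smooth (\<lambda>x. \<Sum>i\<in>A. F i x)"
  by (simp_all add: smooth_iff_upto smooth_upto_const smooth_upto_add smooth_upto_bounded_linear
      smooth_upto_bounded_bilinear smooth_upto_inverse smooth_upto_sum)

lemma smooth_compose:
  fixes \<phi> :: "real^'n \<Rightarrow> real^'n"
  shows "smooth f \<Longrightarrow> smooth \<phi> \<Longrightarrow> smooth (\<lambda>x. f (\<phi> x))"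
  by (simp add: smooth_iff_upto smooth_upto_compose)

lemma smooth_prod: "(\<And>i. i \<in> A \<Longrightarrow> smooth (F i)) \<Longrightarrow> smooth (\<lambda>x. \<Prod>i\<in>A. F i x :: real)"
  by (induction A rule: infinite_finite_induct)
     (auto simp: smooth_const smooth_bounded_bilinear[OF bounded_bilinear_mult])

lemma smooth_id: "smooth (\<lambda>x::real^'n. x)"
proof -
  have "partial j (\<lambda>x::real^'n. x) = (\<lambda>x. axis j 1)" for j
    by (rule ext) (simp add: partial_def frechet_derivative_ident)
  then have "smooth_upto k (\<lambda>x::real^'n. x)" for k
    by (cases k) (auto simp: smooth_upto_const)
  then show ?thesis by (simp add: smooth_iff_upto)
qed

definition orientation_preserving_diffeo :: "(real^'n \<Rightarrow> real^'n) \<Rightarrow> bool" where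
  "orientation_preserving_diffeo \<phi> \<longleftrightarrow>
    smooth \<phi> \<and> bij \<phi> \<and> smooth (inv \<phi>) \<and> (\<forall>x. det (jacobian \<phi> (at x)) > 0)"

typedef 'n diffeo = "{\<phi> :: real^'n \<Rightarrow> real^'n. orientation_preserving_diffeo \<phi>}"
proof
  have "jacobian (\<lambda>x. x) (at x) = (mat 1 :: real^'n^'n)" for x
    by (simp add: jacobian_def frechet_derivative_ident matrix_id_mat_1[unfolded id_def])
  moreover have "inv (\<lambda>x::real^'n. x) = (\<lambda>x. x)" using inv_id unfolding id_def .
  ultimately show "(\<lambda>x. x) \<in> {\<phi> :: real^'n \<Rightarrow> real^'n. orientation_preserving_diffeo \<phi>}"
    using bij_id[unfolded id_def] by (simp add: orientation_preserving_diffeo_def smooth_id)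
qed

setup_lifting type_definition_diffeo

lift_definition diffeo_id :: "'n::finite diffeo" is "\<lambda>x. x"
proof -
  have "jacobian (\<lambda>x. x) (at x) = (mat 1 :: real^'n^'n)" for x
    by (simp add: jacobian_def frechet_derivative_ident matrix_id_mat_1[unfolded id_def])
  moreover have "inv (\<lambda>x::real^'n. x) = (\<lambda>x. x)" using inv_id unfolding id_def .
  ultimately show "orientation_preserving_diffeo (\<lambda>x::real^'n. x)"
    using bij_id[unfolded id_def] by (simp add: orientation_preserving_diffeo_def smooth_id)
qed

lemma jacobian_compose:
  fixes \<phi> \<psi> :: "real^'n \<Rightarrow> real^'n"
  assumes "smooth \<psi>" "smooth \<phi>"
  shows "jacobian (\<lambda>x. \<psi> (\<phi> x)) (at x) = jacobian \<psi> (at (\<phi> x)) ** jacobian \<phi> (at x)"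
proof -
  have \<psi>': "(\<psi> has_derivative frechet_derivative \<psi> (at (\<phi> x))) (at (\<phi> x))"
    and \<phi>': "(\<phi> has_derivative frechet_derivative \<phi> (at x)) (at x)"
    using assms smooth_differentiable frechet_derivative_works by blast+
  have "frechet_derivative (\<lambda>x. \<psi> (\<phi> x)) (at x) = frechet_derivative \<psi> (at (\<phi> x)) \<circ> frechet_derivative \<phi> (at x)"
    using frechet_derivative_at[OF has_derivative_compose[OF \<phi>' \<psi>']] by (simp add: o_def)
  then show ?thesis
    by (simp add: jacobian_def matrix_compose[OF has_derivative_linear[OF \<phi>'] has_derivative_linear[OF \<psi>']])
qed

lift_definition diffeo_comp :: "'n::finite diffeo \<Rightarrow> 'n diffeo \<Rightarrow> 'n diffeo" is "\<lambda>\<psi> \<phi> x. \<psi> (\<phi> x)"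
proof -
  fix \<psi> \<phi> :: "real^'n \<Rightarrow> real^'n"
  assume \<psi>: "orientation_preserving_diffeo \<psi>" and \<phi>: "orientation_preserving_diffeo \<phi>"
  have "bij (\<lambda>x. \<psi> (\<phi> x))"
    using \<psi> \<phi> bij_comp[of \<phi> \<psi>] by (simp add: orientation_preserving_diffeo_def o_def)
  moreover have "inv (\<lambda>x. \<psi> (\<phi> x)) = (\<lambda>x. inv \<phi> (inv \<psi> x))"
    using \<psi> \<phi> o_inv_distrib[of \<psi> \<phi>] by (simp add: orientation_preserving_diffeo_def o_def)
  ultimately show "orientation_preserving_diffeo (\<lambda>x. \<psi> (\<phi> x))"
    using \<psi> \<phi> unfolding orientation_preserving_diffeo_def
    by (simp add: smooth_compose jacobian_compose det_mul)
qed

section \<open>The crossed product\<close>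

definition compact_support :: "(real^'n \<Rightarrow> complex) \<Rightarrow> bool" where
  "compact_support f \<longleftrightarrow> compact (closure {x. f x \<noteq> 0})"

lemma compact_closure_subset: "compact T \<Longrightarrow> closure S \<subseteq> T \<Longrightarrow> compact (closure S)"
  using compact_Int_closed[of T "closure S"] by (simp add: Int_absorb1)

lemma compact_support_subset:
  assumes "compact_support f" "{x. g x \<noteq> 0} \<subseteq> closure {x. f x \<noteq> 0}"
  shows "compact_support g"
proof -
  have "closure {x. g x \<noteq> 0} \<subseteq> closure {x. f x \<noteq> 0}"
    using assms(2) by (simp add: closure_minimal)
  then show ?thesis
    using assms(1) unfolding compact_support_def
    by (blast intro: compact_closure_subset)
qed

lemma compact_support_mono:
  assumes "compact_support f" "\<And>x. f x = 0 \<Longrightarrow> g x = 0"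
  shows "compact_support g"
  using assms(2) closure_subset by (intro compact_support_subset[OF assms(1)]) force

lemma compact_support_add:
  assumes "compact_support f" "compact_support g"
  shows "compact_support (\<lambda>x. f x + g x)"
proof -
  have "closure {x. f x + g x \<noteq> 0} \<subseteq> closure {x. f x \<noteq> 0} \<union> closure {x. g x \<noteq> 0}"
    unfolding closure_Un[symmetric] by (rule closure_mono) auto
  then show ?thesis
    using assms unfolding compact_support_def
    by (blast intro: compact_closure_subset compact_Un)
qed

lemma compact_support_partial:
  assumes "compact_support f"
  shows "compact_support (partial j f)"
proof (rule compact_support_subset[OF assms], rule subsetI, rule ccontr)
  fix x assume x: "x \<in> {x. partial j f x \<noteq> 0}" "x \<notin> closure {x. f x \<noteq> 0}"
  have "(f has_derivative (\<lambda>h. 0)) (at x)"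
  proof (rule has_derivative_transform_within_open)
    show "((\<lambda>x. 0) has_derivative (\<lambda>h. 0)) (at x)" by simp
    show "open (- closure {x. f x \<noteq> 0})" by (intro open_Compl closed_closure)
    show "x \<in> - closure {x. f x \<noteq> 0}" using x by blast
    show "0 = f y" if "y \<in> - closure {x. f x \<noteq> 0}" for y
      using that closure_subset[of "{x. f x \<noteq> 0}"] by force
  qed
  then have "partial j f x = 0" by (simp add: partial_eq)
  with x show False by simp
qed

typedef 'n test_function = "{f :: real^'n \<Rightarrow> complex. smooth f \<and> compact_support f}"
  by (rule exI[of _ "\<lambda>x. 0"]) (simp add: smooth_const compact_support_def)

setup_lifting type_definition_test_function

instantiation test_function :: (finite) complex_vector
begin
lift_definition zero_test_function :: "'a test_function" is "\<lambda>x. 0"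
  by (simp add: smooth_const compact_support_def)
lift_definition plus_test_function :: "'a test_function \<Rightarrow> 'a test_function \<Rightarrow> 'a test_function"
  is "\<lambda>f g x. f x + g x"
  by (simp add: smooth_add compact_support_add)
lift_definition scaleC_test_function :: "complex \<Rightarrow> 'a test_function \<Rightarrow> 'a test_function"
  is "\<lambda>c f x. c * f x"
  by (auto intro: smooth_bounded_linear[OF bounded_linear_mult_right] elim: compact_support_mono)
definition uminus_test_function :: "'a test_function \<Rightarrow> 'a test_function" where
  "uminus_test_function f = (- 1) *\<^sub>C f"
definition minus_test_function :: "'a test_function \<Rightarrow> 'a test_function \<Rightarrow> 'a test_function" where
  "minus_test_function f g = f + (- 1) *\<^sub>C g"
instance
proof
  fix f g :: "'a test_function"
  show "- f + f = 0" unfolding uminus_test_function_def by transfer simp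
  show "f - g = f + - g" unfolding uminus_test_function_def minus_test_function_def ..
qed (transfer; simp add: fun_eq_iff algebra_simps)+
end

text \<open>
  The finite sum \<open>\<Sum>\<^sub>i f\<^sub>i U\<^sup>*\<^bsub>\<phi>\<^sub>i\<^esub>\<close> is represented by the finitely supported family
  of its coefficients; in particular \<open>f U\<^sup>*\<^bsub>\<phi>\<^esub>\<close> is \<^term>\<open>Poly_Mapping.single \<phi> f\<close>.
\<close>

type_synonym 'n crossed = "'n diffeo \<Rightarrow>\<^sub>0 'n test_function"

text \<open>\<open>f (g \<circ> \<phi>)\<close>\<close>

lift_definition twisted_mult :: "'n::finite diffeo \<Rightarrow> 'n test_function \<Rightarrow> 'n test_function \<Rightarrow> 'n test_function"
  is "\<lambda>\<phi> f g x. f x * g (\<phi> x)"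
  by (auto simp: orientation_preserving_diffeo_def elim: compact_support_mono
      intro!: smooth_bounded_bilinear[OF bounded_bilinear_mult] intro: smooth_compose)

definition crossed_mult :: "'n::finite crossed \<Rightarrow> 'n crossed \<Rightarrow> 'n crossed" where
  "crossed_mult a b = (\<Sum>\<phi>\<in>Poly_Mapping.keys a. \<Sum>\<psi>\<in>Poly_Mapping.keys b.
     Poly_Mapping.single (diffeo_comp \<psi> \<phi>)
       (twisted_mult \<phi> (Poly_Mapping.lookup a \<phi>) (Poly_Mapping.lookup b \<psi>)))"

lift_definition partial_test :: "'n::finite \<Rightarrow> 'n test_function \<Rightarrow> 'n test_function" is partial
  by (simp add: smooth_partial compact_support_partial)

text \<open>Multiplication by \<open>\<partial>\<^bsub>j\<^sub>r\<^esub> \<cdots> \<partial>\<^bsub>j\<^sub>1\<^esub> (\<phi>\<^sup>i)\<close> and by \<open>det (\<phi>')\<^sup>-\<^sup>1\<close>\<close>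

lift_definition jet_test :: "'n::finite \<Rightarrow> 'n list \<Rightarrow> 'n diffeo \<Rightarrow> 'n test_function \<Rightarrow> 'n test_function"
  is "\<lambda>i js \<phi> f x. partials js (\<lambda>y. \<phi> y $ i) x *\<^sub>R f x"
  by (auto simp: orientation_preserving_diffeo_def elim: compact_support_mono
      intro!: smooth_bounded_bilinear[OF bounded_bilinear_scaleR] smooth_partials
        smooth_bounded_linear[OF bounded_linear_vec_nth])

lemma smooth_det_jacobian:
  assumes "smooth \<phi>"
  shows "smooth (\<lambda>x. det (jacobian \<phi> (at x)))"
proof -
  have "(\<lambda>x. det (jacobian \<phi> (at x))) = (\<lambda>x. \<Sum>p | p permutes UNIV. of_int (sign p) * (\<Prod>i\<in>UNIV. partial (p i) \<phi> x $ i))"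
    by (simp add: det_def jacobian_def matrix_def partial_def)
  then show ?thesis
    using assms by (simp add: smooth_sum smooth_prod smooth_const smooth_partial
      smooth_bounded_bilinear[OF bounded_bilinear_mult] smooth_bounded_linear[OF bounded_linear_vec_nth])
qed

lift_definition det_inverse_test :: "'n::finite diffeo \<Rightarrow> 'n test_function \<Rightarrow> 'n test_function"
  is "\<lambda>\<phi> f x. inverse (det (jacobian \<phi> (at x))) *\<^sub>R f x"
  by (auto simp: orientation_preserving_diffeo_def less_le elim: compact_support_mono
      intro!: smooth_bounded_bilinear[OF bounded_bilinear_scaleR] smooth_inverse smooth_det_jacobian)

section \<open>Algebras of operators\<close>

typedef (overloaded) 'a endo = "{T :: 'a::complex_vector \<Rightarrow> 'a. clinear T}"
  morphisms apply_endo Abs_endo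
  by (rule exI[of _ "\<lambda>x. x"]) (simp add: clinear_iff)

setup_lifting type_definition_endo

instantiation endo :: (complex_vector) complex_algebra_1
begin
lift_definition zero_endo :: "'a endo" is "\<lambda>x. 0" by (simp add: clinear_iff)
lift_definition one_endo :: "'a endo" is "\<lambda>x. x" by (simp add: clinear_iff)
lift_definition plus_endo :: "'a endo \<Rightarrow> 'a endo \<Rightarrow> 'a endo" is "\<lambda>S T x. S x + T x"
  by (simp add: clinear_iff scaleC_add_right algebra_simps)
lift_definition minus_endo :: "'a endo \<Rightarrow> 'a endo \<Rightarrow> 'a endo" is "\<lambda>S T x. S x - T x"
  by (simp add: clinear_iff complex_vector.scale_right_diff_distrib algebra_simps)
lift_definition uminus_endo :: "'a endo \<Rightarrow> 'a endo" is "\<lambda>T x. - T x"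
  by (simp add: clinear_iff)
lift_definition scaleC_endo :: "complex \<Rightarrow> 'a endo \<Rightarrow> 'a endo" is "\<lambda>c T x. c *\<^sub>C T x"
  by (simp add: clinear_iff scaleC_add_right scaleC_scaleC mult.commute)
lift_definition times_endo :: "'a endo \<Rightarrow> 'a endo \<Rightarrow> 'a endo" is "\<lambda>S T x. S (T x)"
  by (simp add: clinear_iff)
instance
  by standard (transfer;
    simp add: fun_eq_iff clinear_iff scaleC_add_right scaleC_add_left scaleC_scaleC scaleC_one add.assoc add.commute)+
end

inductive_set generated_subalgebra :: "'a::complex_algebra_1 set \<Rightarrow> 'a set" for G where
  gen: "x \<in> G \<Longrightarrow> x \<in> generated_subalgebra G"
| one: "1 \<in> generated_subalgebra G"
| add: "x \<in> generated_subalgebra G \<Longrightarrow> y \<in> generated_subalgebra G \<Longrightarrow> x + y \<in> generated_subalgebra G"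
| scale: "x \<in> generated_subalgebra G \<Longrightarrow> c *\<^sub>C x \<in> generated_subalgebra G"
| mult: "x \<in> generated_subalgebra G \<Longrightarrow> y \<in> generated_subalgebra G \<Longrightarrow> x * y \<in> generated_subalgebra G"

lemma generated_subalgebra_zero: "0 \<in> generated_subalgebra G"
  using generated_subalgebra.scale[OF generated_subalgebra.one, of 0] by simp

lemma generated_subalgebra_uminus: "x \<in> generated_subalgebra G \<Longrightarrow> - x \<in> generated_subalgebra G"
  using generated_subalgebra.scale[of x G "-1"] by (simp add: scaleC_one)

lemma generated_subalgebra_diff:
  "x \<in> generated_subalgebra G \<Longrightarrow> y \<in> generated_subalgebra G \<Longrightarrow> x - y \<in> generated_subalgebra G"
  using generated_subalgebra.add[OF _ generated_subalgebra_uminus] by fastforce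

definition crossed_map :: "('n diffeo \<Rightarrow> 'n test_function \<Rightarrow> 'n test_function) \<Rightarrow> 'n::finite crossed \<Rightarrow> 'n crossed" where
  "crossed_map t a = (\<Sum>\<phi>\<in>Poly_Mapping.keys a. Poly_Mapping.single \<phi> (t \<phi> (Poly_Mapping.lookup a \<phi>)))"

lemma lookup_crossed_map:
  assumes "clinear (t \<phi>)"
  shows "Poly_Mapping.lookup (crossed_map t a) \<phi> = t \<phi> (Poly_Mapping.lookup a \<phi>)"
proof -
  have "t \<phi> 0 = 0"
    using assms[unfolded clinear_iff, THEN conjunct2, rule_format, of 0 0] by simp
  moreover have "Poly_Mapping.lookup (crossed_map t a) \<phi> =
      (\<Sum>\<psi>\<in>Poly_Mapping.keys a. if \<psi> = \<phi> then t \<phi> (Poly_Mapping.lookup a \<phi>) else 0)"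
    unfolding crossed_map_def lookup_sum by (intro sum.cong) (auto simp: lookup_single when_def)
  ultimately show ?thesis by (auto simp: in_keys_iff)
qed

lemma clinear_crossed_map:
  assumes "\<And>\<phi>. clinear (t \<phi>)"
  shows "clinear (crossed_map t)"
proof (rule clinearI; rule poly_mapping_eqI)
  note lin = assms[unfolded clinear_iff]
  fix a b :: "'a crossed" and c \<phi>
  show "Poly_Mapping.lookup (crossed_map t (a + b)) \<phi> = Poly_Mapping.lookup (crossed_map t a + crossed_map t b) \<phi>"
    by (simp add: lookup_crossed_map assms lookup_add lin)
  show "Poly_Mapping.lookup (crossed_map t (c *\<^sub>C a)) \<phi> = Poly_Mapping.lookup (c *\<^sub>C crossed_map t a) \<phi>"
    by (simp add: lookup_crossed_map assms lookup_scaleC lin)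
qed

text \<open>
  \<open>X_op k\<close>, \<open>sigma_op i [j\<^sub>1, \<dots>, j\<^sub>r]\<close> and \<open>sigma_inv_op\<close> are the operators \<open>X\<^sub>k\<close>,
  \<open>\<sigma>\<^sup>i\<close> with lower indices \<open>j\<^sub>1, \<dots>, j\<^sub>r\<close> (only used for \<open>r \<ge> 1\<close>) and \<open>\<sigma>\<^sup>-\<^sup>1\<close>.
\<close>

lift_definition X_op :: "'n::finite \<Rightarrow> 'n crossed endo" is "\<lambda>k. crossed_map (\<lambda>\<phi>. partial_test k)"
proof (rule clinear_crossed_map, rule clinearI; transfer)
  fix k :: 'n and f g :: "real^'n \<Rightarrow> complex" and c :: complex
  assume f: "smooth f \<and> compact_support f"
  show "partial k (\<lambda>x. c * f x) = (\<lambda>x. c * partial k f x)"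
    using f by (intro partial_bounded_linear bounded_linear_mult_right) (simp add: smooth_differentiable)
  assume "smooth g \<and> compact_support g"
  then show "partial k (\<lambda>x. f x + g x) = (\<lambda>x. partial k f x + partial k g x)"
    using f by (simp add: partial_add smooth_differentiable)
qed

lift_definition sigma_op :: "'n::finite \<Rightarrow> 'n list \<Rightarrow> 'n crossed endo" is "\<lambda>i js. crossed_map (jet_test i js)"
  by (rule clinear_crossed_map, rule clinearI; transfer) (simp_all add: fun_eq_iff algebra_simps)

lift_definition sigma_inv_op :: "'n::finite crossed endo" is "crossed_map det_inverse_test"
  by (rule clinear_crossed_map, rule clinearI; transfer) (simp_all add: fun_eq_iff algebra_simps)

typedef 'n kn = "generated_subalgebra (range X_op \<union> {sigma_op i [j] | i j. True} \<union> {sigma_inv_op})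
    :: 'n::finite crossed endo set"
  using generated_subalgebra.one by blast

typedef 'n kab = "generated_subalgebra ({sigma_op i js | i js. js \<noteq> []} \<union> {sigma_inv_op})
    :: 'n::finite crossed endo set"
  using generated_subalgebra.one by blast

setup_lifting type_definition_kn
setup_lifting type_definition_kab

instantiation kn :: (finite) complex_algebra_1
begin
lift_definition zero_kn :: "'a kn" is 0 by (rule generated_subalgebra_zero)
lift_definition one_kn :: "'a kn" is 1 by (rule generated_subalgebra.one)
lift_definition plus_kn :: "'a kn \<Rightarrow> 'a kn \<Rightarrow> 'a kn" is "(+)" by (rule generated_subalgebra.add)
lift_definition minus_kn :: "'a kn \<Rightarrow> 'a kn \<Rightarrow> 'a kn" is "(-)" by (rule generated_subalgebra_diff)
lift_definition uminus_kn :: "'a kn \<Rightarrow> 'a kn" is uminus by (rule generated_subalgebra_uminus)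
lift_definition scaleC_kn :: "complex \<Rightarrow> 'a kn \<Rightarrow> 'a kn" is scaleC by (rule generated_subalgebra.scale)
lift_definition times_kn :: "'a kn \<Rightarrow> 'a kn \<Rightarrow> 'a kn" is "(*)" by (rule generated_subalgebra.mult)
instance
  by standard (transfer; simp add: scaleC_add_right scaleC_add_left scaleC_scaleC scaleC_one
    scaleC_mult_left scaleC_mult_right distrib_left distrib_right mult.assoc)+
end

instantiation kab :: (finite) complex_algebra_1
begin
lift_definition zero_kab :: "'a kab" is 0 by (rule generated_subalgebra_zero)
lift_definition one_kab :: "'a kab" is 1 by (rule generated_subalgebra.one)
lift_definition plus_kab :: "'a kab \<Rightarrow> 'a kab \<Rightarrow> 'a kab" is "(+)" by (rule generated_subalgebra.add)
lift_definition minus_kab :: "'a kab \<Rightarrow> 'a kab \<Rightarrow> 'a kab" is "(-)" by (rule generated_subalgebra_diff)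
lift_definition uminus_kab :: "'a kab \<Rightarrow> 'a kab" is uminus by (rule generated_subalgebra_uminus)
lift_definition scaleC_kab :: "complex \<Rightarrow> 'a kab \<Rightarrow> 'a kab" is scaleC by (rule generated_subalgebra.scale)
lift_definition times_kab :: "'a kab \<Rightarrow> 'a kab \<Rightarrow> 'a kab" is "(*)" by (rule generated_subalgebra.mult)
instance
  by standard (transfer; simp add: scaleC_add_right scaleC_add_left scaleC_scaleC scaleC_one
    scaleC_mult_left scaleC_mult_right distrib_left distrib_right mult.assoc)+
end

lift_definition sigma_kab :: "'n::finite \<Rightarrow> 'n \<Rightarrow> 'n kab" is "\<lambda>i j. sigma_op i [j]"
  by (rule generated_subalgebra.gen) blast

text \<open>
  Coproduct and counit of an algebra of operators on the crossed product, \<open>r\<close> being the inclusion.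
  The coproduct is characterised by \<open>k (a b) = k\<^sub>(\<^sub>1\<^sub>)(a) k\<^sub>(\<^sub>2\<^sub>)(b)\<close>.
\<close>

definition operator_comult ::
  "('k \<Rightarrow> 'n::finite crossed endo) \<Rightarrow> 'k::complex_vector \<Rightarrow> ('k, 'k) tensor" where
  "operator_comult r k = (THE t. \<forall>a b. apply_endo (r k) (crossed_mult a b) =
     tensor_lift (\<lambda>k1 k2. crossed_mult (apply_endo (r k1) a) (apply_endo (r k2) b)) t)"

text \<open>
  The crossed product has no unit: the constant function \<open>1\<close> does not have compact support. Since
  the operators are local, \<open>k 1\<close> still makes sense: the coefficient of \<open>U\<^sup>*\<^bsub>\<phi>\<^esub>\<close> in \<open>k 1\<close> at
  the point \<open>x\<close> is that of \<open>k (h U\<^sup>*\<^bsub>id\<^esub>)\<close>, for any test function \<open>h\<close> that is \<open>1\<close> near \<open>x\<close>.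
\<close>

definition value_at_one :: "'n::finite crossed endo \<Rightarrow> 'n diffeo \<Rightarrow> real^'n \<Rightarrow> complex" where
  "value_at_one k \<phi> x = (THE c. \<forall>h. (\<forall>\<^sub>F y in nhds x. Rep_test_function h y = 1) \<longrightarrow>
     Rep_test_function (Poly_Mapping.lookup (apply_endo k (Poly_Mapping.single diffeo_id h)) \<phi>) x = c)"

definition operator_counit :: "'n::finite crossed endo \<Rightarrow> complex" where
  "operator_counit k = (THE c. \<forall>\<phi> x. value_at_one k \<phi> x = (if \<phi> = diffeo_id then c else 0))"

definition kn_bialgebra :: "'n::finite kn bialg" where
  "kn_bialgebra = \<lparr>bmult = (*), bunit = 1, bcomult = operator_comult Rep_kn,
     bcounit = (\<lambda>k. operator_counit (Rep_kn k))\<rparr>"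

definition kab_bialgebra :: "'n::finite kab bialg" where
  "kab_bialgebra = \<lparr>bmult = (*), bunit = 1, bcomult = operator_comult Rep_kab,
     bcounit = (\<lambda>k. operator_counit (Rep_kab k))\<rparr>"

definition F_K :: "'n::finite kab bialg" where
  "F_K = co_opposite kab_bialgebra"

section \<open>The bicrossed product\<close>

text \<open>The Lie algebra \<open>V\<close>; the \<open>X\<^sub>k\<close> commute, so its bracket is zero.\<close>

typedef 'n lie_V = "complex_vector.span (range X_op) :: 'n::finite crossed endo set"
  using complex_vector.span_zero by blast

setup_lifting type_definition_lie_V

instantiation lie_V :: (finite) complex_lie_algebra
begin
lift_definition zero_lie_V :: "'a lie_V" is 0 by (rule complex_vector.span_zero)
lift_definition plus_lie_V :: "'a lie_V \<Rightarrow> 'a lie_V \<Rightarrow> 'a lie_V" is "(+)" by (rule complex_vector.span_add)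
lift_definition minus_lie_V :: "'a lie_V \<Rightarrow> 'a lie_V \<Rightarrow> 'a lie_V" is "(-)" by (rule complex_vector.span_diff)
lift_definition uminus_lie_V :: "'a lie_V \<Rightarrow> 'a lie_V" is uminus by (rule complex_vector.span_neg)
lift_definition scaleC_lie_V :: "complex \<Rightarrow> 'a lie_V \<Rightarrow> 'a lie_V" is scaleC by (rule complex_vector.span_scale)
definition lie_bracket_lie_V :: "'a lie_V \<Rightarrow> 'a lie_V \<Rightarrow> 'a lie_V" where "lie_bracket_lie_V x y = 0"
instance
  by standard (simp_all add: lie_bracket_lie_V_def,
    (transfer; simp add: scaleC_add_right scaleC_add_left scaleC_scaleC scaleC_one)+)
end

lift_definition X_V :: "'n::finite \<Rightarrow> 'n lie_V" is X_op
  by (rule complex_vector.span_base) (rule rangeI)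

type_synonym 'n UV = "'n lie_V envelope"

text \<open>\<open>x \<triangleright> f = [x, f]\<close>, which is again an element of \<open>\<K>\<^bsub>ab\<^esub>\<close>, and its extension to \<open>\<U>(V)\<close>\<close>

definition V_act :: "'n lie_V \<Rightarrow> 'n kab \<Rightarrow> 'n::finite kab" where
  "V_act x f = Abs_kab (Rep_lie_V x * Rep_kab f - Rep_kab f * Rep_lie_V x)"

definition UV_act :: "'n UV \<Rightarrow> 'n kab \<Rightarrow> 'n::finite kab"  (infixr \<open>\<triangleright>\<close> 75) where
  "u \<triangleright> f = envelope_act V_act u f"

definition coaction :: "'n::finite UV \<Rightarrow> ('n UV, 'n kab) tensor" where
  "coaction = (THE \<rho>. clinear \<rho> \<and> \<rho> 1 = 1 \<otimes>\<^sub>t 1 \<and>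
     (\<forall>l. \<rho> (envelope_of (X_V l)) = (\<Sum>k\<in>UNIV. envelope_of (X_V k) \<otimes>\<^sub>t sigma_kab k l)) \<and>
     (\<forall>u v. \<rho> (u * v) =
        tensor_lift (\<lambda>u1 u2. tensor_lift (\<lambda>u10 u11. tensor_lift (\<lambda>v0 v1.
          (u10 * v0) \<otimes>\<^sub>t (u11 * (u2 \<triangleright> v1))) (\<rho> v)) (\<rho> u1)) (envelope_comult u)))"

definition bicrossed_product :: "('n::finite kab, 'n UV) tensor bialg" where
  "bicrossed_product = \<lparr>
     bmult = (\<lambda>s t. tensor_lift (\<lambda>f u. tensor_lift (\<lambda>g v. tensor_lift (\<lambda>u1 u2.
       (f * (u1 \<triangleright> g)) \<otimes>\<^sub>t (u2 * v)) (envelope_comult u)) t) s),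
     bunit = 1 \<otimes>\<^sub>t 1,
     bcomult = tensor_lift (\<lambda>f u. tensor_lift (\<lambda>f1 f2. tensor_lift (\<lambda>u1 u2. tensor_lift (\<lambda>u10 u11.
       (f1 \<otimes>\<^sub>t u10) \<otimes>\<^sub>t ((f2 * u11) \<otimes>\<^sub>t u2)) (coaction u1)) (envelope_comult u)) (bcomult F_K f)),
     bcounit = tensor_lift (\<lambda>f u. bcounit F_K f * envelope_counit u)\<rparr>"

definition I_map :: "('n::finite kab, 'n UV) tensor \<Rightarrow> 'n kn" where
  "I_map = tensor_lift (\<lambda>f u. Abs_kn (Rep_kab f * envelope_lift Rep_lie_V u))"

end

theory Submission
  imports Defs
begin

text \<open>
  An operator \<open>f \<in> \<K>\<^bsub>ab\<^esub>\<close> multiplies \<open>h U\<^sup>*\<^bsub>\<phi>\<^esub>\<close> by a function built from the jets of \<open>\<phi>\<close>, and \<open>X\<^sub>l\<close> acts on \<open>h\<close> by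
  \<open>\<partial>\<^sub>l\<close>. So \<open>\<I>(f \<bowtie> u) = f u\<close> is the differential operator \<open>u\<close> with the coefficient \<open>f\<close> in front, and the bicrossed
  product consists of differential operators in normal form. That \<open>u\<close> can be moved past a coefficient is the
  Leibniz rule \<open>u g = (u\<^sub>(\<^sub>1\<^sub>) \<triangleright> g) u\<^sub>(\<^sub>2\<^sub>)\<close> (\<open>UV_leibniz\<close>); it makes \<open>\<I>\<close> multiplicative, and as the generators
  of \<open>\<K>\<^sub>n\<close> lie in the image, \<open>\<I>\<close> is surjective. Injectivity says that the normal form is unique: applying an
  operator to test functions that are monomials near a point \<open>x\<close> reads off its coefficients at \<open>x\<close>
  (\<open>separating_UV\<close>, \<open>I_map_eq_0\<close>).

  For the coproducts, existence and uniqueness have to be settled as well. Existence is checked on generators;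
  for \<open>\<K>\<^bsub>ab\<^esub>\<close> it is carried from \<open>\<sigma>\<^sup>i\<^sub>j\<close> to the higher jets by commutators with \<open>X\<^sub>l\<close> (\<open>is_coproduct_commutator\<close>).
  Uniqueness, coassociativity and the counit laws follow from a pairing: the numbers
  \<open>(k (h U\<^sup>*\<^bsub>\<phi>\<^esub>))\<^bsub>\<phi>\<^esub> (x)\<close> determine \<open>k\<close>, hence their products determine tensors of operators (\<open>separating_tensor\<close>), and
  under this pairing the coproduct is dual to the multiplication of the crossed product. The one obstacle is that
  \<open>(h U\<^sup>*\<^bsub>\<phi>\<^esub>) (l U\<^sup>*\<^bsub>\<psi>\<^esub>)\<close> evaluated at \<open>x\<close> involves \<open>l\<close> only at \<open>\<phi> x\<close>; it disappears since the operators do not notice a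
  translation after \<open>\<phi>\<close>, which moves \<open>\<phi> x\<close> to any point (\<open>natural_coalgebra\<close>).

  The coaction on \<open>\<U>(V)\<close> is the orbit of \<open>1 \<otimes> 1\<close> under an action of \<open>\<U>(V)\<close> (\<open>coaction_eq\<close>). With it
  \<open>u\<^sub>(\<^sub>1\<^sub>)\<^sub>\<langle>\<^sub>0\<^sub>\<rangle> \<otimes> u\<^sub>(\<^sub>1\<^sub>)\<^sub>\<langle>\<^sub>1\<^sub>\<rangle> u\<^sub>(\<^sub>2\<^sub>)\<close> is the opposite coproduct of the operator \<open>u\<close> (\<open>UV_coproduct\<close>), so \<open>\<I>\<close> respects the
  coproducts. Finally the bialgebra axioms of the bicrossed product need no separate proof: they are transported
  along the bijection \<open>\<I>\<close> from \<open>\<K>\<^sub>n\<^sup>c\<^sup>o\<^sup>p\<close> (\<open>bialgebra_iso_transport\<close>).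
\<close>

section \<open>Linear maps on tensor products\<close>

lemma
  assumes "clinear f"
  shows clinear_add: "f (x + y) = f x + f y"
    and clinear_scale: "f (c *\<^sub>C x) = c *\<^sub>C f x"
    and clinear_zero: "f 0 = 0"
    and clinear_diff: "f (x - y) = f x - f y"
    and clinear_minus: "f (- x) = - f x"
    and clinear_sum: "f (\<Sum>i\<in>A. u i) = (\<Sum>i\<in>A. f (u i))"
proof -
  interpret Vector_Spaces.linear scaleC scaleC f by (rule assms)
  show "f (x + y) = f x + f y" "f (c *\<^sub>C x) = c *\<^sub>C f x" "f 0 = 0" "f (x - y) = f x - f y"
    "f (- x) = - f x" "f (\<Sum>i\<in>A. u i) = (\<Sum>i\<in>A. f (u i))"
    by (rule add scale zero diff neg sum)+
qed

lemma cbilinear_by_args: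
  "(\<And>x. clinear (f x)) \<Longrightarrow> (\<And>y. clinear (\<lambda>x. f x y)) \<Longrightarrow> cbilinear f"
  by (simp add: cbilinear_def)

lemma clinear_compose: "clinear f \<Longrightarrow> clinear g \<Longrightarrow> clinear (\<lambda>x. f (g x))"
  by (simp add: clinear_iff)

lemma cbilinear_apply:
  assumes "cbilinear f"
  shows "clinear g \<Longrightarrow> clinear (\<lambda>x. f (g x) y)" and "clinear h \<Longrightarrow> clinear (\<lambda>y. f x (h y))"
  using cbilinearD[OF assms] by (auto simp: clinear_iff)

lemma clinear_ident: "clinear (\<lambda>x. x)"
  and clinear_plus_fun: "clinear f \<Longrightarrow> clinear g \<Longrightarrow> clinear (\<lambda>x. f x + g x)"
  and clinear_diff_fun: "clinear f \<Longrightarrow> clinear g \<Longrightarrow> clinear (\<lambda>x. f x - g x)"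
  and clinear_scale_fun: "clinear f \<Longrightarrow> clinear (\<lambda>x. c *\<^sub>C f x)"
  and clinear_sum_fun: "(\<And>i. i \<in> A \<Longrightarrow> clinear (F i)) \<Longrightarrow> clinear (\<lambda>x. \<Sum>i\<in>A. F i x)"
  by (simp_all add: clinear_iff scaleC_add_right scaleC_add_left scaleC_scaleC mult.commute
      complex_vector.scale_right_diff_distrib algebra_simps sum.distrib complex_vector.scale_sum_right)

lemma clinear_functional_fun: "clinear h \<Longrightarrow> clinear (\<lambda>x. h x *\<^sub>C v)"
  unfolding clinear_iff by (simp add: scaleC_add_left scaleC_complex_def scaleC_scaleC)

text \<open>
  In Sweedler notation \<^const>\<open>tensor_lift\<close> is a summation sign, so linear maps pass through it, and a
  summand that depends linearly on a further argument makes the sum depend linearly on it.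
\<close>

lemma clinear_tensor_lift_fun:
  "clinear L \<Longrightarrow> L (tensor_lift G t) = tensor_lift (\<lambda>x y. L (G x y)) t"
  by (simp add: tensor_lift_def linear_extension_def clinear_sum clinear_scale case_prod_unfold)

lemma clinear_tensor_lift_param:
  assumes "\<And>u v. clinear (\<lambda>x. G x u v)"
  shows "clinear (\<lambda>x. tensor_lift (G x) t)"
proof (rule clinearI)
  have "G (x + y) = (\<lambda>u v. G x u v + G y u v)" for x y
    by (intro ext) (rule clinear_add[OF assms])
  then show "tensor_lift (G (x + y)) t = tensor_lift (G x) t + tensor_lift (G y) t" for x y
    by (simp add: tensor_lift_add_fun)
  have "G (c *\<^sub>C x) = (\<lambda>u v. c *\<^sub>C G x u v)" for c x
    by (intro ext) (rule clinear_scale[OF assms])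
  then show "tensor_lift (G (c *\<^sub>C x)) t = c *\<^sub>C tensor_lift (G x) t" for c x
    by (simp add: tensor_lift_scale_fun)
qed

lemma tensor_lift_sum_fun: "tensor_lift (\<lambda>x y. \<Sum>i\<in>A. G i x y) t = (\<Sum>i\<in>A. tensor_lift (G i) t)"
  by (simp add: tensor_lift_def linear_extension_def case_prod_unfold complex_vector.scale_sum_right
      sum.swap[of _ A])

lemmas clinear_tensor_lift_arg = clinear_compose[OF clinear_tensor_lift]

lemmas clinear_intros = clinear_ident clinear_plus_fun clinear_diff_fun clinear_scale_fun
  clinear_functional_fun clinear_sum_fun cbilinear_apply[OF cbilinear_times]
  cbilinear_apply[OF cbilinear_tensor_elem] clinear_tensor_lift_param
  clinear_tensor_lift_arg cbilinear_by_args

lemma tensor_ext: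
  assumes "clinear f" "clinear g" "\<And>x y. f (x \<otimes>\<^sub>t y) = g (x \<otimes>\<^sub>t y)"
  shows "f t = g t"
  by (induction t rule: tensor_induct) (simp_all add: assms(3) clinear_add[OF assms(1)] clinear_add[OF assms(2)])

lemmas tensor_add_left = cbilinearD(1)[OF cbilinear_tensor_elem]
  and tensor_add_right = cbilinearD(2)[OF cbilinear_tensor_elem]
  and tensor_scale_left = cbilinearD(3)[OF cbilinear_tensor_elem]
  and tensor_scale_right = cbilinearD(4)[OF cbilinear_tensor_elem]

lemma tensor_sum_right: "x \<otimes>\<^sub>t (\<Sum>i\<in>A. g i) = (\<Sum>i\<in>A. x \<otimes>\<^sub>t g i)"
  by (rule clinear_sum, intro clinear_intros)

lemma tensor_zero_left: "0 \<otimes>\<^sub>t y = 0" and tensor_zero_right: "x \<otimes>\<^sub>t 0 = 0"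
  using tensor_scale_left[of 0 0 y] tensor_scale_right[of x 0 0] by simp_all

lemma tensor_mult_elem': "(x \<otimes>\<^sub>t y) * (x' \<otimes>\<^sub>t y') = (x * x') \<otimes>\<^sub>t (y * y')"
  for x x' :: "'a::complex_algebra_1" and y y' :: "'b::complex_algebra_1"
  unfolding times_tensor_def by (intro tensor_mult_elem cbilinear_times)

lemma clinear_tensor_map: "clinear f \<Longrightarrow> clinear g \<Longrightarrow> clinear (tensor_map f g)"
  and tensor_map_elem: "clinear f \<Longrightarrow> clinear g \<Longrightarrow> tensor_map f g (x \<otimes>\<^sub>t y) = f x \<otimes>\<^sub>t g y"
  unfolding tensor_map_def
  by (intro clinear_tensor_lift cbilinear_by_args clinear_intros, assumption+)
     (intro tensor_lift_elem cbilinear_by_args clinear_intros, assumption+)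

lemma clinear_tensor_swap: "clinear tensor_swap"
  and tensor_swap_elem: "tensor_swap (x \<otimes>\<^sub>t y) = y \<otimes>\<^sub>t x"
  unfolding tensor_swap_def
  by (intro clinear_tensor_lift cbilinear_by_args clinear_intros)
     (intro tensor_lift_elem cbilinear_by_args clinear_intros)

lemma clinear_tensor_assoc: "clinear (tensor_assoc ::
    (('a::complex_vector, 'b::complex_vector) tensor, 'c::complex_vector) tensor \<Rightarrow> _)"
  and tensor_assoc_elem: "tensor_assoc (((x :: 'a) \<otimes>\<^sub>t (y :: 'b)) \<otimes>\<^sub>t (z :: 'c)) = x \<otimes>\<^sub>t y \<otimes>\<^sub>t z"
proof -
  have inner: "cbilinear (\<lambda>(x :: 'a) (y :: 'b). x \<otimes>\<^sub>t y \<otimes>\<^sub>t z)" for z :: 'c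
    by (intro cbilinear_by_args clinear_intros)
  have outer: "cbilinear (\<lambda>s (z :: 'c). tensor_lift (\<lambda>(x :: 'a) (y :: 'b). x \<otimes>\<^sub>t y \<otimes>\<^sub>t z) s)"
    by (intro cbilinear_by_args clinear_intros)
  show "clinear (tensor_assoc :: (('a, 'b) tensor, 'c) tensor \<Rightarrow> _)"
    unfolding tensor_assoc_def by (rule clinear_tensor_lift[OF outer])
  show "tensor_assoc ((x \<otimes>\<^sub>t y) \<otimes>\<^sub>t z) = x \<otimes>\<^sub>t y \<otimes>\<^sub>t z" for x :: 'a and y :: 'b and z :: 'c
    unfolding tensor_assoc_def by (simp only: tensor_lift_elem[OF outer] tensor_lift_elem[OF inner])
qed

lemma tensor_map_comp:
  assumes "clinear f" "clinear g" "clinear f'" "clinear g'"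
  shows "tensor_map f g (tensor_map f' g' t) = tensor_map (\<lambda>x. f (f' x)) (\<lambda>y. g (g' y)) t"
  by (rule tensor_ext[where t = t])
     (simp_all add: assms tensor_map_elem clinear_compose[of "tensor_map f g"] clinear_tensor_map
       clinear_compose)

lemma tensor_swap_map:
  assumes "clinear f" "clinear g"
  shows "tensor_swap (tensor_map f g t) = tensor_map g f (tensor_swap t)"
  by (rule tensor_ext[where t = t])
     (simp_all add: assms tensor_map_elem tensor_swap_elem clinear_compose clinear_tensor_map
       clinear_tensor_swap)

lemma tensor_map_ident: "tensor_map (\<lambda>x. x) (\<lambda>x. x) t = t"
  by (rule tensor_ext[where t = t]) (simp_all add: tensor_map_elem clinear_tensor_map clinear_ident)

section \<open>Separating families of functionals\<close>

definition separating :: "('a::complex_vector \<Rightarrow> complex) set \<Rightarrow> bool" where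
  "separating F \<longleftrightarrow> (\<forall>f\<in>F. clinear f) \<and> (\<forall>x. (\<forall>f\<in>F. f x = 0) \<longrightarrow> x = 0)"

definition tensor_functional :: "('a::complex_vector \<Rightarrow> complex) \<Rightarrow> ('b::complex_vector \<Rightarrow> complex) \<Rightarrow>
  ('a, 'b) tensor \<Rightarrow> complex" where
  "tensor_functional f g = tensor_lift (\<lambda>x y. f x * g y)"

lemma clinear_tensor_functional: "clinear f \<Longrightarrow> clinear g \<Longrightarrow> clinear (tensor_functional f g)"
  and tensor_functional_elem:
    "clinear f \<Longrightarrow> clinear g \<Longrightarrow> tensor_functional f g (x \<otimes>\<^sub>t y) = f x * g y"
  unfolding tensor_functional_def
  by (intro clinear_tensor_lift cbilinear_by_args clinear_intros, assumption+)
     (intro tensor_lift_elem cbilinear_by_args clinear_intros, assumption+)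

text \<open>
  If the right-hand factors are moreover linearly independent, the tensor determines the left-hand factors, and
  its vanishing can be tested on them one by one.
\<close>

lemma tensor_basis_decomp:
  fixes t :: "('a::complex_vector, 'b::complex_vector) tensor"
  assumes B: "complex_vector.span B = UNIV"
  obtains S a where "finite S" "S \<subseteq> B" "t = (\<Sum>b\<in>S. a b \<otimes>\<^sub>t b)"
proof -
  have "\<exists>S a. finite S \<and> S \<subseteq> B \<and> t = (\<Sum>b\<in>S. a b \<otimes>\<^sub>t b)"
  proof (induction t rule: tensor_induct)
    case (elem x y)
    have "y \<in> complex_vector.span B" using B by simp
    then obtain S c where S: "finite S" "S \<subseteq> B" "y = (\<Sum>b\<in>S. c b *\<^sub>C b)"
      unfolding complex_vector.span_explicit by blast
    then have "x \<otimes>\<^sub>t y = (\<Sum>b\<in>S. (c b *\<^sub>C x) \<otimes>\<^sub>t b)"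
      by (simp add: tensor_sum_right tensor_scale_left tensor_scale_right)
    with S show ?case by (intro exI[of _ S] exI[of _ "\<lambda>b. c b *\<^sub>C x"]) simp
  next
    case (add s t)
    then obtain S a S' a' where
      S: "finite S" "S \<subseteq> B" "s = (\<Sum>b\<in>S. a b \<otimes>\<^sub>t b)" and
      S': "finite S'" "S' \<subseteq> B" "t = (\<Sum>b\<in>S'. a' b \<otimes>\<^sub>t b)" by blast
    have "s = (\<Sum>b\<in>S \<union> S'. (if b \<in> S then a b else 0) \<otimes>\<^sub>t b)"
      unfolding S(3) using S S' by (intro sum.mono_neutral_cong_left) (auto simp: tensor_zero_left)
    moreover have "t = (\<Sum>b\<in>S \<union> S'. (if b \<in> S' then a' b else 0) \<otimes>\<^sub>t b)"
      unfolding S'(3) using S S' by (intro sum.mono_neutral_cong_left) (auto simp: tensor_zero_left)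
    ultimately have "s + t = (\<Sum>b\<in>S \<union> S'. ((if b \<in> S then a b else 0) + (if b \<in> S' then a' b else 0)) \<otimes>\<^sub>t b)"
      by (simp only: tensor_add_left sum.distrib)
    with S S' show ?case
      by (intro exI[of _ "S \<union> S'"] exI[of _ "\<lambda>b. (if b \<in> S then a b else 0) + (if b \<in> S' then a' b else 0)"])
        auto
  qed
  then show ?thesis using that by blast
qed

text \<open>
  The functionals in \<open>F\<close> test the left-hand factors of a basis decomposition. That \<open>G\<close> may depend on \<open>f\<close> is for pairs of
  functionals that refer to a common point.
\<close>

lemma tensor_eq_0I:
  fixes t :: "('a::complex_vector, 'b::complex_vector) tensor"
  assumes F: "separating F"
    and G: "\<And>f. f \<in> F \<Longrightarrow> \<exists>G. separating G \<and> (\<forall>g\<in>G. tensor_functional f g t = 0)"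
  shows "t = 0"
proof -
  obtain B :: "'b set" where ind: "\<not> complex_vector.dependent B" and B: "complex_vector.span B = UNIV"
    using complex_vector.basis_exists[of "UNIV :: 'b set"] by (metis UNIV_eq_I subsetD UNIV_I)
  obtain S a where S: "finite S" "S \<subseteq> B" "t = (\<Sum>b\<in>S. a b \<otimes>\<^sub>t b)"
    by (rule tensor_basis_decomp[OF B, of t])
  have "f (a b) = 0" if f: "f \<in> F" and b: "b \<in> S" for f b
  proof -
    obtain G where G: "separating G" "\<And>g. g \<in> G \<Longrightarrow> tensor_functional f g t = 0"
      using G[OF f] by blast
    have "g (\<Sum>b\<in>S. f (a b) *\<^sub>C b) = 0" if g: "g \<in> G" for g
    proof -
      have lin: "clinear f" "clinear g"
        using F G(1) f g by (auto simp: separating_def)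
      have "g (\<Sum>b\<in>S. f (a b) *\<^sub>C b) = tensor_functional f g t"
        by (simp add: S(3) clinear_sum[OF lin(2)] clinear_scale[OF lin(2)]
            clinear_sum[OF clinear_tensor_functional[OF lin]] tensor_functional_elem[OF lin] scaleC_complex_def)
      then show ?thesis using G(2)[OF g] by simp
    qed
    then have "(\<Sum>b\<in>S. f (a b) *\<^sub>C b) = 0"
      using G(1) unfolding separating_def by blast
    then show ?thesis
      using complex_vector.independentD[OF ind S(1,2), of "\<lambda>b. f (a b)"] b by blast
  qed
  then have "a b = 0" if "b \<in> S" for b
    using F that unfolding separating_def by blast
  then show "t = 0" by (simp add: S(3) tensor_zero_left)
qed

lemma separating_tensor:
  assumes F: "separating F" and G: "separating G"
  shows "separating {tensor_functional f g | f g. f \<in> F \<and> g \<in> G}"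
  unfolding separating_def
proof (intro conjI ballI allI impI)
  have lin: "f \<in> F \<Longrightarrow> clinear f" "g \<in> G \<Longrightarrow> clinear g" for f g
    using F G by (auto simp: separating_def)
  show "clinear \<xi>" if "\<xi> \<in> {tensor_functional f g | f g. f \<in> F \<and> g \<in> G}" for \<xi>
    using that lin by (auto intro: clinear_tensor_functional)
  fix t assume t: "\<forall>\<xi>\<in>{tensor_functional f g | f g. f \<in> F \<and> g \<in> G}. \<xi> t = 0"
  have "tensor_functional f g t = 0" if "f \<in> F" "g \<in> G" for f g
    by (rule bspec[OF t]) (use that in blast)
  then show "t = 0" using G by (intro tensor_eq_0I[OF F] exI[of _ G]) simp
qed

lemma separating_eqI:
  assumes "separating F" "\<And>f. f \<in> F \<Longrightarrow> f x = f y"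
  shows "x = y"
proof -
  have "f (x - y) = 0" if "f \<in> F" for f
    using assms that by (simp add: separating_def clinear_diff)
  then have "x - y = 0" using assms(1) unfolding separating_def by blast
  then show ?thesis by simp
qed

section \<open>Smooth functions\<close>

lemma has_real_derivative_along_axis:
  fixes f :: "real^'n \<Rightarrow> real"
  assumes "f differentiable at (x + t *\<^sub>R axis k 1)"
  shows "((\<lambda>t. f (x + t *\<^sub>R axis k 1)) has_real_derivative partial k f (x + t *\<^sub>R axis k 1)) (at t)"
proof -
  let ?x = "x + t *\<^sub>R axis k 1"
  have f': "(f has_derivative frechet_derivative f (at ?x)) (at ?x)"
    using assms frechet_derivative_works by blast
  have "((\<lambda>t. x + t *\<^sub>R axis k 1) has_derivative (\<lambda>s. s *\<^sub>R axis k 1)) (at t)"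
    by (auto intro!: derivative_eq_intros)
  from has_derivative_compose[OF this f']
  have "((\<lambda>t. f (x + t *\<^sub>R axis k 1)) has_derivative (\<lambda>s. frechet_derivative f (at ?x) (s *\<^sub>R axis k 1))) (at t)" .
  moreover have "frechet_derivative f (at ?x) (s *\<^sub>R axis k 1) = partial k f ?x * s" for s
    using linear_scale[OF has_derivative_linear[OF f']] by (simp add: partial_def)
  ultimately show ?thesis by (simp add: has_field_derivative_def)
qed

text \<open>
  The second difference of \<open>f\<close> over a small square, divided by the area, is a value of \<open>\<partial>\<^sub>k \<partial>\<^sub>j f\<close> near the corner,
  by the mean value theorem in each direction. As it is symmetric in \<open>j\<close> and \<open>k\<close>, the limit of small
  squares gives the symmetry of second derivatives.
\<close>

lemma second_difference_mean_value:
  fixes f :: "real^'n \<Rightarrow> real"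
  assumes f: "smooth f" and h: "h > 0"
  shows "\<exists>y. dist y x \<le> 2 * h \<and>
    f (x + h *\<^sub>R axis j 1 + h *\<^sub>R axis k 1) - f (x + h *\<^sub>R axis j 1) - f (x + h *\<^sub>R axis k 1) + f x
      = h * h * partial k (partial j f) y"
proof -
  define g where "g s = f (x + h *\<^sub>R axis k 1 + s *\<^sub>R axis j 1) - f (x + s *\<^sub>R axis j 1)" for s
  have "\<exists>s. 0 < s \<and> s < h \<and> g h - g 0 =
      (h - 0) * (partial j f (x + h *\<^sub>R axis k 1 + s *\<^sub>R axis j 1) - partial j f (x + s *\<^sub>R axis j 1))"
    unfolding g_def using h
    by (intro MVT2 DERIV_diff has_real_derivative_along_axis smooth_differentiable[OF f])
  then obtain s where s: "0 < s" "s < h" "g h - g 0 =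
      h * (partial j f (x + h *\<^sub>R axis k 1 + s *\<^sub>R axis j 1) - partial j f (x + s *\<^sub>R axis j 1))"
    by auto
  let ?x = "x + s *\<^sub>R axis j 1"
  have "\<exists>t. 0 < t \<and> t < h \<and> partial j f (?x + h *\<^sub>R axis k 1) - partial j f (?x + 0 *\<^sub>R axis k 1)
      = (h - 0) * partial k (partial j f) (?x + t *\<^sub>R axis k 1)"
    using h by (intro MVT2 has_real_derivative_along_axis smooth_differentiable smooth_partial f)
  then obtain t where t: "0 < t" "t < h" "partial j f (?x + h *\<^sub>R axis k 1) - partial j f ?x
      = h * partial k (partial j f) (?x + t *\<^sub>R axis k 1)"
    by auto
  have "g h - g 0 = h * h * partial k (partial j f) (?x + t *\<^sub>R axis k 1)"
    using s(3) t(3) by (simp add: algebra_simps)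
  moreover have "dist (?x + t *\<^sub>R axis k 1) x \<le> 2 * h"
  proof -
    have "dist (?x + t *\<^sub>R axis k 1) x \<le> norm (s *\<^sub>R (axis j 1 :: real^'n)) + norm (t *\<^sub>R (axis k 1 :: real^'n))"
      unfolding dist_norm by (metis add.assoc add_diff_cancel_left' norm_triangle_ineq)
    also have "\<dots> \<le> 2 * h" using s t by simp
    finally show ?thesis .
  qed
  ultimately show ?thesis
    by (intro exI[of _ "?x + t *\<^sub>R axis k 1"]) (simp add: g_def algebra_simps)
qed

lemma smooth_isCont: "smooth f \<Longrightarrow> isCont f x"
  using smooth_differentiable differentiable_imp_continuous_within by blast

lemma partial_commute_real:
  fixes f :: "real^'n \<Rightarrow> real"
  assumes f: "smooth f"
  shows "partial k (partial j f) x = partial j (partial k f) x"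
proof -
  define h :: "nat \<Rightarrow> real" where "h n = inverse (real (Suc n))" for n
  have h: "h n > 0" for n by (simp add: h_def)
  have "\<exists>y z. dist y x \<le> 2 * h n \<and> dist z x \<le> 2 * h n \<and>
      partial k (partial j f) y = partial j (partial k f) z" for n
  proof -
    let ?d = "f (x + h n *\<^sub>R axis j 1 + h n *\<^sub>R axis k 1) - f (x + h n *\<^sub>R axis j 1) - f (x + h n *\<^sub>R axis k 1) + f x"
    obtain y where y: "dist y x \<le> 2 * h n" "?d = h n * h n * partial k (partial j f) y"
      using second_difference_mean_value[OF f h, of x n j k] by blast
    have "x + h n *\<^sub>R axis k 1 + h n *\<^sub>R axis j 1 = x + h n *\<^sub>R axis j 1 + h n *\<^sub>R axis k 1" by simp
    then obtain z where z: "dist z x \<le> 2 * h n" "?d = h n * h n * partial j (partial k f) z"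
      using second_difference_mean_value[OF f h, of x n k j] by (smt (verit, best))
    from y z h[of n] show ?thesis by (metis mult_cancel_left mult_pos_pos less_irrefl)
  qed
  then obtain y z where yz: "\<And>n. dist (y n) x \<le> 2 * h n" "\<And>n. dist (z n) x \<le> 2 * h n"
    "\<And>n. partial k (partial j f) (y n) = partial j (partial k f) (z n)"
    by metis
  have "(\<lambda>n. 2 * h n) \<longlonglongrightarrow> 0"
    using LIMSEQ_inverse_real_of_nat tendsto_mult_right_zero unfolding h_def by blast
  have "w \<longlonglongrightarrow> x" if "\<And>n. dist (w n) x \<le> 2 * h n" for w
    unfolding tendsto_dist_iff[of w x]
    by (rule tendsto_sandwich[OF _ _ tendsto_const \<open>(\<lambda>n. 2 * h n) \<longlonglongrightarrow> 0\<close>]) (use that in auto)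
  then have lim: "y \<longlonglongrightarrow> x" "z \<longlonglongrightarrow> x" using yz(1,2) by blast+
  have "(\<lambda>n. partial k (partial j f) (y n)) \<longlonglongrightarrow> partial k (partial j f) x"
    by (intro isCont_tendsto_compose[OF _ lim(1)] smooth_isCont smooth_partial f)
  moreover have "(\<lambda>n. partial k (partial j f) (y n)) \<longlonglongrightarrow> partial j (partial k f) x"
    unfolding yz(3) by (intro isCont_tendsto_compose[OF _ lim(2)] smooth_isCont smooth_partial f)
  ultimately show ?thesis by (rule LIMSEQ_unique)
qed

lemma partial_commute_complex:
  fixes f :: "real^'n \<Rightarrow> complex"
  assumes f: "smooth f"
  shows "partial k (partial j f) x = partial j (partial k f) x"
proof -
  have "L (partial k (partial j f) x) = L (partial j (partial k f) x)"
    if L: "bounded_linear L" for L :: "complex \<Rightarrow> real"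
  proof -
    have "partial k (partial j (\<lambda>x. L (f x))) = (\<lambda>x. L (partial k (partial j f) x))" for j k
      using f by (simp add: partial_bounded_linear[OF L] smooth_differentiable smooth_partial)
    then show ?thesis
      using partial_commute_real[OF smooth_bounded_linear[OF L f]] by metis
  qed
  from this[OF bounded_linear_Re] this[OF bounded_linear_Im] show ?thesis
    by (simp add: complex_eq_iff)
qed

lemma partial_cong_germ:
  fixes f g :: "real^'a \<Rightarrow> 'b::real_normed_vector"
  assumes "\<forall>\<^sub>F y in nhds x. f y = g y"
  shows "\<forall>\<^sub>F y in nhds x. partial j f y = partial j g y"
proof -
  have "frechet_derivative f (at y) = frechet_derivative g (at y)" if "\<forall>\<^sub>F z in nhds y. f z = g z" for y
  proof -
    have "(v has_derivative D) (at y)" if "(u has_derivative D) (at y)" "\<forall>\<^sub>F z in nhds y. u z = v z"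
      for D and u v :: "real^'a \<Rightarrow> 'b"
      using that by (intro has_derivative_transform_eventually[OF that(1)])
        (auto simp: eventually_at_filter dest: eventually_nhds_x_imp_x elim: eventually_mono)
    from this[of f _ g] this[of g _ f] have "(f has_derivative D) (at y) \<longleftrightarrow> (g has_derivative D) (at y)" for D
      using that by (auto simp: eq_commute)
    then show ?thesis by (simp add: frechet_derivative_def)
  qed
  moreover have "\<forall>\<^sub>F y in nhds x. \<forall>\<^sub>F z in nhds y. f z = g z"
    using assms by (simp add: eventually_eventually)
  ultimately show ?thesis by (auto elim: eventually_mono simp: partial_def)
qed

lemma partial_chain:
  fixes f :: "real^'n \<Rightarrow> 'b::real_normed_vector" and \<phi> :: "real^'n \<Rightarrow> real^'n"
  assumes "\<And>x. f differentiable at x" "\<And>x. \<phi> differentiable at x"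
  shows "partial j (\<lambda>x. f (\<phi> x)) x = (\<Sum>i\<in>UNIV. partial j (\<lambda>y. \<phi> y $ i) x *\<^sub>R partial i f (\<phi> x))"
proof -
  have f': "(f has_derivative frechet_derivative f (at (\<phi> x))) (at (\<phi> x))"
    and \<phi>': "(\<phi> has_derivative frechet_derivative \<phi> (at x)) (at x)"
    using assms frechet_derivative_works by blast+
  interpret linear "frechet_derivative f (at (\<phi> x))"
    using f' by (rule has_derivative_linear)
  have comp: "partial j (\<lambda>y. \<phi> y $ i) x = partial j \<phi> x $ i" for i
    using assms(2) by (simp add: partial_bounded_linear[OF bounded_linear_vec_nth])
  have "partial j (\<lambda>x. f (\<phi> x)) x = frechet_derivative f (at (\<phi> x)) (partial j \<phi> x)"
    using partial_eq[OF has_derivative_compose[OF \<phi>' f']] by (simp add: partial_def)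
  also have "\<dots> = frechet_derivative f (at (\<phi> x)) (\<Sum>i\<in>UNIV. (partial j \<phi> x $ i) *\<^sub>R axis i 1)"
    using basis_expansion[of "partial j \<phi> x"] by (simp add: scalar_mult_eq_scaleR)
  finally show ?thesis
    by (simp add: sum scaleR partial_def comp[unfolded partial_def])
qed

section \<open>Test functions with prescribed germs\<close>

text \<open>
  The functions \<open>x\<^sup>-\<^sup>m exp (- 1 / x)\<close>, continued by \<open>0\<close> to \<open>x \<le> 0\<close>, span a space that is closed under
  differentiation; so the one with \<open>m = 0\<close> is smooth.
\<close>

definition flat :: "nat \<Rightarrow> real \<Rightarrow> real" where
  "flat m x = (if x > 0 then inverse x ^ m * exp (- inverse x) else 0)"

lemma tendsto_flat_0: "(flat m \<longlongrightarrow> 0) (at 0)"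
proof (rule filterlim_split_at)
  show "(flat m \<longlongrightarrow> 0) (at_left 0)"
    by (rule tendsto_eventually) (simp add: eventually_at_left_field flat_def, rule exI[of _ "-1"], simp)
  have "((\<lambda>x::real. inverse x ^ m / exp (inverse x)) \<longlongrightarrow> 0) (at_right 0)"
    by (rule filterlim_compose[OF tendsto_power_div_exp_0 filterlim_inverse_at_top_right])
  then show "(flat m \<longlongrightarrow> 0) (at_right 0)"
    by (rule Lim_transform_eventually)
       (simp add: eventually_at_right_field flat_def exp_minus divide_inverse, rule exI[of _ 1], simp)
qed

lemma has_real_derivative_flat:
  "(flat m has_real_derivative flat (m + 2) x - real m * flat (m + 1) x) (at x)"
proof (cases "x = 0" "x > 0" rule: bool.exhaust[case_product bool.exhaust])
  case True_False
  have "((\<lambda>h. (flat m (0 + h) - flat m 0) / h) \<longlongrightarrow> 0) (at 0)"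
  proof -
    have "(flat m (0 + h) - flat m 0) / h = flat (m + 1) h" for h
      by (simp add: flat_def divide_inverse mult_ac)
    then show ?thesis using tendsto_flat_0[of "m + 1"] by simp
  qed
  then have "(flat m has_real_derivative 0) (at 0)" by (simp add: DERIV_def)
  moreover have "flat (m + 2) 0 - real m * flat (m + 1) 0 = 0" by (simp add: flat_def)
  ultimately show ?thesis using True_False by simp
next
  case False_True
  then have x: "x > 0" by simp
  have "((\<lambda>x. inverse x ^ m * exp (- inverse x)) has_real_derivative flat (m + 2) x - real m * flat (m + 1) x) (at x)"
    using DERIV_mult[OF DERIV_power[OF DERIV_inverse] DERIV_fun_exp[OF DERIV_minus[OF DERIV_inverse]], of x m] x
    by (cases m) (simp_all add: flat_def power2_eq_square algebra_simps)
  then show ?thesis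
    by (rule has_field_derivative_transform_within_open[where S = "{0<..}"]) (use x in \<open>auto simp: flat_def\<close>)
next
  case False_False
  then have x: "x < 0" by simp
  have "((\<lambda>x. 0) has_real_derivative flat (m + 2) x - real m * flat (m + 1) x) (at x)"
    using x by (auto simp: flat_def)
  then show ?thesis
    by (rule has_field_derivative_transform_within_open[where S = "{..<0}"]) (use x in \<open>auto simp: flat_def\<close>)
qed simp

lemma smooth_flat_compose:
  fixes q :: "real^'n \<Rightarrow> real"
  assumes q: "smooth q"
  shows "smooth (\<lambda>x. flat m (q x))"
proof -
  have "smooth_upto k (\<lambda>x. flat m (q x))" for k
  proof (induction k arbitrary: m)
    case (0 m)
    have "flat m differentiable at y" for y
      using has_real_derivative_flat has_field_derivative_imp_has_derivative differentiable_def by blast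
    then show ?case
      using differentiable_chain_at[OF smooth_differentiable[OF q], of "flat m"] by (simp add: o_def)
  next
    case (Suc k m)
    have flat': "flat m differentiable at y" for y
      using has_real_derivative_flat has_field_derivative_imp_has_derivative differentiable_def by blast
    have "partial j (\<lambda>x. flat m (q x)) =
      (\<lambda>x. (flat (m + 2) (q x) + (- real m) * flat (m + 1) (q x)) * partial j q x)" for j
    proof
      fix x
      have q': "(q has_derivative frechet_derivative q (at x)) (at x)"
        using smooth_differentiable[OF q] frechet_derivative_works by blast
      from partial_eq[OF has_derivative_compose[OF this has_real_derivative_flat[of m, unfolded has_field_derivative_def]], of j]
      show "partial j (\<lambda>x. flat m (q x)) x = (flat (m + 2) (q x) + (- real m) * flat (m + 1) (q x)) * partial j q x"
        by (simp add: partial_def)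
    qed
    moreover have "smooth_upto k (\<lambda>x. (flat (m + 2) (q x) + (- real m) * flat (m + 1) (q x)) * partial j q x)" for j
      using smooth_partial[OF q, of j]
      by (intro smooth_upto_bounded_bilinear[OF bounded_bilinear_mult] smooth_upto_add smooth_upto_const Suc.IH)
        (simp add: smooth_iff_upto)
    ultimately show ?case
      using differentiable_chain_at[OF smooth_differentiable[OF q] flat'] by (simp add: o_def)
  qed
  then show ?thesis by (simp add: smooth_iff_upto)
qed

lemma smooth_diff: "smooth f \<Longrightarrow> smooth g \<Longrightarrow> smooth (\<lambda>x. f x - g x)"
  using smooth_add[OF _ smooth_bounded_linear[OF bounded_linear_minus[OF bounded_linear_ident]], of f g] by simp

lemmas smooth_mult = smooth_bounded_bilinear[OF bounded_bilinear_mult]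

text \<open>
  With \<open>r = \<bar>y - x\<bar>\<^sup>2\<close> the quotient of \<open>flat 0 (1 - r)\<close> by \<open>flat 0 (1 - r) + flat 0 (r - 1/4)\<close> is
  \<open>1\<close> where \<open>r \<le> 1/4\<close> and \<open>0\<close> where \<open>r \<ge> 1\<close>.
\<close>

lemma ex_bump_function:
  fixes x :: "real^'n"
  shows "\<exists>h. \<forall>\<^sub>F y in nhds x. Rep_test_function h y = 1"
proof -
  define r where "r y = (y - x) \<bullet> (y - x)" for y
  define d where "d y = flat 0 (1 - r y) + flat 0 (r y - 1/4)" for y
  define b :: "real^'n \<Rightarrow> complex" where "b y = of_real (flat 0 (1 - r y) * inverse (d y))" for y
  have r: "smooth r"
    unfolding r_def by (intro smooth_bounded_bilinear[OF bounded_bilinear_inner] smooth_diff smooth_id smooth_const)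
  have "d y > 0" for y
    unfolding d_def flat_def by (auto intro: add_pos_pos)
  then have "smooth (\<lambda>y. inverse (d y))"
    unfolding d_def by (intro smooth_inverse smooth_add smooth_flat_compose smooth_diff smooth_const r) (simp add: less_imp_neq[symmetric])
  then have "smooth b"
    unfolding b_def
    by (intro smooth_bounded_linear[OF bounded_linear_of_real] smooth_mult smooth_flat_compose smooth_diff smooth_const r)
  moreover have "compact_support b"
  proof -
    have "{y. b y \<noteq> 0} \<subseteq> cball x 1"
    proof
      fix y assume "y \<in> {y. b y \<noteq> 0}"
      then have "r y < 1" by (auto simp: b_def flat_def split: if_splits)
      then have "norm (y - x) < 1" by (simp add: r_def norm_eq_sqrt_inner)
      then show "y \<in> cball x 1" by (simp add: dist_norm norm_minus_commute)
    qed
    then have "closure {y. b y \<noteq> 0} \<subseteq> cball x 1" by (rule closure_minimal) simp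
    then show ?thesis unfolding compact_support_def by (rule compact_closure_subset[OF compact_cball])
  qed
  ultimately have b: "Rep_test_function (Abs_test_function b) = b"
    by (intro Abs_test_function_inverse) simp
  have "\<forall>\<^sub>F y in nhds x. b y = 1"
  proof -
    have "b y = 1" if "y \<in> ball x (1/2)" for y
    proof -
      have "norm (y - x) < 1/2" using that by (simp add: dist_norm norm_minus_commute)
      then have "(norm (y - x))\<^sup>2 < (1/2)\<^sup>2" by (intro power_strict_mono) auto
      then have "r y < 1/4" by (simp add: r_def power2_norm_eq_inner power_divide)
      then show ?thesis by (simp add: b_def d_def flat_def)
    qed
    then show ?thesis unfolding eventually_nhds by (intro exI[of _ "ball x (1/2)"]) simp
  qed
  then show ?thesis using b by metis
qed

text \<open>Multiplication by a bump function makes any smooth germ the germ of a test function.\<close>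

lemma ex_test_function_germ:
  fixes p :: "real^'n \<Rightarrow> complex"
  assumes p: "smooth p"
  shows "\<exists>h. \<forall>\<^sub>F y in nhds x. Rep_test_function h y = p y"
proof -
  obtain b where b: "\<forall>\<^sub>F y in nhds x. Rep_test_function b y = 1" using ex_bump_function by blast
  have sb: "smooth (Rep_test_function b)" "compact_support (Rep_test_function b)"
    using Rep_test_function[of b] by auto
  have "Rep_test_function (Abs_test_function (\<lambda>y. Rep_test_function b y * p y)) = (\<lambda>y. Rep_test_function b y * p y)"
    using sb p by (intro Abs_test_function_inverse) (auto intro: smooth_mult elim: compact_support_mono)
  then have "\<forall>\<^sub>F y in nhds x. Rep_test_function (Abs_test_function (\<lambda>y. Rep_test_function b y * p y)) y = p y"
    using b by (auto elim: eventually_mono)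
  then show ?thesis by blast
qed

definition monomial_at :: "real^'n \<Rightarrow> ('n::finite \<Rightarrow> nat) \<Rightarrow> real^'n \<Rightarrow> real" where
  "monomial_at x a y = (\<Prod>i\<in>UNIV. (y $ i - x $ i) ^ a i)"

lemma smooth_power: "smooth (f :: real^'n \<Rightarrow> real) \<Longrightarrow> smooth (\<lambda>x. f x ^ m)"
  by (induction m) (simp_all add: smooth_const smooth_mult)

lemma smooth_coordinate: "smooth (\<lambda>y. y $ i)"
  by (rule smooth_bounded_linear[OF bounded_linear_vec_nth smooth_id])

lemma smooth_monomial_at: "smooth (monomial_at x a)"
  unfolding monomial_at_def by (intro smooth_prod smooth_power smooth_diff smooth_const smooth_coordinate)

lemma partial_monomial_at:
  "partial k (monomial_at x a) y = real (a k) * monomial_at x (a(k := a k - 1)) y"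
proof -
  define c where "c = (\<Prod>i\<in>UNIV - {k}. (y $ i - x $ i) ^ a i)"
  have split: "monomial_at x b (y + t *\<^sub>R axis k 1) = (y $ k + t - x $ k) ^ b k * c"
    if "\<And>i. i \<noteq> k \<Longrightarrow> b i = a i" for b t
  proof -
    have "monomial_at x b (y + t *\<^sub>R axis k 1) = (y $ k + t - x $ k) ^ b k *
        (\<Prod>i\<in>UNIV - {k}. ((y + t *\<^sub>R axis k 1) $ i - x $ i) ^ b i)"
      unfolding monomial_at_def by (subst prod.remove[of _ k]) (auto simp: axis_def)
    also have "(\<Prod>i\<in>UNIV - {k}. ((y + t *\<^sub>R axis k 1) $ i - x $ i) ^ b i) = c"
      unfolding c_def using that by (intro prod.cong) (auto simp: axis_def)
    finally show ?thesis .
  qed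
  have "((\<lambda>t. monomial_at x a (y + t *\<^sub>R axis k 1)) has_real_derivative partial k (monomial_at x a) (y + 0 *\<^sub>R axis k 1)) (at 0)"
    by (rule has_real_derivative_along_axis) (simp add: smooth_differentiable smooth_monomial_at)
  moreover have "((\<lambda>t. monomial_at x a (y + t *\<^sub>R axis k 1)) has_real_derivative
      real (a k) * (y $ k - x $ k) ^ (a k - 1) * c) (at 0)"
    by (simp add: split) (auto intro!: derivative_eq_intros)
  ultimately have "partial k (monomial_at x a) y = real (a k) * (y $ k - x $ k) ^ (a k - 1) * c"
    using DERIV_unique by fastforce
  then show ?thesis using split[of "a(k := a k - 1)" 0] by simp
qed

section \<open>Opposite coproducts and transport of structure\<close>

lemma bialgebra_co_opposite:
  fixes B :: "'a::complex_vector bialg"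
  assumes "bialgebra B"
  shows "bialgebra (co_opposite B)"
proof -
  interpret bialgebra B by (rule assms)
  let ?\<Delta> = "bcomult B"
  have lin: "clinear (\<lambda>x. tensor_swap (?\<Delta> x))"
    by (rule clinear_compose[OF clinear_tensor_swap clinear_comult])
  note map_lin = clinear_tensor_map[OF clinear_comult clinear_ident] clinear_tensor_map[OF clinear_ident clinear_comult]
    clinear_tensor_map[OF lin clinear_ident] clinear_tensor_map[OF clinear_ident lin]
    clinear_tensor_map[OF clinear_ident clinear_tensor_swap]
  note map_elem = tensor_map_elem[OF clinear_comult clinear_ident] tensor_map_elem[OF clinear_ident clinear_comult]
    tensor_map_elem[OF lin clinear_ident] tensor_map_elem[OF clinear_ident lin]
    tensor_map_elem[OF clinear_ident clinear_tensor_swap]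
  \<comment> \<open>reversing the three factors turns either side of one coassociativity law into a side of the other\<close>
  define rev :: "('a, ('a, 'a) tensor) tensor \<Rightarrow> ('a, ('a, 'a) tensor) tensor"
    where "rev s = tensor_assoc (tensor_swap (tensor_map (\<lambda>x. x) tensor_swap s))" for s
  have rev: "clinear rev"
    unfolding rev_def by (intro clinear_compose[OF clinear_tensor_assoc] clinear_compose[OF clinear_tensor_swap] map_lin)
  have 1: "tensor_assoc (tensor_map (\<lambda>x. tensor_swap (?\<Delta> x)) (\<lambda>x. x) (tensor_swap t)) = rev (tensor_map (\<lambda>x. x) ?\<Delta> t)" for t
    by (rule tensor_ext[where t = t], intro clinear_compose[OF clinear_tensor_assoc] clinear_compose[OF map_lin(3)] clinear_tensor_swap)
       (intro clinear_compose[OF rev] map_lin, simp add: map_elem rev_def tensor_swap_elem)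
  have rev_assoc: "y \<otimes>\<^sub>t tensor_swap s = rev (tensor_assoc (s \<otimes>\<^sub>t y))" for s y
    by (rule tensor_ext[where t = s], intro cbilinear_apply[OF cbilinear_tensor_elem] clinear_tensor_swap)
       (intro clinear_compose[OF rev] clinear_compose[OF clinear_tensor_assoc] cbilinear_apply[OF cbilinear_tensor_elem] clinear_ident,
        simp add: map_elem rev_def tensor_swap_elem tensor_assoc_elem)
  have 2: "tensor_map (\<lambda>x. x) (\<lambda>x. tensor_swap (?\<Delta> x)) (tensor_swap t) = rev (tensor_assoc (tensor_map ?\<Delta> (\<lambda>x. x) t))" for t
    by (rule tensor_ext[where t = t], intro clinear_compose[OF map_lin(4)] clinear_tensor_swap)
       (intro clinear_compose[OF rev] clinear_compose[OF clinear_tensor_assoc] map_lin,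
        simp add: map_elem tensor_swap_elem rev_assoc)
  have lift_swap: "tensor_lift f (tensor_swap t) = tensor_lift (\<lambda>x y. f y x) t" if "cbilinear f" for f :: "'a \<Rightarrow> 'a \<Rightarrow> 'a" and t
  proof -
    have "cbilinear (\<lambda>x y. f y x)" using that by (simp add: cbilinear_def)
    with that show ?thesis
      by - (rule tensor_ext[where t = t],
         simp_all add: tensor_swap_elem tensor_lift_elem clinear_compose[OF clinear_tensor_lift] clinear_tensor_swap clinear_tensor_lift)
  qed
  have mult_swap: "tensor_swap (tensor_mult (bmult B) (bmult B) s t) =
      tensor_mult (bmult B) (bmult B) (tensor_swap s) (tensor_swap t)" for s t
  proof -
    let ?m = "tensor_mult (bmult B) (bmult B)"
    note bil = cbilinear_apply[OF cbilinear_tensor_mult[OF cbilinear_mult cbilinear_mult]]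
    have "tensor_swap (?m (x \<otimes>\<^sub>t y) t) = ?m (tensor_swap (x \<otimes>\<^sub>t y)) (tensor_swap t)" for x y
    proof (rule tensor_ext[where t = t])
      show "clinear (\<lambda>t. tensor_swap (?m (x \<otimes>\<^sub>t y) t))"
        by (rule clinear_compose[OF clinear_tensor_swap bil(2)[OF clinear_ident]])
      show "clinear (\<lambda>t. ?m (tensor_swap (x \<otimes>\<^sub>t y)) (tensor_swap t))"
        by (rule bil(2)[OF clinear_tensor_swap])
    qed (simp add: tensor_swap_elem tensor_mult_elem cbilinear_mult)
    then show ?thesis
      by - (rule tensor_ext[where t = s], rule clinear_compose[OF clinear_tensor_swap bil(1)[OF clinear_ident]],
         rule bil(1)[OF clinear_tensor_swap])
  qed
  have eps: "cbilinear (\<lambda>y z. bcounit B y *\<^sub>C z)" "cbilinear (\<lambda>y z. bcounit B z *\<^sub>C y)"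
    by (intro cbilinear_by_args clinear_intros clinear_counit)+
  show ?thesis
    by (rule bialgebra.intro)
      (simp_all add: co_opposite_def cbilinear_mult mult_assoc unit_left unit_right lin clinear_counit
        comult_unit counit_mult counit_unit comult_mult mult_swap tensor_swap_elem id_def
        1 2 coassoc[unfolded id_def] lift_swap eps counit_left counit_right)
qed

text \<open>
  A linear bijection that respects all operations carries the bialgebra axioms from its codomain to its
  domain; so for the bicrossed product none of them has to be verified from the formulas.
\<close>

lemma bialgebra_iso_transport:
  fixes B :: "'a::complex_vector bialg" and C :: "'b::complex_vector bialg"
  assumes "bialgebra C" and h: "clinear h" and bij: "bij h"
    and mult: "\<And>x y. h (bmult B x y) = bmult C (h x) (h y)"
    and unit: "h (bunit B) = bunit C"
    and comult: "\<And>x. bcomult C (h x) = tensor_map h h (bcomult B x)"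
    and counit: "\<And>x. bcounit C (h x) = bcounit B x"
  shows "bialgebra_iso B C h"
proof -
  interpret C: bialgebra C by (rule assms(1))
  define g where "g = inv h"
  have hg: "h (g y) = y" and gh: "g (h x) = x" for x y
    using bij by (simp_all add: g_def bij_def surj_f_inv_f)
  have inj: "h x = h y \<Longrightarrow> x = y" for x y
    using gh by metis
  have g: "clinear g"
    by (rule clinearI) (rule inj, simp add: hg clinear_add[OF h] clinear_scale[OF h])+
  have mult': "bmult B x y = g (bmult C (h x) (h y))" for x y
    by (simp add: mult[symmetric] gh)
  have comult': "bcomult B x = tensor_map g g (bcomult C (h x))" for x
    by (simp add: comult tensor_map_comp g h gh tensor_map_ident)
  have bil: "cbilinear (bmult B)"
    using cbilinearD[OF C.cbilinear_mult] unfolding mult'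
    by (intro cbilinearI) (simp_all add: clinear_add[OF h] clinear_add[OF g] clinear_scale[OF h] clinear_scale[OF g])
  have \<Delta>: "clinear (bcomult B)"
    unfolding comult'[abs_def]
    by (intro clinear_compose[OF clinear_tensor_map[OF g g]] clinear_compose[OF C.clinear_comult] h)
  have \<epsilon>: "clinear (bcounit B)"
    using clinear_compose[OF C.clinear_counit h] by (simp add: counit)
  have hh: "clinear (tensor_map h h)" "clinear (tensor_map g g)"
    by (intro clinear_tensor_map g h)+
  have inj2: "s = t" if "tensor_map h h s = tensor_map h h t" for s t
  proof -
    have "tensor_map g g (tensor_map h h s) = tensor_map g g (tensor_map h h t)" using that by simp
    then show ?thesis by (simp add: tensor_map_comp g h gh tensor_map_ident)
  qed
  have inj3: "s = t" if "tensor_map h (tensor_map h h) s = tensor_map h (tensor_map h h) t" for s t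
  proof -
    have "tensor_map g (tensor_map g g) (tensor_map h (tensor_map h h) s) =
        tensor_map g (tensor_map g g) (tensor_map h (tensor_map h h) t)" using that by simp
    then show ?thesis by (simp add: tensor_map_comp hh g h gh tensor_map_ident)
  qed
  have assoc: "tensor_map h (tensor_map h h) (tensor_assoc t) = tensor_assoc (tensor_map (tensor_map h h) h t)" for t
  proof (rule tensor_ext[where t = t])
    show "clinear (\<lambda>t. tensor_map h (tensor_map h h) (tensor_assoc t))"
      by (intro clinear_compose[OF clinear_tensor_map[OF h hh(1)]] clinear_tensor_assoc)
    show "clinear (\<lambda>t. tensor_assoc (tensor_map (tensor_map h h) h t))"
      by (intro clinear_compose[OF clinear_tensor_assoc] clinear_tensor_map h hh)
    fix s :: "('a, 'a) tensor" and z
    show "tensor_map h (tensor_map h h) (tensor_assoc (s \<otimes>\<^sub>t z)) = tensor_assoc (tensor_map (tensor_map h h) h (s \<otimes>\<^sub>t z))"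
    proof (rule tensor_ext[where t = s])
      show "clinear (\<lambda>s. tensor_map h (tensor_map h h) (tensor_assoc (s \<otimes>\<^sub>t z)))"
        by (intro clinear_compose[OF clinear_tensor_map[OF h hh(1)]] clinear_compose[OF clinear_tensor_assoc]
            cbilinear_apply[OF cbilinear_tensor_elem] clinear_ident)
      show "clinear (\<lambda>s. tensor_assoc (tensor_map (tensor_map h h) h (s \<otimes>\<^sub>t z)))"
        by (intro clinear_compose[OF clinear_tensor_assoc] clinear_compose[OF clinear_tensor_map[OF hh(1) h]]
            cbilinear_apply[OF cbilinear_tensor_elem] clinear_ident)
    qed (simp add: tensor_assoc_elem tensor_map_elem h hh)
  qed
  have lift: "h (tensor_lift f t) = tensor_lift f' (tensor_map h h t)"
    if "cbilinear f" "cbilinear f'" "\<And>x y. h (f x y) = f' (h x) (h y)"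
    for f :: "'a \<Rightarrow> 'a \<Rightarrow> 'a" and f' :: "'b \<Rightarrow> 'b \<Rightarrow> 'b" and t
    by (rule tensor_ext[where t = t])
       (simp_all add: that tensor_lift_elem tensor_map_elem h hh clinear_compose[OF h] clinear_tensor_lift
         clinear_compose[OF clinear_tensor_lift])
  have tmult: "tensor_map h h (tensor_mult (bmult B) (bmult B) s t) =
      tensor_mult (bmult C) (bmult C) (tensor_map h h s) (tensor_map h h t)" for s t
  proof -
    note bils = cbilinear_apply[OF cbilinear_tensor_mult[OF bil bil]]
      cbilinear_apply[OF cbilinear_tensor_mult[OF C.cbilinear_mult C.cbilinear_mult]]
    show ?thesis
      by (rule tensor_ext[where t = s], intro clinear_compose[OF hh(1)] bils clinear_ident,
          intro bils hh, rule tensor_ext[where t = t],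
          intro clinear_compose[OF hh(1)] bils clinear_ident, intro bils hh)
         (simp add: tensor_map_elem h tensor_mult_elem bil C.cbilinear_mult mult)
  qed
  have "bialgebra B"
  proof (rule bialgebra.intro, goal_cases)
    case 1 show ?case by (rule bil)
    case (2 x y z) show ?case by (rule inj) (simp add: mult C.mult_assoc)
    case (3 x) show ?case by (rule inj) (simp add: mult unit C.unit_left)
    case (4 x) show ?case by (rule inj) (simp add: mult unit C.unit_right)
    case 5 show ?case by (rule \<Delta>)
    case 6 show ?case by (rule \<epsilon>)
    case (7 x)
    have "tensor_map h (tensor_map h h) (tensor_assoc (tensor_map (bcomult B) id (bcomult B x))) =
        tensor_assoc (tensor_map (bcomult C) id (bcomult C (h x)))"
      by (simp add: assoc id_def tensor_map_comp comult h hh \<Delta> clinear_ident C.clinear_comult)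
    also have "\<dots> = tensor_map id (bcomult C) (bcomult C (h x))" by (rule C.coassoc)
    also have "\<dots> = tensor_map h (tensor_map h h) (tensor_map id (bcomult B) (bcomult B x))"
      by (simp add: id_def tensor_map_comp comult h hh \<Delta> clinear_ident C.clinear_comult)
    finally show ?case by (rule inj3)
  next
    case (8 x)
    have "h (tensor_lift (\<lambda>y z. bcounit B y *\<^sub>C z) (bcomult B x)) =
        tensor_lift (\<lambda>y z. bcounit C y *\<^sub>C z) (tensor_map h h (bcomult B x))"
      by (intro lift cbilinear_by_args clinear_intros \<epsilon> C.clinear_counit) (simp add: clinear_scale[OF h] counit)
    then show ?case using C.counit_left[of "h x"] by (simp add: comult inj)
  next
    case (9 x)
    have "h (tensor_lift (\<lambda>y z. bcounit B z *\<^sub>C y) (bcomult B x)) =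
        tensor_lift (\<lambda>y z. bcounit C z *\<^sub>C y) (tensor_map h h (bcomult B x))"
      by (intro lift cbilinear_by_args clinear_intros \<epsilon> C.clinear_counit) (simp add: clinear_scale[OF h] counit)
    then show ?case using C.counit_right[of "h x"] by (simp add: comult inj)
  next
    case (10 x y) show ?case by (rule inj2) (simp add: comult[symmetric] mult C.comult_mult tmult)
    case 11 show ?case by (rule inj2) (simp add: comult[symmetric] unit C.comult_unit tensor_map_elem h)
    case (12 x y) show ?case by (simp add: counit[symmetric] mult C.counit_mult)
    case 13 show ?case by (simp add: counit[symmetric] unit C.counit_unit)
  qed
  then show ?thesis
    using assms by (intro bialgebra_iso.intro bialgebra_iso_axioms.intro) auto
qed

section \<open>Enveloping algebras\<close>

lemma poly_mapping_clinear_ext: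
  fixes F G :: "('a \<Rightarrow>\<^sub>0 complex) \<Rightarrow> 'b::complex_vector"
  assumes F: "clinear F" and G: "clinear G"
    and "\<And>k. F (Poly_Mapping.single k 1) = G (Poly_Mapping.single k 1)"
  shows "F p = G p"
proof -
  have "F (linear_extension (\<lambda>k. Poly_Mapping.single k 1) p) = G (linear_extension (\<lambda>k. Poly_Mapping.single k 1) p)"
    by (simp add: linear_extension_def clinear_sum[OF F] clinear_sum[OF G] clinear_scale[OF F] clinear_scale[OF G] assms(3))
  then show ?thesis using linear_extension_decomp[of p] by simp
qed

lemma linear_extension_monoid_hom:
  fixes f :: "'m::monoid_add \<Rightarrow> 'b::complex_algebra_1"
  assumes f: "\<And>v w. f (v + w) = f v * f w"
  shows "linear_extension f (p * q) = linear_extension f p * linear_extension f q"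
proof -
  have L: "clinear (linear_extension f)" by (rule clinear_linear_extension)
  have left: "clinear (\<lambda>p :: 'm \<Rightarrow>\<^sub>0 complex. p * q)" for q
    by (rule clinearI) (simp_all add: distrib_right scaleC_eq_single_mult mult.assoc)
  have right: "clinear (\<lambda>q :: 'm \<Rightarrow>\<^sub>0 complex. p * q)" for p
  proof (rule clinearI)
    show "p * (c *\<^sub>C q) = c *\<^sub>C (p * q)" for c q
      by (metis mult.assoc scaleC_eq_single_mult single_zero_commute)
  qed (simp add: distrib_left)
  show ?thesis
  proof (rule poly_mapping_clinear_ext[where p = p])
    show "clinear (\<lambda>p. linear_extension f (p * q))" by (rule clinear_compose[OF L left])
    show "clinear (\<lambda>p. linear_extension f p * linear_extension f q)"
      by (intro clinear_intros L)
    show "linear_extension f (Poly_Mapping.single v 1 * q) = linear_extension f (Poly_Mapping.single v 1) * linear_extension f q" for v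
      by (rule poly_mapping_clinear_ext[where p = q], rule clinear_compose[OF L right], intro clinear_intros L)
         (simp add: mult_single linear_extension_single f scaleC_one)
  qed
qed

text \<open>Lie algebra maps into an associative algebra, which carries the commutator as its bracket\<close>

definition lie_hom :: "('v::complex_lie_algebra \<Rightarrow> 'b::complex_algebra_1) \<Rightarrow> bool" where
  "lie_hom g \<longleftrightarrow> clinear g \<and> (\<forall>x y. g x * g y - g y * g x = g (lie_bracket x y))"

lemma linear_extension_envelope_null:
  fixes g :: "'v::complex_lie_algebra \<Rightarrow> 'b::complex_algebra_1"
  assumes g: "lie_hom g" and s: "s \<in> envelope_null"
  shows "linear_extension (\<lambda>w. prod_list (map g (letters w))) s = 0"
proof -
  let ?L = "linear_extension (\<lambda>w. prod_list (map g (letters w)))"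
  note lin = clinear_add[OF clinear_linear_extension] clinear_diff[OF clinear_linear_extension]
    clinear_scale[OF clinear_linear_extension] clinear_zero[OF clinear_linear_extension]
  have mult: "?L (p * q) = ?L p * ?L q" for p q
    by (rule linear_extension_monoid_hom) (simp add: plus_word_def)
  have letter: "?L (letter x) = g x" for x
    by (simp add: letter_def linear_extension_single scaleC_one)
  have "?L r = 0" if "r \<in> envelope_relators" for r
    using that g by cases (simp_all add: lin mult letter lie_hom_def clinear_iff)
  with s show ?thesis
    unfolding envelope_null_def by induction (simp_all add: lin mult)
qed

lemma envelope_lift_abs:
  assumes g: "lie_hom g"
  shows "envelope_lift g (abs_envelope p) = linear_extension (\<lambda>w. prod_list (map g (letters w))) p"
proof -
  have "p - rep_envelope (abs_envelope p) \<in> envelope_null"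
    by (rule rep_abs_rsp[OF Quotient3_envelope]) (rule envelope_null_eqI, rule refl)
  from linear_extension_envelope_null[OF g this] show ?thesis
    by (simp add: envelope_lift_def clinear_diff[OF clinear_linear_extension])
qed

lemma ex_abs_envelope: "\<exists>p. u = abs_envelope p"
  using Quotient3_abs_rep[OF Quotient3_envelope] by metis

lemma
  fixes g :: "'v::complex_lie_algebra \<Rightarrow> 'b::complex_algebra_1"
  assumes g: "lie_hom g"
  shows clinear_envelope_lift: "clinear (envelope_lift g)"
    and envelope_lift_one: "envelope_lift g 1 = 1"
    and envelope_lift_mult: "envelope_lift g (u * v) = envelope_lift g u * envelope_lift g v"
    and envelope_lift_of: "envelope_lift g (envelope_of x) = g x"
proof -
  note lin = clinear_add[OF clinear_linear_extension] clinear_scale[OF clinear_linear_extension]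
  show "clinear (envelope_lift g)"
  proof (rule clinearI)
    fix u v :: "'v envelope" and c :: complex
    obtain p q where "u = abs_envelope p" "v = abs_envelope q" using ex_abs_envelope by metis
    then show "envelope_lift g (u + v) = envelope_lift g u + envelope_lift g v"
      "envelope_lift g (c *\<^sub>C u) = c *\<^sub>C envelope_lift g u"
      by (simp_all add: plus_envelope.abs_eq scaleC_envelope.abs_eq envelope_lift_abs[OF g] lin)
  qed
  show "envelope_lift g 1 = 1"
    by (simp add: one_envelope.abs_eq envelope_lift_abs[OF g] linear_extension_single scaleC_one zero_word_def
        flip: single_one)
  obtain p q where "u = abs_envelope p" "v = abs_envelope q" using ex_abs_envelope by metis
  then show "envelope_lift g (u * v) = envelope_lift g u * envelope_lift g v"
    by (simp add: times_envelope.abs_eq envelope_lift_abs[OF g])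
       (rule linear_extension_monoid_hom, simp add: plus_word_def)
  show "envelope_lift g (envelope_of x) = g x"
    by (simp add: envelope_of.abs_eq envelope_lift_abs[OF g] letter_def linear_extension_single scaleC_one)
qed

lemma clinear_envelope_of: "clinear envelope_of"
proof (rule clinearI; transfer)
  have relator: "r \<in> envelope_null" if "r \<in> envelope_relators" for r :: "'a word \<Rightarrow>\<^sub>0 complex"
    using two_sided_ideal.add[OF two_sided_ideal.zero that, of 1 1] by (simp add: envelope_null_def)
  show "letter (x + y) - (letter x + letter y) \<in> envelope_null" for x y :: 'a
    using relator[OF envelope_relators.intros(1)] by (simp add: diff_diff_eq)
  show "letter (c *\<^sub>C x) - c *\<^sub>C letter x \<in> envelope_null" for c and x :: 'a
    by (rule relator[OF envelope_relators.intros(2)])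
qed

lemma envelope_of_commutator:
  "envelope_of x * envelope_of y - envelope_of y * envelope_of x = envelope_of (lie_bracket x y)"
proof transfer
  fix x y :: 'a
  have "letter x * letter y - letter y * letter x - letter (lie_bracket x y) \<in> envelope_relators"
    by (rule envelope_relators.intros)
  from two_sided_ideal.add[OF two_sided_ideal.zero this, of 1 1]
  show "letter x * letter y - letter y * letter x - letter (lie_bracket x y) \<in> envelope_null"
    by (simp add: envelope_null_def)
qed

lemma envelope_induct [case_names one of_mult add scale]:
  assumes "P 1" "\<And>x u. P u \<Longrightarrow> P (envelope_of x * u)"
    and "\<And>u v. P u \<Longrightarrow> P v \<Longrightarrow> P (u + v)" and "\<And>c u. P u \<Longrightarrow> P (c *\<^sub>C u)"
  shows "P (u :: 'v::complex_lie_algebra envelope)"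
proof -
  have word: "P (abs_envelope (Poly_Mapping.single (Word xs) 1))" for xs :: "'v list"
  proof (induction xs)
    case Nil
    then show ?case using assms(1) by (simp add: one_envelope.abs_eq flip: zero_word_def single_one)
  next
    case (Cons x xs)
    have "abs_envelope (Poly_Mapping.single (Word (x # xs)) 1) = envelope_of x * abs_envelope (Poly_Mapping.single (Word xs) 1)"
      by (simp add: envelope_of.abs_eq times_envelope.abs_eq letter_def mult_single plus_word_def)
    with assms(2)[OF Cons] show ?case by simp
  qed
  have zero: "P 0" using assms(4)[OF assms(1), of 0] by simp
  have abs: "clinear (abs_envelope :: ('v word \<Rightarrow>\<^sub>0 complex) \<Rightarrow> _)"
    by (rule clinearI) (simp_all add: plus_envelope.abs_eq scaleC_envelope.abs_eq)
  obtain p where u: "u = abs_envelope p" using ex_abs_envelope by metis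
  have "u = abs_envelope (linear_extension (\<lambda>k. Poly_Mapping.single k 1) p)"
    using u linear_extension_decomp[of p] by simp
  then have "u = (\<Sum>w\<in>Poly_Mapping.keys p. Poly_Mapping.lookup p w *\<^sub>C abs_envelope (Poly_Mapping.single w 1))"
    by (simp add: linear_extension_def clinear_sum[OF abs] clinear_scale[OF abs])
  moreover have "P (\<Sum>w\<in>A. c w *\<^sub>C abs_envelope (Poly_Mapping.single w 1))"
    if "finite A" for A and c :: "_ \<Rightarrow> complex"
    using that
  proof (induction A)
    case (insert w A)
    have "P (abs_envelope (Poly_Mapping.single w 1))" using word[of "letters w"] by simp
    with insert show ?case by (simp add: assms(3,4))
  qed (simp add: zero)
  ultimately show ?thesis by simp
qed

section \<open>Endomorphism algebras\<close>

lemma endo_eqI: "(\<And>x. apply_endo S x = apply_endo T x) \<Longrightarrow> S = T"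
  by (simp add: apply_endo_inject[symmetric] fun_eq_iff)

lemma clinear_apply_endo: "clinear (apply_endo T)"
  using apply_endo by blast

lemma clinear_apply_endo_left: "clinear (\<lambda>T. apply_endo T x)"
  by (rule clinearI) (simp_all add: plus_endo.rep_eq scaleC_endo.rep_eq)

lemma apply_Abs_endo: "clinear f \<Longrightarrow> apply_endo (Abs_endo f) x = f x"
  by (simp add: Abs_endo_inverse)

text \<open>
  An action of a Lie algebra is a Lie algebra map into the endomorphisms of the module, so the extended
  action is a case of the universal property.
\<close>

lemma envelope_act_eq:
  fixes a :: "'v::complex_lie_algebra \<Rightarrow> 'm::complex_vector \<Rightarrow> 'm"
  assumes a: "\<And>x. clinear (a x)"
  shows "envelope_act a u m = apply_endo (envelope_lift (\<lambda>x. Abs_endo (a x)) u) m"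
proof -
  have "foldr a xs m = apply_endo (prod_list (map (\<lambda>x. Abs_endo (a x)) xs)) m" for xs
    by (induction xs) (simp_all add: one_endo.rep_eq times_endo.rep_eq apply_Abs_endo[OF a])
  then show ?thesis
    by (simp add: envelope_act_def envelope_lift_def linear_extension_def
        clinear_sum[OF clinear_apply_endo_left] clinear_scale[OF clinear_apply_endo_left])
qed

section \<open>The Hopf structure of an enveloping algebra\<close>

lemma lie_hom_comult:
  "lie_hom (\<lambda>x :: 'v::complex_lie_algebra. envelope_of x \<otimes>\<^sub>t 1 + 1 \<otimes>\<^sub>t envelope_of x :: ('v envelope, 'v envelope) tensor)"
proof -
  have "(envelope_of x \<otimes>\<^sub>t 1 + 1 \<otimes>\<^sub>t envelope_of x) * (envelope_of y \<otimes>\<^sub>t 1 + 1 \<otimes>\<^sub>t envelope_of y)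
      - (envelope_of y \<otimes>\<^sub>t 1 + 1 \<otimes>\<^sub>t envelope_of y) * (envelope_of x \<otimes>\<^sub>t 1 + 1 \<otimes>\<^sub>t envelope_of x)
    = (envelope_of (lie_bracket x y) \<otimes>\<^sub>t 1 + 1 \<otimes>\<^sub>t envelope_of (lie_bracket x y) :: ('v envelope, 'v envelope) tensor)"
    for x y :: 'v
    by (simp add: distrib_left distrib_right tensor_mult_elem' algebra_simps
        clinear_diff[OF cbilinear_apply(1)[OF cbilinear_tensor_elem clinear_ident]]
        clinear_diff[OF cbilinear_apply(2)[OF cbilinear_tensor_elem clinear_ident]]
        flip: envelope_of_commutator)
  then show ?thesis
    unfolding lie_hom_def by (intro conjI allI clinear_intros clinear_envelope_of) simp
qed

lemmas clinear_envelope_comult = clinear_envelope_lift[OF lie_hom_comult, folded envelope_comult_def]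
  and envelope_comult_one = envelope_lift_one[OF lie_hom_comult, folded envelope_comult_def]
  and envelope_comult_mult = envelope_lift_mult[OF lie_hom_comult, folded envelope_comult_def]
  and envelope_comult_of = envelope_lift_of[OF lie_hom_comult, folded envelope_comult_def]

lemma lie_hom_zero: "lie_hom (\<lambda>x. 0)"
  by (simp add: lie_hom_def clinear_iff)

lemmas clinear_envelope_counit = clinear_envelope_lift[OF lie_hom_zero, where 'b = complex, folded envelope_counit_def]
  and envelope_counit_one = envelope_lift_one[OF lie_hom_zero, where 'b = complex, folded envelope_counit_def]
  and envelope_counit_mult = envelope_lift_mult[OF lie_hom_zero, where 'b = complex, folded envelope_counit_def]
  and envelope_counit_of = envelope_lift_of[OF lie_hom_zero, where 'b = complex, folded envelope_counit_def]

text \<open>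
  As \<open>\<Delta>(x u) = (x \<otimes> 1 + 1 \<otimes> x) \<Delta>(u)\<close>, a sum over \<open>\<Delta>(x u)\<close> is a sum over \<open>\<Delta>(u)\<close>. This is the induction step of all
  identities below that involve the coproduct of \<open>\<U>(V)\<close>.
\<close>

lemma tensor_lift_comult_of_mult:
  assumes F: "cbilinear F"
  shows "tensor_lift F (envelope_comult (envelope_of x * u)) =
    tensor_lift (\<lambda>u1 u2. F (envelope_of x * u1) u2 + F u1 (envelope_of x * u2)) (envelope_comult u)"
proof -
  have "tensor_lift F ((envelope_of x \<otimes>\<^sub>t 1 + 1 \<otimes>\<^sub>t envelope_of x) * t) =
    tensor_lift (\<lambda>u1 u2. F (envelope_of x * u1) u2 + F u1 (envelope_of x * u2)) t" for t
  proof (rule tensor_ext[where t = t])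
    have "cbilinear (\<lambda>u1 u2. F (envelope_of x * u1) u2 + F u1 (envelope_of x * u2))"
      by (intro cbilinear_by_args clinear_intros cbilinear_apply[OF F])
    then show "clinear (tensor_lift (\<lambda>u1 u2. F (envelope_of x * u1) u2 + F u1 (envelope_of x * u2)))"
      "tensor_lift F ((envelope_of x \<otimes>\<^sub>t 1 + 1 \<otimes>\<^sub>t envelope_of x) * (y \<otimes>\<^sub>t z)) =
        tensor_lift (\<lambda>u1 u2. F (envelope_of x * u1) u2 + F u1 (envelope_of x * u2)) (y \<otimes>\<^sub>t z)" for y z
      by (simp_all add: clinear_tensor_lift tensor_lift_elem F distrib_right tensor_mult_elem'
          clinear_add[OF clinear_tensor_lift])
    show "clinear (\<lambda>t. tensor_lift F ((envelope_of x \<otimes>\<^sub>t 1 + 1 \<otimes>\<^sub>t envelope_of x) * t))"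
      by (intro clinear_intros F)
  qed
  then show ?thesis by (simp add: envelope_comult_mult envelope_comult_of)
qed

section \<open>The crossed product and its operators\<close>

abbreviation coef :: "'n::finite crossed \<Rightarrow> 'n diffeo \<Rightarrow> real^'n \<Rightarrow> complex" where
  "coef a \<phi> x \<equiv> Rep_test_function (Poly_Mapping.lookup a \<phi>) x"

abbreviation monom_U :: "'n::finite diffeo \<Rightarrow> 'n test_function \<Rightarrow> 'n crossed" where
  "monom_U \<phi> h \<equiv> Poly_Mapping.single \<phi> h"

lemma clinear_coef: "clinear (\<lambda>a. coef a \<phi> x)"
  by (rule clinearI)
    (simp_all add: lookup_add lookup_scaleC plus_test_function.rep_eq scaleC_test_function.rep_eq scaleC_complex_def)

lemmas coef_simps = clinear_add[OF clinear_coef] clinear_scale[OF clinear_coef, unfolded scaleC_complex_def]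
  clinear_zero[OF clinear_coef] clinear_diff[OF clinear_coef] clinear_minus[OF clinear_coef]
  clinear_sum[OF clinear_coef]

lemma coef_monom_U: "coef (monom_U \<phi> h) \<psi> x = (if \<psi> = \<phi> then Rep_test_function h x else 0)"
  by (simp add: lookup_single when_def zero_test_function.rep_eq)

lemma test_function_eqI: "(\<And>x. Rep_test_function f x = Rep_test_function g x) \<Longrightarrow> f = g"
  by (simp add: Rep_test_function_inject[symmetric] fun_eq_iff)

lemma crossed_eqI: "(\<And>\<phi> x. coef a \<phi> x = coef b \<phi> x) \<Longrightarrow> a = b"
  by (intro poly_mapping_eqI test_function_eqI)

lemma operator_eqI:
  "(\<And>a \<phi> x. coef (apply_endo S a) \<phi> x = coef (apply_endo T a) \<phi> x) \<Longrightarrow> S = T"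
  by (intro endo_eqI crossed_eqI)

lemma smooth_test_function: "smooth (Rep_test_function h)"
  using Rep_test_function[of h] by simp

lemma smooth_diffeo: "smooth (Rep_diffeo \<phi>)"
  and smooth_diffeo_component: "smooth (\<lambda>y. Rep_diffeo \<phi> y $ i)"
  and det_jacobian_pos: "det (jacobian (Rep_diffeo \<phi>) (at x)) > 0"
  using Rep_diffeo[of \<phi>]
  by (simp_all add: orientation_preserving_diffeo_def smooth_bounded_linear[OF bounded_linear_vec_nth])

lemma crossed_clinear_ext:
  assumes F: "clinear F" and G: "clinear G" and "\<And>\<phi> h. F (monom_U \<phi> h) = G (monom_U \<phi> h)"
  shows "F a = G (a :: 'n::finite crossed)"
proof -
  have "a = (\<Sum>\<phi>\<in>Poly_Mapping.keys a. monom_U \<phi> (Poly_Mapping.lookup a \<phi>))"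
  proof (rule poly_mapping_eqI)
    fix \<psi>
    have "(\<Sum>\<phi>\<in>Poly_Mapping.keys a. Poly_Mapping.lookup (monom_U \<phi> (Poly_Mapping.lookup a \<phi>)) \<psi>) =
        (\<Sum>\<phi>\<in>Poly_Mapping.keys a. if \<phi> = \<psi> then Poly_Mapping.lookup a \<psi> else 0)"
      by (intro sum.cong) (auto simp: lookup_single when_def)
    then show "Poly_Mapping.lookup a \<psi> = Poly_Mapping.lookup (\<Sum>\<phi>\<in>Poly_Mapping.keys a. monom_U \<phi> (Poly_Mapping.lookup a \<phi>)) \<psi>"
      by (simp add: lookup_sum in_keys_iff)
  qed
  then show ?thesis
    by (metis (no_types, lifting) assms(3) clinear_sum[OF F] clinear_sum[OF G] sum.cong)
qed

lemma crossed_cbilinear_ext: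
  assumes F: "cbilinear F" and G: "cbilinear G"
    and "\<And>\<phi> h \<psi> l. F (monom_U \<phi> h) (monom_U \<psi> l) = G (monom_U \<phi> h) (monom_U \<psi> l)"
  shows "F a b = G (a :: 'n::finite crossed) (b :: 'n crossed)"
proof (rule crossed_clinear_ext[where a = a])
  fix \<phi> h
  show "F (monom_U \<phi> h) b = G (monom_U \<phi> h) b"
    by (rule crossed_clinear_ext[where a = b]) (use assms in \<open>auto simp: cbilinear_def\<close>)
qed (use F G in \<open>simp_all add: cbilinear_def\<close>)

lemma cbilinear_twisted_mult: "cbilinear (twisted_mult \<phi>)"
  by (rule cbilinearI; transfer; simp add: fun_eq_iff algebra_simps)

lemma crossed_mult_superset:
  assumes "finite S" "finite T" "Poly_Mapping.keys a \<subseteq> S" "Poly_Mapping.keys b \<subseteq> T"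
  shows "crossed_mult a b = (\<Sum>\<phi>\<in>S. \<Sum>\<psi>\<in>T. monom_U (diffeo_comp \<psi> \<phi>)
     (twisted_mult \<phi> (Poly_Mapping.lookup a \<phi>) (Poly_Mapping.lookup b \<psi>)))"
proof -
  have zero: "twisted_mult \<phi> 0 g = 0" "twisted_mult \<phi> f 0 = 0" for \<phi> :: "'a diffeo" and f g
    using clinear_zero[OF cbilinear_apply(1)[OF cbilinear_twisted_mult clinear_ident]]
      clinear_zero[OF cbilinear_apply(2)[OF cbilinear_twisted_mult clinear_ident]] by blast+
  have "(\<Sum>\<psi>\<in>T. monom_U (diffeo_comp \<psi> \<phi>) (twisted_mult \<phi> (Poly_Mapping.lookup a \<phi>) (Poly_Mapping.lookup b \<psi>)))
      = (\<Sum>\<psi>\<in>Poly_Mapping.keys b. monom_U (diffeo_comp \<psi> \<phi>) (twisted_mult \<phi> (Poly_Mapping.lookup a \<phi>) (Poly_Mapping.lookup b \<psi>)))" for \<phi>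
    using assms by (intro sum.mono_neutral_right) (auto simp: in_keys_iff zero)
  then show ?thesis
    unfolding crossed_mult_def using assms
    by (simp, intro sum.mono_neutral_left) (auto simp: in_keys_iff zero)
qed

lemma cbilinear_crossed_mult: "cbilinear crossed_mult"
proof (rule cbilinearI)
  fix a a' b b' :: "'a crossed" and c :: complex
  note tw = cbilinearD[OF cbilinear_twisted_mult]
  let ?A = "Poly_Mapping.keys a \<union> Poly_Mapping.keys a'" and ?B = "Poly_Mapping.keys b \<union> Poly_Mapping.keys b'"
  have fin: "finite ?A" "finite ?B" by auto
  have scale: "monom_U \<phi> (c *\<^sub>C h) = c *\<^sub>C monom_U \<phi> h" for \<phi> :: "'a diffeo" and h
    by (rule poly_mapping_eqI) (simp add: lookup_scaleC lookup_single when_def)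
  have sub: "Poly_Mapping.keys (a + a') \<subseteq> ?A" "Poly_Mapping.keys (b + b') \<subseteq> ?B" by (rule Poly_Mapping.keys_add)+
  have sub': "Poly_Mapping.keys (c *\<^sub>C a) \<subseteq> ?A" "Poly_Mapping.keys (c *\<^sub>C b) \<subseteq> ?B"
    by (auto simp: in_keys_iff lookup_scaleC)
  note expand = crossed_mult_superset[OF fin]
  show "crossed_mult (a + a') b = crossed_mult a b + crossed_mult a' b"
    by (simp add: expand sub lookup_add tw single_add sum.distrib)
  show "crossed_mult a (b + b') = crossed_mult a b + crossed_mult a b'"
    by (simp add: expand sub lookup_add tw single_add sum.distrib)
  show "crossed_mult (c *\<^sub>C a) b = c *\<^sub>C crossed_mult a b" "crossed_mult a (c *\<^sub>C b) = c *\<^sub>C crossed_mult a b"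
    by (simp_all add: expand sub' lookup_scaleC tw scale complex_vector.scale_sum_right)
qed

lemma crossed_mult_monom_U:
  "crossed_mult (monom_U \<phi> h) (monom_U \<psi> l) = monom_U (diffeo_comp \<psi> \<phi>) (twisted_mult \<phi> h l)"
  by (subst crossed_mult_superset[of "{\<phi>}" "{\<psi>}"]) (auto simp: lookup_single)

lemma
  shows clinear_partial_test: "clinear (partial_test k)"
    and clinear_jet_test: "clinear (jet_test i js \<phi>)"
    and clinear_det_inverse_test: "clinear (det_inverse_test \<phi>)"
proof -
  have "partial k (\<lambda>x. c * f x) = (\<lambda>x. c * partial k f x)" if "smooth f" for c :: complex and f
    using that by (intro partial_bounded_linear bounded_linear_mult_right) (simp add: smooth_differentiable)
  then show "clinear (partial_test k)"
    by (intro clinearI; transfer) (simp_all add: partial_add smooth_differentiable)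
  show "clinear (jet_test i js \<phi>)" "clinear (det_inverse_test \<phi>)"
    by (intro clinearI; transfer; simp add: fun_eq_iff algebra_simps)+
qed

lemma coef_X_op: "coef (apply_endo (X_op k) a) \<phi> x = partial k (coef a \<phi>) x"
  and coef_sigma_op: "coef (apply_endo (sigma_op i js) a) \<phi> x =
    of_real (partials js (\<lambda>y. Rep_diffeo \<phi> y $ i) x) * coef a \<phi> x"
  and coef_sigma_inv_op: "coef (apply_endo sigma_inv_op a) \<phi> x =
    of_real (inverse (det (jacobian (Rep_diffeo \<phi>) (at x)))) * coef a \<phi> x"
  by (simp_all add: X_op.rep_eq sigma_op.rep_eq sigma_inv_op.rep_eq lookup_crossed_map clinear_partial_test
      clinear_jet_test clinear_det_inverse_test partial_test.rep_eq jet_test.rep_eq det_inverse_test.rep_eq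
      scaleR_conv_of_real)

lemma smooth_coef: "smooth (coef a \<phi>)"
  by (rule smooth_test_function)

lemma partials_snoc: "partials (js @ [l]) f = partial l (partials js f)"
  and partials_Cons: "partials (j # js) f = partials js (partial j f)"
  and partials_Nil: "partials [] f = f"
  by (simp_all add: partials_def)

lemma smooth_diffeo_jet: "smooth (partials js (\<lambda>y. Rep_diffeo \<phi> y $ i))"
  by (intro smooth_partials smooth_diffeo_component)

lemma X_op_commute: "X_op k * X_op l = X_op l * X_op k"
  by (rule operator_eqI)
    (simp add: times_endo.rep_eq coef_X_op[abs_def] partial_commute_complex[OF smooth_coef])

lemma partial_of_real_mult:
  fixes f :: "real^'n \<Rightarrow> real" and g :: "real^'n \<Rightarrow> complex"
  assumes "smooth f" "smooth g"
  shows "partial l (\<lambda>x. of_real (f x) * g x) x = of_real (partial l f x) * g x + of_real (f x) * partial l g x"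
  using partial_bounded_bilinear[OF bounded_bilinear_scaleR, of f g l] assms
  by (simp add: smooth_differentiable scaleR_conv_of_real)

text \<open>By the Leibniz rule, a commutator with \<open>X\<^sub>l\<close> differentiates the coefficient by which an operator multiplies.\<close>

lemma commutator_X_sigma: "X_op l * sigma_op i js - sigma_op i js * X_op l = sigma_op i (js @ [l])"
proof (rule operator_eqI)
  fix a \<phi> x
  have "coef (apply_endo (X_op l * sigma_op i js) a) \<phi> x =
    partial l (\<lambda>y. of_real (partials js (\<lambda>y. Rep_diffeo \<phi> y $ i) y) * coef a \<phi> y) x"
    by (simp add: times_endo.rep_eq coef_X_op coef_sigma_op[abs_def])
  then show "coef (apply_endo (X_op l * sigma_op i js - sigma_op i js * X_op l) a) \<phi> x =
      coef (apply_endo (sigma_op i (js @ [l])) a) \<phi> x"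
    by (simp add: partial_of_real_mult smooth_diffeo_jet smooth_coef minus_endo.rep_eq coef_simps
        times_endo.rep_eq coef_X_op coef_sigma_op partials_snoc)
qed

lemma sigma_op_symmetric: "sigma_op i [j, l] = sigma_op i [l, j]"
  by (rule operator_eqI) (simp add: coef_sigma_op partials_Cons partials_Nil
      partial_commute_real[OF smooth_diffeo_component])

lemma jacobian_entry:
  assumes "\<And>x. \<phi> differentiable at x"
  shows "jacobian \<phi> (at x) $ i $ j = partial j (\<lambda>y. \<phi> y $ i) x"
  using partial_bounded_linear[OF bounded_linear_vec_nth, of \<phi> j i] assms
  by (simp add: jacobian_def matrix_def partial_def fun_eq_iff)

lemma
  shows X_op_crossed_mult: "apply_endo (X_op k) (crossed_mult a b) =
      crossed_mult (apply_endo (X_op k) a) b +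
      (\<Sum>i\<in>UNIV. crossed_mult (apply_endo (sigma_op i [k]) a) (apply_endo (X_op i) b))" (is ?X)
    and sigma_op_crossed_mult: "apply_endo (sigma_op i [j]) (crossed_mult a b) =
      (\<Sum>k\<in>UNIV. crossed_mult (apply_endo (sigma_op k [j]) a) (apply_endo (sigma_op i [k]) b))" (is ?S)
    and sigma_inv_op_crossed_mult: "apply_endo sigma_inv_op (crossed_mult a b) =
      crossed_mult (apply_endo sigma_inv_op a) (apply_endo sigma_inv_op b)" (is ?D)
proof -
  note intros = cbilinear_by_args clinear_intros clinear_compose[OF clinear_apply_endo]
    cbilinear_apply[OF cbilinear_crossed_mult]
  have monom: "apply_endo (X_op k) (monom_U \<phi> h) = monom_U \<phi> (partial_test k h)"
    "apply_endo (sigma_op i js) (monom_U \<phi> h) = monom_U \<phi> (jet_test i js \<phi> h)"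
    "apply_endo sigma_inv_op (monom_U \<phi> h) = monom_U \<phi> (det_inverse_test \<phi> h)" for k i js h and \<phi> :: "'a diffeo"
    by (rule crossed_eqI; simp add: coef_X_op coef_sigma_op coef_sigma_inv_op coef_monom_U[abs_def]
        partial_const partial_test.rep_eq jet_test.rep_eq det_inverse_test.rep_eq scaleR_conv_of_real)+
  have chain: "partial k (\<lambda>y. f (Rep_diffeo \<phi> y)) x =
      (\<Sum>i\<in>UNIV. partial k (\<lambda>y. Rep_diffeo \<phi> y $ i) x *\<^sub>R partial i f (Rep_diffeo \<phi> x))"
    if "smooth f" for k x and \<phi> :: "'a diffeo" and f :: "real^'a \<Rightarrow> complex"
    using that by (intro partial_chain smooth_differentiable smooth_diffeo)
  have chain': "partial j (\<lambda>y. Rep_diffeo \<psi> (Rep_diffeo \<phi> y) $ i) x =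
      (\<Sum>k\<in>UNIV. partial j (\<lambda>y. Rep_diffeo \<phi> y $ k) x * partial k (\<lambda>y. Rep_diffeo \<psi> y $ i) (Rep_diffeo \<phi> x))"
    for i j x and \<phi> \<psi> :: "'a diffeo"
    using partial_chain[of "\<lambda>y. Rep_diffeo \<psi> y $ i" "Rep_diffeo \<phi>" j x]
    by (simp add: smooth_differentiable smooth_diffeo smooth_diffeo_component)
  note reps = twisted_mult.rep_eq partial_test.rep_eq jet_test.rep_eq det_inverse_test.rep_eq diffeo_comp.rep_eq
    partials_Cons partials_Nil
  have leibniz: "partial k (\<lambda>y. Rep_test_function h y * Rep_test_function l (Rep_diffeo \<phi> y)) x =
     Rep_test_function h x * partial k (\<lambda>y. Rep_test_function l (Rep_diffeo \<phi> y)) x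
     + partial k (Rep_test_function h) x * Rep_test_function l (Rep_diffeo \<phi> x)" for h l x and \<phi> :: "'a diffeo"
    by (subst partial_bounded_bilinear[OF bounded_bilinear_mult])
       (auto intro!: smooth_differentiable smooth_compose smooth_test_function smooth_diffeo)
  show ?X
    by (rule crossed_cbilinear_ext[where a = a and b = b], (intro intros)[1], (intro intros)[1])
       (rule crossed_eqI, simp add: monom crossed_mult_monom_U coef_simps coef_monom_U reps leibniz chain
         smooth_test_function sum_distrib_left scaleR_conv_of_real mult_ac)
  show ?S
    by (rule crossed_cbilinear_ext[where a = a and b = b], (intro intros)[1], (intro intros)[1])
       (rule crossed_eqI, simp add: monom crossed_mult_monom_U coef_simps coef_monom_U reps chain'
         smooth_diffeo_component sum_distrib_right sum_distrib_left scaleR_conv_of_real mult_ac)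
  show ?D
    by (rule crossed_cbilinear_ext[where a = a and b = b], (intro intros)[1], (intro intros)[1])
       (rule crossed_eqI, simp add: monom crossed_mult_monom_U coef_simps coef_monom_U reps
         jacobian_compose smooth_diffeo det_mul scaleR_conv_of_real mult_ac)
qed

section \<open>Natural operators\<close>

text \<open>
  The operators of \<open>\<K>\<^sub>n\<close> are built from derivatives of \<open>f\<close> and from the jets of \<open>\<phi>\<close> of positive
  order. Hence the germ at \<open>x\<close> of the coefficient of \<open>U\<^sup>*\<^bsub>\<phi>\<^esub>\<close> in the image depends only on the germ at
  \<open>x\<close> of the same coefficient of the argument, and it does not change when \<open>\<phi>\<close> is followed by a translation.
  The last point allows to move \<open>\<phi> x\<close> to any given point, where another factor can take over.
\<close>

definition natural_operator :: "'n::finite crossed endo \<Rightarrow> bool" where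
  "natural_operator k \<longleftrightarrow> (\<forall>a b \<phi> \<psi> c x. (\<forall>y. Rep_diffeo \<psi> y = Rep_diffeo \<phi> y + c) \<longrightarrow>
    (\<forall>\<^sub>F y in nhds x. coef a \<phi> y = coef b \<psi> y) \<longrightarrow>
    (\<forall>\<^sub>F y in nhds x. coef (apply_endo k a) \<phi> y = coef (apply_endo k b) \<psi> y))"

lemma natural_operatorD:
  "natural_operator k \<Longrightarrow> (\<And>y. Rep_diffeo \<psi> y = Rep_diffeo \<phi> y + c) \<Longrightarrow>
    (\<forall>\<^sub>F y in nhds x. coef a \<phi> y = coef b \<psi> y) \<Longrightarrow> coef (apply_endo k a) \<phi> x = coef (apply_endo k b) \<psi> x"
  unfolding natural_operator_def by (blast dest: eventually_nhds_x_imp_x)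

lemma natural_operator_coef:
  assumes "natural_operator k"
  shows "(\<forall>\<^sub>F y in nhds x. coef a \<phi> y = coef b \<phi> y) \<Longrightarrow> coef (apply_endo k a) \<phi> x = coef (apply_endo k b) \<phi> x"
  by (rule natural_operatorD[OF assms, where c = 0]) simp_all

lemma natural_operator_monom_U:
  assumes "natural_operator k"
  shows "apply_endo k (monom_U \<phi> h) = monom_U \<phi> (Poly_Mapping.lookup (apply_endo k (monom_U \<phi> h)) \<phi>)"
proof (rule crossed_eqI)
  fix \<psi> x
  have "coef (apply_endo k (monom_U \<phi> h)) \<psi> x = coef (apply_endo k 0) \<psi> x" if "\<psi> \<noteq> \<phi>"
    using that by (intro natural_operator_coef[OF assms]) (simp add: coef_monom_U zero_test_function.rep_eq)
  then show "coef (apply_endo k (monom_U \<phi> h)) \<psi> x = coef (monom_U \<phi> (Poly_Mapping.lookup (apply_endo k (monom_U \<phi> h)) \<phi>)) \<psi> x"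
    by (auto simp: coef_monom_U clinear_zero[OF clinear_apply_endo] zero_test_function.rep_eq)
qed

text \<open>
  The equation \<open>k(1) = c 1\<close>, expressed by functions that are constant near a point. Values \<open>d\<close> other than \<open>1\<close> are
  included because \<open>l(1) = d 1\<close> is what a second operator is applied to.
\<close>

definition has_counit :: "'n::finite crossed endo \<Rightarrow> complex \<Rightarrow> bool" where
  "has_counit k c \<longleftrightarrow> (\<forall>a d x. (\<forall>\<^sub>F y in nhds x. coef a diffeo_id y = d) \<longrightarrow>
    (\<forall>\<^sub>F y in nhds x. coef (apply_endo k a) diffeo_id y = c * d))"

lemma operator_counit_eqI:
  assumes nat: "natural_operator k" and c: "has_counit k c"
  shows "operator_counit k = c"
proof -
  have val: "value_at_one k \<phi> x = (if \<phi> = diffeo_id then c else 0)" for \<phi> x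
  proof -
    have eval: "coef (apply_endo k (monom_U diffeo_id h)) \<phi> x = (if \<phi> = diffeo_id then c else 0)"
      if "\<forall>\<^sub>F y in nhds x. Rep_test_function h y = 1" for h
    proof (cases "\<phi> = diffeo_id")
      case True
      have "\<forall>\<^sub>F y in nhds x. coef (apply_endo k (monom_U diffeo_id h)) diffeo_id y = c * 1"
        using that by (intro c[unfolded has_counit_def, rule_format]) (simp add: coef_monom_U)
      with True show ?thesis by (auto dest: eventually_nhds_x_imp_x)
    next
      case False
      then show ?thesis
        by (subst natural_operator_monom_U[OF nat]) (simp add: coef_monom_U)
    qed
    moreover obtain h where "\<forall>\<^sub>F y in nhds x. Rep_test_function h y = 1"
      using ex_bump_function by blast
    ultimately show ?thesis unfolding value_at_one_def by (intro the_equality) auto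
  qed
  show ?thesis
    unfolding operator_counit_def val by (rule the_equality) (auto dest: spec[of _ diffeo_id])
qed

lemma operator_counit_eval:
  assumes "natural_operator k" "has_counit k c" "\<forall>\<^sub>F y in nhds x. Rep_test_function h y = 1"
  shows "operator_counit k = coef (apply_endo k (monom_U diffeo_id h)) diffeo_id x"
proof -
  have "\<forall>\<^sub>F y in nhds x. coef (apply_endo k (monom_U diffeo_id h)) diffeo_id y = c * 1"
    using assms(3) by (intro assms(2)[unfolded has_counit_def, rule_format]) (simp add: coef_monom_U)
  then show ?thesis
    using operator_counit_eqI[OF assms(1,2)] by (auto dest: eventually_nhds_x_imp_x)
qed

lemma partials_const: "\<exists>c. partials js (\<lambda>x. d) = (\<lambda>x. c)"
  by (induction js arbitrary: d) (auto simp: partials_Cons partials_Nil partial_const)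

lemma has_counit_X_op: "has_counit (X_op l) 0"
  unfolding has_counit_def coef_X_op
  using partial_cong_germ[where g = "\<lambda>y. d" for d] by (fastforce simp: partial_const)

text \<open>The counit exists on the generators because the jets of the identity are constant functions.\<close>

lemma generated_natural_counit:
  assumes "k \<in> generated_subalgebra (range X_op \<union> {sigma_op i js | i js. js \<noteq> []} \<union> {sigma_inv_op})"
  shows "natural_operator k \<and> (\<exists>c. has_counit k c)"
  using assms
proof induction
  case (gen k)
  have translate: "partial j (\<lambda>y. Rep_diffeo \<psi> y $ i) = partial j (\<lambda>y. Rep_diffeo \<phi> y $ i)"
    if "\<And>y. Rep_diffeo \<psi> y = Rep_diffeo \<phi> y + c" for \<phi> \<psi> :: "'a diffeo" and c i j
  proof -
    have "partial j (\<lambda>y. Rep_diffeo \<phi> y $ i + c $ i) = (\<lambda>x. partial j (\<lambda>y. Rep_diffeo \<phi> y $ i) x + 0)"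
      using partial_const[of j "c $ i"] by (subst partial_add) (auto intro!: smooth_differentiable smooth_diffeo_component)
    then show ?thesis by (simp add: that)
  qed
  have translate_det: "det (jacobian (Rep_diffeo \<psi>) (at x)) = det (jacobian (Rep_diffeo \<phi>) (at x))"
    if "\<And>y. Rep_diffeo \<psi> y = Rep_diffeo \<phi> y + c" for \<phi> \<psi> :: "'a diffeo" and c x
  proof -
    have "jacobian (Rep_diffeo \<psi>) (at x) = jacobian (Rep_diffeo \<phi>) (at x)"
      using translate[OF that]
      by (simp add: vec_eq_iff jacobian_entry smooth_differentiable smooth_diffeo)
    then show ?thesis by simp
  qed
  have partial_id: "partial j (\<lambda>y::real^'a. y $ i) = (\<lambda>x. axis j 1 $ i)" for i j
    using partial_bounded_linear[OF bounded_linear_vec_nth, of "\<lambda>y. y" j i]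
    by (simp add: partial_def frechet_derivative_ident)
  from gen consider (X) l where "k = X_op l" | (sigma) i j js where "k = sigma_op i (j # js)" | (inv) "k = sigma_inv_op"
    by (auto simp: neq_Nil_conv)
  then show ?case
  proof cases
    case X
    have "natural_operator k"
      unfolding natural_operator_def X by (simp add: coef_X_op partial_cong_germ)
    moreover have "has_counit k 0" unfolding X by (rule has_counit_X_op)
    ultimately show ?thesis by blast
  next
    case sigma
    have nat: "natural_operator k"
      unfolding natural_operator_def sigma coef_sigma_op partials_Cons
    proof (intro allI impI)
      fix a b :: "'a crossed" and \<phi> \<psi> :: "'a diffeo" and c x
      assume *: "\<forall>y. Rep_diffeo \<psi> y = Rep_diffeo \<phi> y + c"
      assume "\<forall>\<^sub>F y in nhds x. coef a \<phi> y = coef b \<psi> y"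
      then show "\<forall>\<^sub>F y in nhds x. of_real (partials js (partial j (\<lambda>y. Rep_diffeo \<phi> y $ i)) y) * coef a \<phi> y =
          of_real (partials js (partial j (\<lambda>y. Rep_diffeo \<psi> y $ i)) y) * coef b \<psi> y"
        by eventually_elim (simp add: translate[OF *[rule_format]])
    qed
    obtain c where "partials js (\<lambda>x::real^'a. axis j 1 $ i :: real) = (\<lambda>x. c)"
      using partials_const by blast
    then have "has_counit k (of_real c)"
      unfolding has_counit_def sigma coef_sigma_op partials_Cons diffeo_id.rep_eq partial_id
      by (auto elim: eventually_mono)
    with nat show ?thesis by blast
  next
    case inv
    have nat: "natural_operator k"
      unfolding natural_operator_def inv coef_sigma_inv_op
    proof (intro allI impI)
      fix a b :: "'a crossed" and \<phi> \<psi> :: "'a diffeo" and c x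
      assume *: "\<forall>y. Rep_diffeo \<psi> y = Rep_diffeo \<phi> y + c"
      assume "\<forall>\<^sub>F y in nhds x. coef a \<phi> y = coef b \<psi> y"
      then show "\<forall>\<^sub>F y in nhds x. of_real (inverse (det (jacobian (Rep_diffeo \<phi>) (at y)))) * coef a \<phi> y =
          of_real (inverse (det (jacobian (Rep_diffeo \<psi>) (at y)))) * coef b \<psi> y"
        by eventually_elim (simp add: translate_det[OF *[rule_format]])
    qed
    have "jacobian (\<lambda>x. x) (at x) = (mat 1 :: real^'a^'a)" for x
      by (simp add: jacobian_def frechet_derivative_ident matrix_id_mat_1[unfolded id_def])
    then have "has_counit k 1"
      unfolding has_counit_def inv coef_sigma_inv_op diffeo_id.rep_eq by (auto elim: eventually_mono)
    with nat show ?thesis by blast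
  qed
next
  case one
  have "natural_operator 1" "has_counit 1 1"
    by (simp_all add: natural_operator_def has_counit_def one_endo.rep_eq)
  then show ?case by blast
next
  case (add k l)
  then obtain c d where cd: "has_counit k c" "has_counit l d" by blast
  have "natural_operator (k + l)"
    unfolding natural_operator_def plus_endo.rep_eq coef_simps
  proof (intro allI impI)
    fix a b :: "'a crossed" and \<phi> \<psi> e x
    assume "\<forall>y. Rep_diffeo \<psi> y = Rep_diffeo \<phi> y + e" "\<forall>\<^sub>F y in nhds x. coef a \<phi> y = coef b \<psi> y"
    then have "\<forall>\<^sub>F y in nhds x. coef (apply_endo k a) \<phi> y = coef (apply_endo k b) \<psi> y"
      "\<forall>\<^sub>F y in nhds x. coef (apply_endo l a) \<phi> y = coef (apply_endo l b) \<psi> y"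
      using add unfolding natural_operator_def by blast+
    then show "\<forall>\<^sub>F y in nhds x. coef (apply_endo k a) \<phi> y + coef (apply_endo l a) \<phi> y =
        coef (apply_endo k b) \<psi> y + coef (apply_endo l b) \<psi> y"
      by eventually_elim simp
  qed
  moreover have "has_counit (k + l) (c + d)"
    unfolding has_counit_def plus_endo.rep_eq coef_simps
  proof (intro allI impI)
    fix a :: "'a crossed" and e x assume "\<forall>\<^sub>F y in nhds x. coef a diffeo_id y = e"
    then have "\<forall>\<^sub>F y in nhds x. coef (apply_endo k a) diffeo_id y = c * e"
      "\<forall>\<^sub>F y in nhds x. coef (apply_endo l a) diffeo_id y = d * e"
      using cd unfolding has_counit_def by blast+
    then show "\<forall>\<^sub>F y in nhds x. coef (apply_endo k a) diffeo_id y + coef (apply_endo l a) diffeo_id y = (c + d) * e"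
      by eventually_elim (simp add: algebra_simps)
  qed
  ultimately show ?case by blast
next
  case (scale k e)
  then obtain c where c: "has_counit k c" by blast
  have "natural_operator (e *\<^sub>C k)"
    unfolding natural_operator_def scaleC_endo.rep_eq coef_simps
  proof (intro allI impI)
    fix a b :: "'a crossed" and \<phi> \<psi> d x
    assume "\<forall>y. Rep_diffeo \<psi> y = Rep_diffeo \<phi> y + d" "\<forall>\<^sub>F y in nhds x. coef a \<phi> y = coef b \<psi> y"
    then have "\<forall>\<^sub>F y in nhds x. coef (apply_endo k a) \<phi> y = coef (apply_endo k b) \<psi> y"
      using scale unfolding natural_operator_def by blast
    then show "\<forall>\<^sub>F y in nhds x. e * coef (apply_endo k a) \<phi> y = e * coef (apply_endo k b) \<psi> y"
      by eventually_elim simp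
  qed
  moreover have "has_counit (e *\<^sub>C k) (e * c)"
    unfolding has_counit_def scaleC_endo.rep_eq coef_simps
  proof (intro allI impI)
    fix a :: "'a crossed" and d x assume "\<forall>\<^sub>F y in nhds x. coef a diffeo_id y = d"
    then have "\<forall>\<^sub>F y in nhds x. coef (apply_endo k a) diffeo_id y = c * d"
      using c unfolding has_counit_def by blast
    then show "\<forall>\<^sub>F y in nhds x. e * coef (apply_endo k a) diffeo_id y = e * c * d"
      by eventually_elim simp
  qed
  ultimately show ?case by blast
next
  case (mult k l)
  then obtain c d where cd: "has_counit k c" "has_counit l d" by blast
  have "natural_operator (k * l)"
    using mult unfolding natural_operator_def times_endo.rep_eq by blast
  moreover have "has_counit (k * l) (c * d)"
    using cd unfolding has_counit_def times_endo.rep_eq mult.assoc by blast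
  ultimately show ?case by blast
qed

definition translated :: "real^'n \<Rightarrow> 'n::finite diffeo \<Rightarrow> 'n diffeo" where
  "translated c \<phi> = Abs_diffeo (\<lambda>y. Rep_diffeo \<phi> y + c)"

lemma orientation_preserving_translated:
  assumes "orientation_preserving_diffeo \<phi>"
  shows "orientation_preserving_diffeo (\<lambda>y. \<phi> y + c)"
proof -
  from assms
  have \<phi>: "smooth \<phi>" "bij \<phi>" "smooth (inv \<phi>)" "\<And>x. det (jacobian \<phi> (at x)) > 0"
    by (auto simp: orientation_preserving_diffeo_def)
  have surj: "\<phi> (inv \<phi> y) = y" and inj: "inv \<phi> (\<phi> y) = y" for y
    using \<phi>(2) by (simp_all add: bij_def surj_f_inv_f)
  have bij: "bij (\<lambda>y. \<phi> y + c)"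
    by (rule o_bij[where g = "\<lambda>z. inv \<phi> (z - c)"]) (simp_all add: fun_eq_iff surj inj)
  have "inv (\<lambda>y. \<phi> y + c) = (\<lambda>z. inv \<phi> (z - c))"
    by (rule inv_unique_comp) (simp_all add: fun_eq_iff surj inj)
  moreover have "smooth (\<lambda>z. inv \<phi> (z - c))"
    by (intro smooth_compose[OF \<phi>(3)] smooth_diff smooth_id smooth_const)
  moreover have "jacobian (\<lambda>y. \<phi> y + c) (at x) = jacobian \<phi> (at x)" for x
  proof -
    have "(\<phi> has_derivative frechet_derivative \<phi> (at x)) (at x)"
      using \<phi>(1) smooth_differentiable frechet_derivative_works by blast
    from has_derivative_add[OF this has_derivative_const[of c]]
    have "((\<lambda>y. \<phi> y + c) has_derivative frechet_derivative \<phi> (at x)) (at x)" by simp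
    from frechet_derivative_at[OF this] show ?thesis by (simp add: jacobian_def)
  qed
  ultimately show "orientation_preserving_diffeo (\<lambda>y. \<phi> y + c)"
    unfolding orientation_preserving_diffeo_def using bij \<phi>
    by (simp add: smooth_add smooth_const)
qed

lemma Rep_translated: "Rep_diffeo (translated c \<phi>) y = Rep_diffeo \<phi> y + c"
  using Rep_diffeo[of \<phi>] by (simp add: translated_def Abs_diffeo_inverse orientation_preserving_translated)

section \<open>Coproduct and counit of natural operators\<close>

definition is_coproduct :: "('k \<Rightarrow> 'n::finite crossed endo) \<Rightarrow> 'n crossed endo \<Rightarrow> ('k::complex_vector, 'k) tensor \<Rightarrow> bool" where
  "is_coproduct r T t \<longleftrightarrow> (\<forall>a b. apply_endo T (crossed_mult a b) =
     tensor_lift (\<lambda>k1 k2. crossed_mult (apply_endo (r k1) a) (apply_endo (r k2) b)) t)"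

lemma cbilinear_apply_endo: "cbilinear apply_endo"
  by (intro cbilinear_by_args clinear_apply_endo clinear_apply_endo_left)

lemma cbilinear_operator_product:
  "clinear r \<Longrightarrow> cbilinear (\<lambda>k1 k2. crossed_mult (apply_endo (r k1) a) (apply_endo (r k2) b))"
  by (intro cbilinear_by_args cbilinear_apply[OF cbilinear_crossed_mult] cbilinear_apply[OF cbilinear_apply_endo])

lemma is_coproduct_elem:
  assumes "clinear r" "\<And>a b. apply_endo T (crossed_mult a b) = crossed_mult (apply_endo (r k) a) (apply_endo (r l) b)"
  shows "is_coproduct r T (k \<otimes>\<^sub>t l)"
  unfolding is_coproduct_def by (simp add: assms(2) tensor_lift_elem[OF cbilinear_operator_product[OF assms(1)]])

lemma is_coproduct_add:
  assumes "clinear r" "is_coproduct r S s" "is_coproduct r T t"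
  shows "is_coproduct r (S + T) (s + t)"
  using assms(2,3) unfolding is_coproduct_def
  by (simp add: plus_endo.rep_eq clinear_add[OF clinear_tensor_lift[OF cbilinear_operator_product[OF assms(1)]]])

lemma is_coproduct_scale:
  assumes "clinear r" "is_coproduct r T t"
  shows "is_coproduct r (c *\<^sub>C T) (c *\<^sub>C t)"
  using assms(2) unfolding is_coproduct_def
  by (simp add: scaleC_endo.rep_eq clinear_scale[OF clinear_tensor_lift[OF cbilinear_operator_product[OF assms(1)]]])

lemma is_coproduct_mult:
  fixes r :: "'k::complex_algebra_1 \<Rightarrow> 'n::finite crossed endo"
  assumes r: "clinear r" and mult: "\<And>k l. r (k * l) = r k * r l"
    and S: "is_coproduct r S s" and T: "is_coproduct r T t"
  shows "is_coproduct r (S * T) (s * t)"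
  unfolding is_coproduct_def
proof (intro allI)
  fix a b
  let ?G = "\<lambda>a b k1 k2. crossed_mult (apply_endo (r k1) a) (apply_endo (r k2) b)"
  have G: "cbilinear (?G a b)" for a b by (rule cbilinear_operator_product[OF r])
  have inner: "cbilinear (\<lambda>k1 k2. tensor_lift (\<lambda>l1 l2. ?G (apply_endo (r k1) a) (apply_endo (r k2) b) l1 l2) s)" for s
    by (intro cbilinear_by_args clinear_intros cbilinear_apply[OF cbilinear_crossed_mult]
        cbilinear_apply[OF cbilinear_apply_endo] clinear_compose[OF clinear_apply_endo] r)
  have st: "tensor_lift (\<lambda>k1 k2. tensor_lift (?G (apply_endo (r k1) a) (apply_endo (r k2) b)) s) t = tensor_lift (?G a b) (s * t)"
  proof (rule tensor_ext[where t = t])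
    show "clinear (tensor_lift (\<lambda>k1 k2. tensor_lift (?G (apply_endo (r k1) a) (apply_endo (r k2) b)) s))"
      by (rule clinear_tensor_lift[OF inner])
    show "clinear (\<lambda>t. tensor_lift (?G a b) (s * t))"
      by (intro clinear_compose[OF clinear_tensor_lift[OF G]] clinear_intros)
    fix x y
    have "tensor_lift (?G (apply_endo (r x) a) (apply_endo (r y) b)) s = tensor_lift (?G a b) (s * (x \<otimes>\<^sub>t y))"
      by (rule tensor_ext[where t = s], rule clinear_tensor_lift[OF G],
          rule clinear_compose[OF clinear_tensor_lift[OF G]], intro clinear_intros)
         (simp add: tensor_lift_elem[OF G] tensor_mult_elem' mult times_endo.rep_eq)
    then show "tensor_lift (\<lambda>k1 k2. tensor_lift (?G (apply_endo (r k1) a) (apply_endo (r k2) b)) s) (x \<otimes>\<^sub>t y) =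
        tensor_lift (?G a b) (s * (x \<otimes>\<^sub>t y))"
      by (simp add: tensor_lift_elem[OF inner])
  qed
  have "apply_endo (S * T) (crossed_mult a b) = apply_endo S (tensor_lift (?G a b) t)"
    using T by (simp add: is_coproduct_def times_endo.rep_eq)
  also have "\<dots> = tensor_lift (\<lambda>k1 k2. apply_endo S (?G a b k1 k2)) t"
    by (rule clinear_tensor_lift_fun[OF clinear_apply_endo])
  also have "\<dots> = tensor_lift (\<lambda>k1 k2. tensor_lift (?G (apply_endo (r k1) a) (apply_endo (r k2) b)) s) t"
    using S by (simp add: is_coproduct_def)
  finally show "apply_endo (S * T) (crossed_mult a b) = tensor_lift (?G a b) (s * t)"
    by (simp add: st)
qed

lemma tensor_functional_assoc:
  assumes f: "clinear f" and g: "clinear g" and e: "clinear e"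
  shows "tensor_functional f (tensor_functional g e) (tensor_assoc s) = tensor_functional (tensor_functional f g) e s"
proof -
  note lin = clinear_tensor_functional[OF f clinear_tensor_functional[OF g e]]
    clinear_tensor_functional[OF clinear_tensor_functional[OF f g] e]
  have "tensor_functional f (tensor_functional g e) (tensor_assoc (t \<otimes>\<^sub>t z)) = tensor_functional (tensor_functional f g) e (t \<otimes>\<^sub>t z)" for t z
    by (rule tensor_ext[where t = t],
        rule clinear_compose[OF lin(1) clinear_compose[OF clinear_tensor_assoc cbilinear_apply(1)[OF cbilinear_tensor_elem clinear_ident]]],
        rule clinear_compose[OF lin(2) cbilinear_apply(1)[OF cbilinear_tensor_elem clinear_ident]])
       (simp add: tensor_assoc_elem tensor_functional_elem clinear_tensor_functional f g e)
  then show ?thesis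
    by - (rule tensor_ext[where t = s], rule clinear_compose[OF lin(1) clinear_tensor_assoc], rule lin(2))
qed

lemma tensor_functional_map:
  assumes "clinear f" "clinear g" "clinear F" "clinear G"
  shows "tensor_functional f g (tensor_map F G t) = tensor_functional (\<lambda>x. f (F x)) (\<lambda>y. g (G y)) t"
  using assms
  by - (rule tensor_ext[where t = t], simp_all add: tensor_functional_elem tensor_map_elem clinear_tensor_functional
      clinear_tensor_map clinear_compose[of "tensor_functional f g"] clinear_compose[of f] clinear_compose[of g])

lemma diffeo_comp_assoc: "diffeo_comp \<theta> (diffeo_comp \<psi> \<phi>) = diffeo_comp (diffeo_comp \<theta> \<psi>) \<phi>"
  by transfer simp

lemma diffeo_comp_id: "diffeo_comp \<phi> diffeo_id = \<phi>" "diffeo_comp diffeo_id \<phi> = \<phi>"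
  by (transfer; simp)+

lemma twisted_mult_assoc:
  "twisted_mult (diffeo_comp \<psi> \<phi>) (twisted_mult \<phi> h l) m = twisted_mult \<phi> h (twisted_mult \<psi> l m)"
  by transfer (simp add: mult.assoc)

text \<open>
  The functionals \<open>(\<phi>, x, h) : k \<mapsto> (k (h U\<^sup>*\<^bsub>\<phi>\<^esub>))\<^bsub>\<phi>\<^esub> (x)\<close> separate operators. A coproduct pairs with two of them by
  \<open>\<langle>\<Delta> k, (\<phi>, x, h) \<otimes> (\<psi>, \<phi> x, l)\<rangle> = \<langle>k, (\<psi> \<phi>, x, h (l \<circ> \<phi>))\<rangle>\<close>, and since a translation after \<open>\<phi>\<close> does not
  change the first functional, this covers every pair. So the coproduct is unique, and its laws become
  the associativity and the units of the product of functionals on the right-hand side.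
\<close>

locale natural_coalgebra =
  fixes r :: "'k::complex_vector \<Rightarrow> 'n::finite crossed endo"
  assumes r: "clinear r" and inj: "r k = 0 \<Longrightarrow> k = 0"
    and natural: "natural_operator (r k)" and ex_counit: "\<exists>c. has_counit (r k) c"
    and ex_coproduct: "\<exists>t. is_coproduct r (r k) t"
begin

definition ev :: "'n diffeo \<Rightarrow> real^'n \<Rightarrow> 'n test_function \<Rightarrow> 'k \<Rightarrow> complex" where
  "ev \<phi> x h k = coef (apply_endo (r k) (monom_U \<phi> h)) \<phi> x"

definition evs :: "('k \<Rightarrow> complex) set" where
  "evs = {ev \<phi> x h | \<phi> x h. True}"

lemma clinear_ev: "clinear (ev \<phi> x h)"
  unfolding ev_def by (intro clinear_compose[OF clinear_coef] clinear_compose[OF clinear_apply_endo_left] r)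

lemma coef_eq_ev: "coef (apply_endo (r k) a) \<phi> x = ev \<phi> x (Poly_Mapping.lookup a \<phi>) k"
  unfolding ev_def by (rule natural_operator_coef[OF natural]) (simp add: coef_monom_U)

lemma separating_evs: "separating evs"
  unfolding separating_def
proof (intro conjI ballI allI impI)
  show "clinear f" if "f \<in> evs" for f
    using that by (auto simp: evs_def clinear_ev)
  fix k assume "\<forall>f\<in>evs. f k = 0"
  then have "ev \<phi> x h k = 0" for \<phi> x h unfolding evs_def by blast
  then have "r k = 0"
    by (intro operator_eqI) (simp add: coef_eq_ev zero_endo.rep_eq zero_test_function.rep_eq)
  then show "k = 0" by (rule inj)
qed

lemma ev_move:
  obtains \<phi>' where "ev \<phi>' x h = ev \<phi> x h" "Rep_diffeo \<phi>' x = y"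
proof
  let ?\<phi> = "translated (y - Rep_diffeo \<phi> x) \<phi>"
  show "ev ?\<phi> x h = ev \<phi> x h"
    unfolding ev_def
    by (rule ext, rule sym, rule natural_operatorD[OF natural Rep_translated]) (simp add: coef_monom_U)
  show "Rep_diffeo ?\<phi> x = y" by (simp add: Rep_translated)
qed

lemma coproduct_pairing:
  assumes "is_coproduct r T t"
  shows "tensor_functional (ev \<phi> x h) (ev \<psi> (Rep_diffeo \<phi> x) l) t =
    coef (apply_endo T (monom_U (diffeo_comp \<psi> \<phi>) (twisted_mult \<phi> h l))) (diffeo_comp \<psi> \<phi>) x"
proof -
  let ?G = "\<lambda>k1 k2. crossed_mult (apply_endo (r k1) (monom_U \<phi> h)) (apply_endo (r k2) (monom_U \<psi> l))"
  have G: "cbilinear ?G" by (rule cbilinear_operator_product[OF r])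
  have "tensor_functional (ev \<phi> x h) (ev \<psi> (Rep_diffeo \<phi> x) l) t = coef (tensor_lift ?G t) (diffeo_comp \<psi> \<phi>) x"
  proof (rule tensor_ext[where t = t])
    fix k1 k2
    define h1 where "h1 = Poly_Mapping.lookup (apply_endo (r k1) (monom_U \<phi> h)) \<phi>"
    define l1 where "l1 = Poly_Mapping.lookup (apply_endo (r k2) (monom_U \<psi> l)) \<psi>"
    have "apply_endo (r k1) (monom_U \<phi> h) = monom_U \<phi> h1" "apply_endo (r k2) (monom_U \<psi> l) = monom_U \<psi> l1"
      unfolding h1_def l1_def by (rule natural_operator_monom_U[OF natural])+
    then show "tensor_functional (ev \<phi> x h) (ev \<psi> (Rep_diffeo \<phi> x) l) (k1 \<otimes>\<^sub>t k2) =
        coef (tensor_lift ?G (k1 \<otimes>\<^sub>t k2)) (diffeo_comp \<psi> \<phi>) x"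
      by (simp add: tensor_functional_elem clinear_ev tensor_lift_elem[OF G] crossed_mult_monom_U coef_monom_U
          twisted_mult.rep_eq) (simp add: ev_def h1_def l1_def)
  qed (intro clinear_tensor_functional clinear_ev clinear_compose[OF clinear_coef] clinear_tensor_lift G)+
  also have "tensor_lift ?G t = apply_endo T (monom_U (diffeo_comp \<psi> \<phi>) (twisted_mult \<phi> h l))"
    using assms by (simp add: is_coproduct_def flip: crossed_mult_monom_U)
  finally show ?thesis .
qed

lemma coproduct_unique:
  assumes "is_coproduct r T s" "is_coproduct r T t"
  shows "s = t"
proof (rule separating_eqI[OF separating_tensor[OF separating_evs separating_evs]])
  fix f assume "f \<in> {tensor_functional f g | f g. f \<in> evs \<and> g \<in> evs}"
  then obtain \<phi> x h \<psi> y l where f: "f = tensor_functional (ev \<phi> x h) (ev \<psi> y l)"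
    unfolding evs_def by blast
  obtain \<phi>' where "ev \<phi>' x h = ev \<phi> x h" "Rep_diffeo \<phi>' x = y" by (rule ev_move)
  then have "f = tensor_functional (ev \<phi>' x h) (ev \<psi> (Rep_diffeo \<phi>' x) l)" by (simp add: f)
  then show "f s = f t" using assms by (simp add: coproduct_pairing)
qed

lemma comult_eqI: "is_coproduct r (r k) t \<Longrightarrow> operator_comult r k = t"
  unfolding operator_comult_def is_coproduct_def[symmetric]
  by (rule the_equality) (auto intro: coproduct_unique)

lemma is_coproduct_comult: "is_coproduct r (r k) (operator_comult r k)"
  using ex_coproduct comult_eqI by metis

lemma comult_pairing:
  "tensor_functional (ev \<phi> x h) (ev \<psi> (Rep_diffeo \<phi> x) l) (operator_comult r k) =
    ev (diffeo_comp \<psi> \<phi>) x (twisted_mult \<phi> h l) k"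
  by (simp add: coproduct_pairing[OF is_coproduct_comult] ev_def)

lemma clinear_comult: "clinear (operator_comult r)"
  by (rule clinearI; rule comult_eqI)
     (simp_all add: clinear_add[OF r] clinear_scale[OF r] is_coproduct_add is_coproduct_scale r is_coproduct_comult)

lemma coassoc:
  "tensor_assoc (tensor_map (operator_comult r) id (operator_comult r k)) =
    tensor_map id (operator_comult r) (operator_comult r k)" (is "?s = ?t")
proof (rule separating_eqI[OF separating_tensor[OF separating_evs separating_tensor[OF separating_evs separating_evs]]])
  fix f assume "f \<in> {tensor_functional f g | f g. f \<in> evs \<and> g \<in> {tensor_functional f g | f g. f \<in> evs \<and> g \<in> evs}}"
  then obtain \<phi> x h \<psi>0 y l \<theta> z m where
    f: "f = tensor_functional (ev \<phi> x h) (tensor_functional (ev \<psi>0 y l) (ev \<theta> z m))"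
    unfolding evs_def by blast
  obtain \<psi> where \<psi>: "ev \<psi> y l = ev \<psi>0 y l" "Rep_diffeo \<psi> y = z" by (rule ev_move)
  obtain \<phi>' where \<phi>': "ev \<phi>' x h = ev \<phi> x h" "Rep_diffeo \<phi>' x = y" by (rule ev_move)
  let ?f = "ev \<phi>' x h" and ?g = "ev \<psi> y l" and ?e = "ev \<theta> z m"
  have f': "f = tensor_functional ?f (tensor_functional ?g ?e)" by (simp add: f \<psi> \<phi>')
  have fg: "(\<lambda>k. tensor_functional ?f ?g (operator_comult r k)) = ev (diffeo_comp \<psi> \<phi>') x (twisted_mult \<phi>' h l)"
    using comult_pairing[of \<phi>' x h \<psi> l] \<phi>'(2) by auto
  have ge: "(\<lambda>k. tensor_functional ?g ?e (operator_comult r k)) = ev (diffeo_comp \<theta> \<psi>) y (twisted_mult \<psi> l m)"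
    using comult_pairing[of \<psi> y l \<theta> m] \<psi>(2) by auto
  have z: "Rep_diffeo (diffeo_comp \<psi> \<phi>') x = z"
    by (simp add: diffeo_comp.rep_eq \<phi>'(2) \<psi>(2))
  have "f ?s = tensor_functional (\<lambda>k. tensor_functional ?f ?g (operator_comult r k)) ?e (operator_comult r k)"
    by (simp add: f' tensor_functional_assoc clinear_ev tensor_functional_map clinear_tensor_functional
        clinear_comult clinear_ident id_def)
  also have "\<dots> = ev (diffeo_comp \<theta> (diffeo_comp \<psi> \<phi>')) x (twisted_mult (diffeo_comp \<psi> \<phi>') (twisted_mult \<phi>' h l) m) k"
    unfolding fg using comult_pairing[of "diffeo_comp \<psi> \<phi>'" x _ \<theta> m] z by simp
  also have "\<dots> = ev (diffeo_comp (diffeo_comp \<theta> \<psi>) \<phi>') x (twisted_mult \<phi>' h (twisted_mult \<psi> l m)) k"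
    by (simp add: diffeo_comp_assoc twisted_mult_assoc)
  also have "\<dots> = tensor_functional ?f (\<lambda>k. tensor_functional ?g ?e (operator_comult r k)) (operator_comult r k)"
    unfolding ge using comult_pairing[of \<phi>' x h "diffeo_comp \<theta> \<psi>"] \<phi>'(2) by simp
  also have "\<dots> = f ?t"
    by (simp add: f' clinear_ev tensor_functional_map clinear_tensor_functional clinear_comult clinear_ident id_def)
  finally show "f ?s = f ?t" .
qed

lemma counit_eq_ev:
  assumes "\<forall>\<^sub>F y in nhds x. Rep_test_function h y = 1"
  shows "(\<lambda>k. operator_counit (r k)) = ev diffeo_id x h"
proof
  fix k
  obtain c where "has_counit (r k) c" using ex_counit by blast
  then show "operator_counit (r k) = ev diffeo_id x h k"
    unfolding ev_def by (rule operator_counit_eval[OF natural _ assms])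
qed

lemma ev_cong_germ:
  assumes "\<forall>\<^sub>F y in nhds x. Rep_test_function h y = Rep_test_function l y"
  shows "ev \<phi> x h = ev \<phi> x l"
  unfolding ev_def using assms
  by (intro ext natural_operator_coef[OF natural]) (simp add: coef_monom_U)

lemma clinear_counit: "clinear (\<lambda>k. operator_counit (r k))"
proof -
  obtain h :: "'n test_function" where "\<forall>\<^sub>F y in nhds 0. Rep_test_function h y = 1" using ex_bump_function by blast
  from counit_eq_ev[OF this] show ?thesis by (simp add: clinear_ev)
qed

lemma counit_left: "tensor_lift (\<lambda>k l. operator_counit (r k) *\<^sub>C l) (operator_comult r k) = k"
proof (rule separating_eqI[OF separating_evs])
  fix f assume "f \<in> evs"
  then obtain \<phi> x h where f: "f = ev \<phi> x h" unfolding evs_def by blast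
  obtain b where b: "\<forall>\<^sub>F y in nhds x. Rep_test_function b y = 1" using ex_bump_function by blast
  have "f (tensor_lift (\<lambda>k l. operator_counit (r k) *\<^sub>C l) (operator_comult r k)) =
      tensor_functional (\<lambda>k. operator_counit (r k)) (ev \<phi> x h) (operator_comult r k)"
    by (simp add: f tensor_functional_def clinear_tensor_lift_fun[OF clinear_ev] clinear_scale[OF clinear_ev] scaleC_complex_def)
  also have "\<dots> = ev \<phi> x (twisted_mult diffeo_id b h) k"
    using comult_pairing[of diffeo_id x b \<phi> h k]
    by (simp add: counit_eq_ev[OF b] diffeo_id.rep_eq diffeo_comp_id)
  also have "ev \<phi> x (twisted_mult diffeo_id b h) = ev \<phi> x h"
    using b by (intro ev_cong_germ) (auto simp: twisted_mult.rep_eq diffeo_id.rep_eq elim: eventually_mono)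
  finally show "f (tensor_lift (\<lambda>k l. operator_counit (r k) *\<^sub>C l) (operator_comult r k)) = f k"
    by (simp add: f)
qed

lemma counit_right: "tensor_lift (\<lambda>k l. operator_counit (r l) *\<^sub>C k) (operator_comult r k) = k"
proof (rule separating_eqI[OF separating_evs])
  fix f assume "f \<in> evs"
  then obtain \<phi> x h where f: "f = ev \<phi> x h" unfolding evs_def by blast
  obtain b where b: "\<forall>\<^sub>F y in nhds (Rep_diffeo \<phi> x). Rep_test_function b y = 1" using ex_bump_function by blast
  have "f (tensor_lift (\<lambda>k l. operator_counit (r l) *\<^sub>C k) (operator_comult r k)) =
      tensor_functional (ev \<phi> x h) (\<lambda>k. operator_counit (r k)) (operator_comult r k)"
    by (simp add: f tensor_functional_def clinear_tensor_lift_fun[OF clinear_ev] clinear_scale[OF clinear_ev]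
        scaleC_complex_def mult.commute)
  also have "\<dots> = ev \<phi> x (twisted_mult \<phi> h b) k"
    using comult_pairing[of \<phi> x h diffeo_id b k]
    by (simp add: counit_eq_ev[OF b] diffeo_comp_id)
  also have "ev \<phi> x (twisted_mult \<phi> h b) = ev \<phi> x h"
  proof (rule ev_cong_germ)
    have "(Rep_diffeo \<phi> \<longlongrightarrow> Rep_diffeo \<phi> x) (nhds x)"
      using smooth_isCont[OF smooth_diffeo] by (simp add: isCont_def tendsto_at_iff_tendsto_nhds)
    from eventually_compose_filterlim[OF b this]
    show "\<forall>\<^sub>F y in nhds x. Rep_test_function (twisted_mult \<phi> h b) y = Rep_test_function h y"
      by (auto simp: twisted_mult.rep_eq elim: eventually_mono)
  qed
  finally show "f (tensor_lift (\<lambda>k l. operator_counit (r l) *\<^sub>C k) (operator_comult r k)) = f k"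
    by (simp add: f)
qed

end

section \<open>The commutative subalgebra and its derivations\<close>

lemma generated_subalgebra_subset:
  assumes "G \<subseteq> generated_subalgebra H"
  shows "generated_subalgebra G \<subseteq> generated_subalgebra H"
proof
  fix x assume "x \<in> generated_subalgebra G"
  then show "x \<in> generated_subalgebra H"
    by induction (use assms in \<open>auto intro: generated_subalgebra.intros\<close>)
qed

lemma generated_subalgebra_sum: "(\<And>i. i \<in> A \<Longrightarrow> f i \<in> generated_subalgebra G) \<Longrightarrow> sum f A \<in> generated_subalgebra G"
  by (induction A rule: infinite_finite_induct) (auto intro: generated_subalgebra_zero generated_subalgebra.add)

abbreviation kn_set :: "'n::finite crossed endo set" where
  "kn_set \<equiv> generated_subalgebra (range X_op \<union> {sigma_op i [j] | i j. True} \<union> {sigma_inv_op})"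

abbreviation kab_set :: "'n::finite crossed endo set" where
  "kab_set \<equiv> generated_subalgebra ({sigma_op i js | i js. js \<noteq> []} \<union> {sigma_inv_op})"

abbreviation jet_algebra :: "'n::finite crossed endo set" where
  "jet_algebra \<equiv> generated_subalgebra {sigma_op i js | i js. js \<noteq> []}"

lemma sigma_op_in_kn_set:
  assumes "js \<noteq> []"
  shows "sigma_op i js \<in> kn_set"
  using assms
proof (induction js rule: rev_nonempty_induct)
  case (single j)
  show ?case by (rule generated_subalgebra.gen) blast
next
  case (snoc l js)
  have "X_op l \<in> kn_set" by (rule generated_subalgebra.gen) blast
  with snoc show ?case
    unfolding commutator_X_sigma[symmetric]
    by (intro generated_subalgebra_diff generated_subalgebra.mult)
qed

lemma kab_set_subset_kn_set: "kab_set \<subseteq> kn_set"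
proof (rule generated_subalgebra_subset)
  have "sigma_inv_op \<in> kn_set" by (rule generated_subalgebra.gen) blast
  then show "{sigma_op i js | i js. js \<noteq> []} \<union> {sigma_inv_op} \<subseteq> kn_set"
    using sigma_op_in_kn_set by blast
qed

lemma kn_set_natural_counit: "k \<in> kn_set \<Longrightarrow> natural_operator k \<and> (\<exists>c. has_counit k c)"
  by (rule generated_natural_counit, erule set_mp[rotated], rule generated_subalgebra_subset)
     (auto intro: generated_subalgebra.gen)

definition is_multiplication :: "'n::finite crossed endo \<Rightarrow> ('n diffeo \<Rightarrow> real^'n \<Rightarrow> complex) \<Rightarrow> bool" where
  "is_multiplication T F \<longleftrightarrow> (\<forall>a \<phi> x. coef (apply_endo T a) \<phi> x = F \<phi> x * coef a \<phi> x)"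

lemma is_multiplication_intros:
  "is_multiplication 1 (\<lambda>\<phi> x. 1)"
  "is_multiplication S F \<Longrightarrow> is_multiplication T G \<Longrightarrow> is_multiplication (S + T) (\<lambda>\<phi> x. F \<phi> x + G \<phi> x)"
  "is_multiplication S F \<Longrightarrow> is_multiplication (c *\<^sub>C S) (\<lambda>\<phi> x. c * F \<phi> x)"
  "is_multiplication S F \<Longrightarrow> is_multiplication T G \<Longrightarrow> is_multiplication (S * T) (\<lambda>\<phi> x. F \<phi> x * G \<phi> x)"
  by (simp_all add: is_multiplication_def one_endo.rep_eq plus_endo.rep_eq scaleC_endo.rep_eq times_endo.rep_eq
      coef_simps distrib_right mult.assoc)

lemma kab_set_multiplication: "T \<in> kab_set \<Longrightarrow> \<exists>F. is_multiplication T F"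
proof (induction rule: generated_subalgebra.induct)
  case (gen T)
  then show ?case by (auto simp: is_multiplication_def coef_sigma_op coef_sigma_inv_op)
next
  case one
  show ?case using is_multiplication_intros(1) by blast
next
  case (add S T)
  then show ?case using is_multiplication_intros(2) by blast
next
  case (scale S c)
  then show ?case using is_multiplication_intros(3) by blast
next
  case (mult S T)
  then show ?case using is_multiplication_intros(4) by blast
qed

lemma kab_set_commute:
  assumes "S \<in> kab_set" "T \<in> kab_set"
  shows "S * T = T * S"
proof -
  obtain F G where "is_multiplication S F" "is_multiplication T G"
    using assms kab_set_multiplication by blast
  then show ?thesis
    by (intro operator_eqI) (simp add: is_multiplication_def times_endo.rep_eq)
qed

text \<open>
  The inverse of \<open>\<sigma>\<^sup>-\<^sup>1\<close> is a polynomial \<open>D\<close> in the \<open>\<sigma>\<^sup>i\<^sub>j\<close>. Hence \<open>[X\<^sub>l, \<sigma>\<^sup>-\<^sup>1] = - \<sigma>\<^sup>-\<^sup>1 [X\<^sub>l, D] \<sigma>\<^sup>-\<^sup>1\<close>, and only commutators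
  with the \<open>\<sigma>\<^sup>i\<close> remain.
\<close>

lemma ex_det_operator:
  "\<exists>D \<in> jet_algebra. is_multiplication D (\<lambda>\<phi> x. of_real (det (jacobian (Rep_diffeo \<phi>) (at x))))"
proof -
  \<comment> \<open>functions form a commutative ring, so the determinant can be built from its entries on this side\<close>
  define symbols :: "('a diffeo \<Rightarrow> real^'a \<Rightarrow> complex) set"
    where "symbols = {F. \<exists>T\<in>jet_algebra. is_multiplication T F}"
  have const: "(\<lambda>\<phi> x. c) \<in> symbols" for c
    using is_multiplication_intros(3)[OF is_multiplication_intros(1), of c]
    by (auto simp: symbols_def intro!: bexI[of _ "c *\<^sub>C 1"] generated_subalgebra.intros)
  have add: "(\<lambda>\<phi> x. F \<phi> x + G \<phi> x) \<in> symbols" if "F \<in> symbols" "G \<in> symbols" for F G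
    using that unfolding symbols_def
    by (blast intro: is_multiplication_intros generated_subalgebra.add)
  have mult: "(\<lambda>\<phi> x. F \<phi> x * G \<phi> x) \<in> symbols" if "F \<in> symbols" "G \<in> symbols" for F G
    using that unfolding symbols_def
    by (blast intro: is_multiplication_intros generated_subalgebra.mult)
  have sums: "(\<lambda>\<phi> x. \<Sum>i\<in>A. F i \<phi> x) \<in> symbols" if "\<And>i. F i \<in> symbols" for F :: "'c \<Rightarrow> _" and A
    by (induction A rule: infinite_finite_induct) (simp_all add: const add that)
  have prods: "(\<lambda>\<phi> x. \<Prod>i\<in>A. F i \<phi> x) \<in> symbols" if "\<And>i. F i \<in> symbols" for F :: "'c \<Rightarrow> _" and A
    by (induction A rule: infinite_finite_induct) (simp_all add: const mult that)
  have entry: "(\<lambda>\<phi> x. of_real (jacobian (Rep_diffeo \<phi>) (at x) $ i $ j)) \<in> symbols" for i j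
    by (auto simp: symbols_def is_multiplication_def coef_sigma_op partials_Cons partials_Nil
        jacobian_entry smooth_differentiable smooth_diffeo
        intro!: bexI[of _ "sigma_op i [j]"] generated_subalgebra.gen)
  have "(\<lambda>\<phi> x. of_real (det (jacobian (Rep_diffeo \<phi>) (at x)))) \<in> symbols"
    unfolding det_def of_real_sum of_real_mult of_real_prod by (intro sums mult prods entry const)
  then show ?thesis by (simp add: symbols_def)
qed

lemma commutator_in_generated:
  fixes X :: "'a::complex_algebra_1"
  assumes T: "T \<in> generated_subalgebra G" and "G \<subseteq> generated_subalgebra H"
    and gen: "\<And>g. g \<in> G \<Longrightarrow> X * g - g * X \<in> generated_subalgebra H"
  shows "X * T - T * X \<in> generated_subalgebra H"
  using T
proof induction
  case (mult S T)
  have "S \<in> generated_subalgebra H" "T \<in> generated_subalgebra H"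
    using mult generated_subalgebra_subset[OF assms(2)] by auto
  then have "(X * S - S * X) * T + S * (X * T - T * X) \<in> generated_subalgebra H"
    using mult by (intro generated_subalgebra.add generated_subalgebra.mult)
  then show ?case by (simp add: algebra_simps)
next
  case (add S T)
  then have "(X * S - S * X) + (X * T - T * X) \<in> generated_subalgebra H"
    by (intro generated_subalgebra.add)
  then show ?case by (simp add: algebra_simps)
next
  case (scale T c)
  then have "c *\<^sub>C (X * T - T * X) \<in> generated_subalgebra H"
    by (intro generated_subalgebra.scale)
  then show ?case by (simp add: scaleC_mult_left scaleC_mult_right complex_vector.scale_right_diff_distrib)
qed (simp_all add: gen generated_subalgebra_zero)

lemma commutator_X_kab_set:
  assumes "T \<in> kab_set"
  shows "X_op l * T - T * X_op l \<in> kab_set"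
proof (rule commutator_in_generated[OF assms])
  have jet: "jet_algebra \<subseteq> kab_set"
    by (rule generated_subalgebra_subset) (auto intro: generated_subalgebra.gen)
  show "{sigma_op i js | i js. js \<noteq> []} \<union> {sigma_inv_op} \<subseteq> kab_set"
    by (auto intro: generated_subalgebra.gen)
  fix g :: "'a crossed endo" assume g: "g \<in> {sigma_op i js | i js. js \<noteq> []} \<union> {sigma_inv_op}"
  show "X_op l * g - g * X_op l \<in> kab_set"
  proof (cases "g = sigma_inv_op")
    case False
    with g obtain i js where "g = sigma_op i js" by auto
    then have "X_op l * g - g * X_op l = sigma_op i (js @ [l])" by (simp add: commutator_X_sigma)
    moreover have "sigma_op i (js @ [l]) \<in> kab_set"
      by (rule generated_subalgebra.gen) blast
    ultimately show ?thesis by simp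
  next
    case True
    obtain D :: "'a crossed endo" where D: "D \<in> jet_algebra"
      "is_multiplication D (\<lambda>\<phi> x. of_real (det (jacobian (Rep_diffeo \<phi>) (at x))))"
      using ex_det_operator by blast
    have "det (jacobian (Rep_diffeo \<phi>) (at x)) \<noteq> 0" for \<phi> and x :: "real^'a"
      using det_jacobian_pos[of \<phi> x] by simp
    then have inv: "g * D = 1" "D * g = 1"
      using D(2) unfolding True
      by (intro operator_eqI, simp add: is_multiplication_def times_endo.rep_eq one_endo.rep_eq coef_sigma_inv_op)+
    have "X_op l * D - D * X_op l \<in> jet_algebra"
    proof (rule commutator_in_generated[OF D(1)])
      fix g :: "'a crossed endo" assume "g \<in> {sigma_op i js | i js. js \<noteq> []}"
      then obtain i js where "g = sigma_op i js" by blast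
      then have "X_op l * g - g * X_op l = sigma_op i (js @ [l])" by (simp add: commutator_X_sigma)
      moreover have "sigma_op i (js @ [l]) \<in> jet_algebra"
        by (rule generated_subalgebra.gen) blast
      ultimately show "X_op l * g - g * X_op l \<in> jet_algebra" by simp
    qed (blast intro: generated_subalgebra.gen)
    moreover have "g \<in> kab_set" unfolding True by (rule generated_subalgebra.gen) blast
    \<comment> \<open>the derivative of an inverse\<close>
    ultimately have "- (g * (X_op l * D - D * X_op l) * g) \<in> kab_set"
      using jet by (intro generated_subalgebra_uminus generated_subalgebra.mult) auto
    moreover have "- (g * (X_op l * D - D * X_op l) * g) = X_op l * g - g * X_op l"
    proof -
      have "g * (X_op l * D - D * X_op l) * g = g * X_op l * (D * g) - (g * D) * X_op l * g"
        by (simp add: algebra_simps)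
      then show ?thesis by (simp add: inv)
    qed
    ultimately show ?thesis by simp
  qed
qed

text \<open>
  The coordinate of an element of \<open>V\<close> along \<open>X\<^sub>l\<close> is its value at \<open>0\<close> on a function that coincides with the \<open>l\<close>-th
  coordinate function near \<open>0\<close>. In particular the \<open>X\<^sub>l\<close> are a basis of \<open>V\<close>.
\<close>

definition coordinate_test :: "'n \<Rightarrow> 'n::finite test_function" where
  "coordinate_test l = (SOME h. \<forall>\<^sub>F y in nhds 0. Rep_test_function h y = of_real (y $ l))"

definition lie_V_coord :: "'n::finite \<Rightarrow> 'n lie_V \<Rightarrow> complex" where
  "lie_V_coord l x = coef (apply_endo (Rep_lie_V x) (monom_U diffeo_id (coordinate_test l))) diffeo_id 0"

lemma coordinate_test: "\<forall>\<^sub>F y in nhds 0. Rep_test_function (coordinate_test l) y = of_real (y $ l)"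
  unfolding coordinate_test_def
  by (rule someI_ex, rule ex_test_function_germ)
     (rule smooth_bounded_linear[OF bounded_linear_of_real smooth_coordinate])

lemma partial_coordinate: "partial k (\<lambda>y::real^'n. y $ l) x = (if k = l then 1 else 0)"
  using partial_bounded_linear[OF bounded_linear_vec_nth, of "\<lambda>y. y" k l]
  by (auto simp: partial_def frechet_derivative_ident axis_def)

lemma partial_of_real:
  "(\<And>x. f differentiable at x) \<Longrightarrow> partial k (\<lambda>y. of_real (f y) :: complex) x = of_real (partial k f x)"
  by (simp add: partial_bounded_linear[OF bounded_linear_of_real])

lemma X_op_coordinate_test:
  "coef (apply_endo (X_op k) (monom_U diffeo_id (coordinate_test l))) diffeo_id 0 = (if k = l then 1 else 0)"
  using eventually_nhds_x_imp_x[OF partial_cong_germ[OF coordinate_test, of k l]]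
  by (simp add: coef_X_op coef_monom_U[abs_def] partial_of_real smooth_differentiable smooth_coordinate partial_coordinate)

lemma Rep_lie_V_expand: "Rep_lie_V x = (\<Sum>l\<in>UNIV. lie_V_coord l x *\<^sub>C X_op l)"
proof -
  define c where "c Y l = coef (apply_endo Y (monom_U diffeo_id (coordinate_test l))) diffeo_id 0"
    for Y :: "'a crossed endo" and l
  have c: "clinear (\<lambda>Y. c Y l)" for l
    unfolding c_def by (intro clinear_compose[OF clinear_coef] clinear_apply_endo_left)
  define E where "E Y = (\<Sum>l\<in>UNIV. c Y l *\<^sub>C X_op l)" for Y
  have E: "clinear E"
    unfolding E_def by (intro clinear_intros c)
  have "E (Rep_lie_V x) = Rep_lie_V x"
  proof (rule complex_vector.span_induct[OF Rep_lie_V, where P = "\<lambda>Y. E Y = Y"])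
    show "complex_vector.subspace {Y. E Y = Y}"
      by (rule complex_vector.subspaceI) (simp_all add: clinear_zero[OF E] clinear_add[OF E] clinear_scale[OF E])
    fix Y :: "'a crossed endo" assume "Y \<in> range X_op"
    then obtain k where Y: "Y = X_op k" by blast
    have "E Y = (\<Sum>l\<in>UNIV. if k = l then X_op k else 0)"
      unfolding E_def c_def Y by (intro sum.cong) (auto simp: X_op_coordinate_test scaleC_one)
    then show "E Y = Y" by (simp add: Y)
  qed
  then show ?thesis by (simp add: E_def c_def lie_V_coord_def)
qed

lemma clinear_Rep_lie_V: "clinear Rep_lie_V"
  by (rule clinearI) (simp_all add: plus_lie_V.rep_eq scaleC_lie_V.rep_eq)

lemma clinear_lie_V_coord: "clinear (lie_V_coord l)"
  unfolding lie_V_coord_def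
  by (intro clinear_compose[OF clinear_coef] clinear_compose[OF clinear_apply_endo_left] clinear_Rep_lie_V)

lemma lie_V_coord_X_V: "lie_V_coord l (X_V k) = (if k = l then 1 else 0)"
  by (simp add: lie_V_coord_def X_V.rep_eq X_op_coordinate_test)

lemma lie_V_expand: "x = (\<Sum>l\<in>UNIV. lie_V_coord l x *\<^sub>C X_V l)"
  by (rule Rep_lie_V_inject[THEN iffD1])
     (simp add: clinear_sum[OF clinear_Rep_lie_V] clinear_scale[OF clinear_Rep_lie_V] X_V.rep_eq Rep_lie_V_expand[of x])

lemma lie_V_clinear_ext:
  assumes f: "clinear f" and g: "clinear g" and "\<And>l. f (X_V l) = g (X_V l)"
  shows "f x = g x"
  by (subst (1 2) lie_V_expand)
     (simp add: clinear_sum[OF f] clinear_scale[OF f] clinear_sum[OF g] clinear_scale[OF g] assms(3))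

lemma Rep_lie_V_commute: "Rep_lie_V x * Rep_lie_V y = Rep_lie_V y * Rep_lie_V x"
proof -
  have "Rep_lie_V (X_V l) * Rep_lie_V y = Rep_lie_V y * Rep_lie_V (X_V l)" for l
    by (rule lie_V_clinear_ext[where x = y]; (intro clinear_intros clinear_Rep_lie_V)?)
       (simp add: X_V.rep_eq X_op_commute)
  then show ?thesis
    by (intro lie_V_clinear_ext[where x = x, OF cbilinear_apply(1)[OF cbilinear_times clinear_Rep_lie_V]
          cbilinear_apply(2)[OF cbilinear_times clinear_Rep_lie_V]])
qed

lemma Rep_V_act: "Rep_kab (V_act x f) = Rep_lie_V x * Rep_kab f - Rep_kab f * Rep_lie_V x"
proof -
  have "Rep_lie_V x * Rep_kab f - Rep_kab f * Rep_lie_V x =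
      (\<Sum>l\<in>UNIV. lie_V_coord l x *\<^sub>C (X_op l * Rep_kab f - Rep_kab f * X_op l))"
    by (simp add: Rep_lie_V_expand[of x] sum_distrib_left sum_distrib_right scaleC_mult_left scaleC_mult_right
        complex_vector.scale_right_diff_distrib sum_subtractf)
  also have "\<dots> \<in> kab_set"
    by (intro generated_subalgebra_sum generated_subalgebra.scale commutator_X_kab_set Rep_kab)
  finally show ?thesis by (simp add: V_act_def Abs_kab_inverse)
qed

lemma Rep_kab_eqI: "Rep_kab f = Rep_kab g \<Longrightarrow> f = g"
  by (simp add: Rep_kab_inject)

lemma clinear_Rep_kab: "clinear Rep_kab"
  and clinear_Rep_kn: "clinear Rep_kn"
  by (rule clinearI; simp add: plus_kab.rep_eq scaleC_kab.rep_eq plus_kn.rep_eq scaleC_kn.rep_eq)+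

lemma kab_commute: "f * g = g * (f :: 'n::finite kab)"
  by (rule Rep_kab_eqI) (simp add: times_kab.rep_eq kab_set_commute[OF Rep_kab[of f] Rep_kab[of g]])

lemma cbilinear_V_act: "cbilinear V_act"
  by (rule cbilinearI; rule Rep_kab_eqI)
     (simp_all add: Rep_V_act clinear_add[OF clinear_Rep_kab] clinear_scale[OF clinear_Rep_kab] plus_lie_V.rep_eq
       scaleC_lie_V.rep_eq algebra_simps scaleC_mult_left scaleC_mult_right complex_vector.scale_right_diff_distrib)

lemma V_act_mult: "V_act x (f * g) = V_act x f * g + f * V_act x g"
  and V_act_one: "V_act x 1 = 0"
  by (rule Rep_kab_eqI; simp add: Rep_V_act times_kab.rep_eq plus_kab.rep_eq one_kab.rep_eq zero_kab.rep_eq algebra_simps)+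

lemma V_act_commute: "V_act x (V_act y f) = V_act y (V_act x f)"
proof (rule Rep_kab_eqI)
  have "Rep_kab f * Rep_lie_V x * Rep_lie_V y = Rep_kab f * Rep_lie_V y * Rep_lie_V x"
    by (simp add: mult.assoc Rep_lie_V_commute[of x y])
  then show "Rep_kab (V_act x (V_act y f)) = Rep_kab (V_act y (V_act x f))"
    by (simp add: Rep_V_act right_diff_distrib left_diff_distrib Rep_lie_V_commute[of x y] flip: mult.assoc)
qed

lemma sigma_kab_derivative: "V_act (X_V l) (sigma_kab k m) = V_act (X_V m) (sigma_kab k l)"
  by (rule Rep_kab_eqI) (simp add: Rep_V_act X_V.rep_eq sigma_kab.rep_eq commutator_X_sigma sigma_op_symmetric)

section \<open>The bialgebra structures\<close>

abbreviation kn_comult :: "'n::finite kn \<Rightarrow> ('n kn, 'n kn) tensor" where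
  "kn_comult \<equiv> operator_comult Rep_kn"

abbreviation kab_comult :: "'n::finite kab \<Rightarrow> ('n kab, 'n kab) tensor" where
  "kab_comult \<equiv> operator_comult Rep_kab"

lemma tensor_lift_diff_fun: "tensor_lift (\<lambda>x y. f x y - g x y) t = tensor_lift f t - tensor_lift g t"
  by (simp add: tensor_lift_def linear_extension_def case_prod_unfold complex_vector.scale_right_diff_distrib sum_subtractf)

text \<open>
  The commutator of the coproduct \<open>X\<^sub>l \<otimes> 1 + \<sigma>\<^sup>k\<^sub>l \<otimes> X\<^sub>k\<close> of \<open>X\<^sub>l\<close> with \<open>t\<close> has no factor \<open>X\<^sub>k\<close> left, as the
  \<open>\<sigma>\<^sup>k\<^sub>l\<close> commute with \<open>t\<close>; so the coproduct of \<open>[X\<^sub>l, T]\<close> is again made of multiplication operators.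
\<close>

lemma is_coproduct_commutator:
  assumes T: "is_coproduct Rep_kab T t"
  shows "\<exists>t'. is_coproduct Rep_kab (X_op l * T - T * X_op l) t'"
proof -
  let ?G = "\<lambda>a b f1 f2. crossed_mult (apply_endo (Rep_kab f1) a) (apply_endo (Rep_kab f2) b)"
  define W where "W f1 f2 = V_act (X_V l) f1 \<otimes>\<^sub>t f2 + (\<Sum>k\<in>UNIV. (sigma_kab k l * f1) \<otimes>\<^sub>t V_act (X_V k) f2)"
    for f1 f2 :: "'a kab"
  have G: "cbilinear (?G a b)" for a b by (rule cbilinear_operator_product[OF clinear_Rep_kab])
  note Glin = clinear_add[OF clinear_tensor_lift[OF G]] clinear_sum[OF clinear_tensor_lift[OF G]]
  note cm = cbilinear_crossed_mult
  have diff1: "crossed_mult (a - a') b = crossed_mult a b - crossed_mult a' b" for a a' b :: "'a crossed"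
    by (rule clinear_diff[OF cbilinear_apply(1)[OF cm clinear_ident]])
  have diff2: "crossed_mult a (b - b') = crossed_mult a b - crossed_mult a b'" for a b b' :: "'a crossed"
    by (rule clinear_diff[OF cbilinear_apply(2)[OF cm clinear_ident]])
  have "is_coproduct Rep_kab (X_op l * T - T * X_op l) (tensor_lift W t)"
    unfolding is_coproduct_def
  proof (intro allI)
    fix a b
    have pointwise: "apply_endo (X_op l) (?G a b f1 f2) -
        (?G (apply_endo (X_op l) a) b f1 f2 + (\<Sum>k\<in>UNIV. ?G (apply_endo (sigma_op k [l]) a) (apply_endo (X_op k) b) f1 f2))
      = tensor_lift (?G a b) (W f1 f2)" for f1 f2
    proof -
      have "apply_endo (Rep_kab f1) (apply_endo (sigma_op k [l]) a) = apply_endo (sigma_op k [l]) (apply_endo (Rep_kab f1) a)" for k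
        using kab_commute[of f1 "sigma_kab k l"]
        by (metis Rep_kab_inject times_kab.rep_eq times_endo.rep_eq sigma_kab.rep_eq)
      then show ?thesis
        by (simp add: W_def Glin tensor_lift_elem[OF G] X_op_crossed_mult Rep_V_act X_V.rep_eq sigma_kab.rep_eq
            times_kab.rep_eq times_endo.rep_eq minus_endo.rep_eq diff1 diff2 sum_subtractf)
    qed
    have "apply_endo (X_op l * T - T * X_op l) (crossed_mult a b) = tensor_lift (\<lambda>f1 f2. apply_endo (X_op l) (?G a b f1 f2)) t -
        (tensor_lift (?G (apply_endo (X_op l) a) b) t +
         (\<Sum>k\<in>UNIV. tensor_lift (?G (apply_endo (sigma_op k [l]) a) (apply_endo (X_op k) b)) t))"
      using T by (simp add: minus_endo.rep_eq times_endo.rep_eq X_op_crossed_mult is_coproduct_def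
          clinear_add[OF clinear_apply_endo] clinear_sum[OF clinear_apply_endo] clinear_tensor_lift_fun[OF clinear_apply_endo])
    also have "\<dots> = tensor_lift (\<lambda>f1 f2. tensor_lift (?G a b) (W f1 f2)) t"
      by (simp only: pointwise[symmetric] tensor_lift_diff_fun tensor_lift_add_fun tensor_lift_sum_fun)
    also have "\<dots> = tensor_lift (?G a b) (tensor_lift W t)"
      by (rule clinear_tensor_lift_fun[OF clinear_tensor_lift[OF G], symmetric])
    finally show "apply_endo (X_op l * T - T * X_op l) (crossed_mult a b) = tensor_lift (?G a b) (tensor_lift W t)" .
  qed
  then show ?thesis by blast
qed

lemma ex_coproduct_kab:
  assumes "T \<in> kab_set"
  shows "\<exists>t. is_coproduct Rep_kab T t"
  using assms
proof (induction rule: generated_subalgebra.induct)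
  case (gen T)
  note lin = clinear_tensor_lift[OF cbilinear_operator_product[OF clinear_Rep_kab]]
  have sigma: "\<exists>t. is_coproduct Rep_kab (sigma_op i js) t" if "js \<noteq> []" for i :: 'a and js
    using that
  proof (induction js rule: rev_nonempty_induct)
    case (single j)
    have "is_coproduct Rep_kab (sigma_op i [j]) (\<Sum>k\<in>UNIV. sigma_kab k j \<otimes>\<^sub>t sigma_kab i k)"
      unfolding is_coproduct_def
      by (simp add: clinear_sum[OF lin] tensor_lift_elem cbilinear_operator_product clinear_Rep_kab
          sigma_kab.rep_eq sigma_op_crossed_mult)
    then show ?case by blast
  next
    case (snoc l js)
    then show ?case unfolding commutator_X_sigma[symmetric] using is_coproduct_commutator by blast
  qed
  have "Rep_kab (Abs_kab sigma_inv_op) = (sigma_inv_op :: 'a crossed endo)"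
    by (rule Abs_kab_inverse, rule generated_subalgebra.gen) blast
  then have "is_coproduct Rep_kab (sigma_inv_op :: 'a crossed endo) (Abs_kab sigma_inv_op \<otimes>\<^sub>t Abs_kab sigma_inv_op)"
    by (intro is_coproduct_elem clinear_Rep_kab) (simp add: sigma_inv_op_crossed_mult)
  with gen sigma show ?case by blast
next
  case one
  have "is_coproduct Rep_kab 1 (1 \<otimes>\<^sub>t 1)"
    by (intro is_coproduct_elem clinear_Rep_kab) (simp add: one_endo.rep_eq one_kab.rep_eq)
  then show ?case by blast
next
  case (add S T)
  then show ?case using is_coproduct_add[OF clinear_Rep_kab] by blast
next
  case (scale T c)
  then show ?case using is_coproduct_scale[OF clinear_Rep_kab] by blast
next
  case (mult S T)
  then show ?case using is_coproduct_mult[OF clinear_Rep_kab times_kab.rep_eq] by blast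
qed

lift_definition X_kn :: "'n::finite \<Rightarrow> 'n kn" is X_op
  by (rule generated_subalgebra.gen) blast

lift_definition sigma_kn :: "'n::finite \<Rightarrow> 'n \<Rightarrow> 'n kn" is "\<lambda>i j. sigma_op i [j]"
  by (rule generated_subalgebra.gen) blast

lift_definition sigma_inv_kn :: "'n::finite kn" is sigma_inv_op
  by (rule generated_subalgebra.gen) blast

lemma is_coproduct_X_kn: "is_coproduct Rep_kn (X_op l) (X_kn l \<otimes>\<^sub>t 1 + (\<Sum>k\<in>UNIV. sigma_kn k l \<otimes>\<^sub>t X_kn k))"
proof -
  note lin = clinear_tensor_lift[OF cbilinear_operator_product[OF clinear_Rep_kn]]
  show ?thesis
    unfolding is_coproduct_def
    by (simp add: clinear_add[OF lin] clinear_sum[OF lin] tensor_lift_elem cbilinear_operator_product clinear_Rep_kn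
        X_kn.rep_eq sigma_kn.rep_eq one_kn.rep_eq one_endo.rep_eq X_op_crossed_mult)
qed

lemma ex_coproduct_kn:
  assumes "T \<in> kn_set"
  shows "\<exists>t. is_coproduct Rep_kn T t"
  using assms
proof (induction rule: generated_subalgebra.induct)
  case (gen T)
  note lin = clinear_tensor_lift[OF cbilinear_operator_product[OF clinear_Rep_kn]]
  have "is_coproduct Rep_kn (sigma_op i [j]) (\<Sum>k\<in>UNIV. sigma_kn k j \<otimes>\<^sub>t sigma_kn i k)" for i j :: 'a
    unfolding is_coproduct_def
    by (simp add: clinear_sum[OF lin] tensor_lift_elem cbilinear_operator_product clinear_Rep_kn
        sigma_kn.rep_eq sigma_op_crossed_mult)
  moreover have "is_coproduct Rep_kn (sigma_inv_op :: 'a crossed endo) (sigma_inv_kn \<otimes>\<^sub>t sigma_inv_kn)"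
    by (intro is_coproduct_elem clinear_Rep_kn) (simp add: sigma_inv_op_crossed_mult sigma_inv_kn.rep_eq)
  ultimately show ?case using gen is_coproduct_X_kn by blast
next
  case one
  have "is_coproduct Rep_kn 1 (1 \<otimes>\<^sub>t 1)"
    by (intro is_coproduct_elem clinear_Rep_kn) (simp add: one_endo.rep_eq one_kn.rep_eq)
  then show ?case by blast
next
  case (add S T)
  then show ?case using is_coproduct_add[OF clinear_Rep_kn] by blast
next
  case (scale T c)
  then show ?case using is_coproduct_scale[OF clinear_Rep_kn] by blast
next
  case (mult S T)
  then show ?case using is_coproduct_mult[OF clinear_Rep_kn times_kn.rep_eq] by blast
qed

interpretation kn: natural_coalgebra "Rep_kn :: 'n::finite kn \<Rightarrow> _"
proof (rule natural_coalgebra.intro)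
  fix k :: "'n kn"
  show "clinear (Rep_kn :: 'n kn \<Rightarrow> _)" by (rule clinear_Rep_kn)
  show "k = 0" if "Rep_kn k = 0" using that by (metis Rep_kn_inject zero_kn.rep_eq)
  show "natural_operator (Rep_kn k)" "\<exists>c. has_counit (Rep_kn k) c"
    using kn_set_natural_counit[OF Rep_kn] by blast+
  show "\<exists>t. is_coproduct Rep_kn (Rep_kn k) t" by (rule ex_coproduct_kn[OF Rep_kn])
qed

interpretation kab: natural_coalgebra "Rep_kab :: 'n::finite kab \<Rightarrow> _"
proof (rule natural_coalgebra.intro)
  fix k :: "'n kab"
  show "clinear (Rep_kab :: 'n kab \<Rightarrow> _)" by (rule clinear_Rep_kab)
  show "k = 0" if "Rep_kab k = 0" using that by (metis Rep_kab_inject zero_kab.rep_eq)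
  show "natural_operator (Rep_kab k)" "\<exists>c. has_counit (Rep_kab k) c"
    using kn_set_natural_counit[OF set_mp[OF kab_set_subset_kn_set Rep_kab]] by blast+
  show "\<exists>t. is_coproduct Rep_kab (Rep_kab k) t" by (rule ex_coproduct_kab[OF Rep_kab])
qed

lemma operator_counit_kn_mult: "operator_counit (Rep_kn (x * y)) = operator_counit (Rep_kn x) * operator_counit (Rep_kn y)"
  and operator_counit_one: "operator_counit 1 = 1"
proof -
  obtain c d where cd: "has_counit (Rep_kn x) c" "has_counit (Rep_kn y) d"
    using kn.ex_counit by metis
  then have "has_counit (Rep_kn (x * y)) (c * d)"
    unfolding has_counit_def times_kn.rep_eq times_endo.rep_eq mult.assoc by blast
  with cd show "operator_counit (Rep_kn (x * y)) = operator_counit (Rep_kn x) * operator_counit (Rep_kn y)"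
    by (simp add: operator_counit_eqI[OF kn.natural])
  have "natural_operator 1" "has_counit 1 1"
    by (simp_all add: natural_operator_def has_counit_def one_endo.rep_eq)
  then show "operator_counit 1 = 1" by (rule operator_counit_eqI)
qed

lemma comult_kn_mult: "kn_comult (x * y) = kn_comult x * kn_comult y"
  unfolding times_tensor_def[symmetric]
  by (intro kn.comult_eqI, unfold times_kn.rep_eq, intro is_coproduct_mult clinear_Rep_kn kn.is_coproduct_comult times_kn.rep_eq)

lemma bialgebra_kn: "bialgebra kn_bialgebra"
proof (rule bialgebra.intro; simp add: kn_bialgebra_def)
  show "cbilinear ((*) :: 'a kn \<Rightarrow> _)" by (rule cbilinear_times)
  show "x * y * z = x * (y * z)" for x y z :: "'a kn" by (rule mult.assoc)
  show "clinear (kn_comult)" by (rule kn.clinear_comult)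
  show "clinear (\<lambda>k. operator_counit (Rep_kn k))" by (rule kn.clinear_counit)
  show "tensor_assoc (tensor_map (kn_comult) id (kn_comult x)) =
      tensor_map id (kn_comult) (kn_comult x)" for x :: "'a kn" by (rule kn.coassoc)
  show "tensor_lift (\<lambda>y z. operator_counit (Rep_kn y) *\<^sub>C z) (kn_comult x) = x" for x :: "'a kn"
    by (rule kn.counit_left)
  show "tensor_lift (\<lambda>y z. operator_counit (Rep_kn z) *\<^sub>C y) (kn_comult x) = x" for x :: "'a kn"
    by (rule kn.counit_right)
  show "kn_comult (x * y) = tensor_mult (*) (*) (kn_comult x) (kn_comult y)"
    for x y :: "'a kn" by (simp add: comult_kn_mult times_tensor_def)
  show "kn_comult 1 = 1 \<otimes>\<^sub>t (1 :: 'a kn)"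
    by (intro kn.comult_eqI is_coproduct_elem clinear_Rep_kn) (simp add: one_endo.rep_eq one_kn.rep_eq)
  show "operator_counit (Rep_kn (x * y)) = operator_counit (Rep_kn x) * operator_counit (Rep_kn y)" for x y :: "'a kn"
    by (rule operator_counit_kn_mult)
  show "operator_counit (Rep_kn 1 :: 'a crossed endo) = 1" by (simp add: one_kn.rep_eq operator_counit_one)
qed

definition kab_inclusion :: "'n::finite kab \<Rightarrow> 'n kn" where
  "kab_inclusion f = Abs_kn (Rep_kab f)"

lemma Rep_kab_inclusion: "Rep_kn (kab_inclusion f) = Rep_kab f"
  unfolding kab_inclusion_def by (rule Abs_kn_inverse[OF set_mp[OF kab_set_subset_kn_set Rep_kab]])

lemma Rep_kn_eqI: "Rep_kn k = Rep_kn l \<Longrightarrow> k = l"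
  by (simp add: Rep_kn_inject)

lemma clinear_kab_inclusion: "clinear kab_inclusion"
  by (rule clinearI; rule Rep_kn_eqI)
     (simp_all add: Rep_kab_inclusion plus_kn.rep_eq scaleC_kn.rep_eq plus_kab.rep_eq scaleC_kab.rep_eq)

lemma kab_inclusion_mult: "kab_inclusion (f * g) = kab_inclusion f * kab_inclusion g"
  and kab_inclusion_one: "kab_inclusion 1 = 1"
  by (rule Rep_kn_eqI; simp add: Rep_kab_inclusion times_kn.rep_eq times_kab.rep_eq one_kn.rep_eq one_kab.rep_eq)+

lemma kab_inclusion_sigma: "kab_inclusion (sigma_kab i j) = sigma_kn i j"
  by (rule Rep_kn_eqI) (simp add: Rep_kab_inclusion sigma_kab.rep_eq sigma_kn.rep_eq)

lemma tensor_lift_map: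
  assumes "cbilinear G" "clinear f" "clinear g"
  shows "tensor_lift G (tensor_map f g t) = tensor_lift (\<lambda>x y. G (f x) (g y)) t"
proof -
  have G: "cbilinear (\<lambda>x y. G (f x) (g y))"
    by (intro cbilinear_by_args cbilinear_apply[OF assms(1)] assms)
  show ?thesis
    by (rule tensor_ext[where t = t])
       (simp_all add: clinear_compose[OF clinear_tensor_lift] clinear_tensor_map clinear_tensor_lift G assms
         tensor_map_elem tensor_lift_elem)
qed

lemma comult_kab_inclusion:
  "kn_comult (kab_inclusion f) = tensor_map kab_inclusion kab_inclusion (kab_comult f)"
proof (rule kn.comult_eqI)
  show "is_coproduct Rep_kn (Rep_kn (kab_inclusion f)) (tensor_map kab_inclusion kab_inclusion (kab_comult f))"
    using kab.is_coproduct_comult[of f]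
    by (simp add: is_coproduct_def tensor_lift_map cbilinear_operator_product clinear_Rep_kn clinear_kab_inclusion Rep_kab_inclusion)
qed

section \<open>The enveloping algebra of the translations\<close>

abbreviation X_UV :: "'n::finite \<Rightarrow> 'n UV" where
  "X_UV l \<equiv> envelope_of (X_V l)"

lemma UV_induct [case_names one X_mult add scale]:
  assumes "P 1" and X: "\<And>l u. P u \<Longrightarrow> P (X_UV l * u)"
    and add: "\<And>u v. P u \<Longrightarrow> P v \<Longrightarrow> P (u + v)" and scale: "\<And>c u. P u \<Longrightarrow> P (c *\<^sub>C u)"
  shows "P (u :: 'n::finite UV)"
proof (induction u rule: envelope_induct)
  case (of_mult x u)
  have zero: "P 0" using scale[OF assms(1), of 0] by simp
  have "P (\<Sum>l\<in>A. lie_V_coord l x *\<^sub>C (X_UV l * u))" if "finite A" for A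
    using that by (induction A) (simp_all add: zero add scale X of_mult)
  moreover have "envelope_of x * u = (\<Sum>l\<in>UNIV. lie_V_coord l x *\<^sub>C (X_UV l * u))"
    by (subst lie_V_expand[of x])
      (simp add: clinear_sum[OF clinear_envelope_of] clinear_scale[OF clinear_envelope_of] sum_distrib_right scaleC_mult_left)
  ultimately show ?case by simp
qed (use assms in auto)

lemma UV_clinear_ext:
  assumes F: "clinear F" and G: "clinear G" and "F 1 = G 1"
    and "\<And>l u. F u = G u \<Longrightarrow> F (X_UV l * u) = G (X_UV l * u)"
  shows "F u = G (u :: 'n::finite UV)"
  by (induction u rule: UV_induct)
    (simp_all add: assms(3,4) clinear_add[OF F] clinear_add[OF G] clinear_scale[OF F] clinear_scale[OF G])

lemma UV_commute: "envelope_of x * envelope_of y = envelope_of y * (envelope_of x :: 'n::finite UV)"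
proof -
  have "envelope_of x * envelope_of y - envelope_of y * envelope_of x = envelope_of (0 :: 'n lie_V)"
    using envelope_of_commutator[of x y] by (simp add: lie_bracket_lie_V_def)
  then show ?thesis by (simp only: clinear_zero[OF clinear_envelope_of] right_minus_eq)
qed

lemma lie_hom_commutingI:
  fixes g :: "'n::finite lie_V \<Rightarrow> 'b::complex_algebra_1"
  assumes "clinear g" "\<And>x y. g x * g y = g y * g x"
  shows "lie_hom g"
  using assms clinear_zero[OF assms(1)] by (simp add: lie_hom_def lie_bracket_lie_V_def)

lemma lie_hom_Rep_lie_V: "lie_hom Rep_lie_V"
  by (intro lie_hom_commutingI clinear_Rep_lie_V Rep_lie_V_commute)

lemma envelope_lift_in_kn_set: "envelope_lift Rep_lie_V u \<in> kn_set"
proof (induction u rule: UV_induct)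
  case (X_mult l u)
  have "X_op l \<in> kn_set" by (rule generated_subalgebra.gen) blast
  with X_mult show ?case
    by (simp add: envelope_lift_mult[OF lie_hom_Rep_lie_V] envelope_lift_of[OF lie_hom_Rep_lie_V] X_V.rep_eq
        generated_subalgebra.mult)
qed (simp_all add: envelope_lift_one[OF lie_hom_Rep_lie_V] clinear_add[OF clinear_envelope_lift[OF lie_hom_Rep_lie_V]]
    clinear_scale[OF clinear_envelope_lift[OF lie_hom_Rep_lie_V]] generated_subalgebra.intros)

definition UV_map :: "'n::finite UV \<Rightarrow> 'n kn" where
  "UV_map u = Abs_kn (envelope_lift Rep_lie_V u)"

lemma Rep_UV_map: "Rep_kn (UV_map u) = envelope_lift Rep_lie_V u"
  unfolding UV_map_def by (rule Abs_kn_inverse[OF envelope_lift_in_kn_set])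

lemma clinear_UV_map: "clinear UV_map"
  by (rule clinearI; rule Rep_kn_eqI)
     (simp_all add: Rep_UV_map plus_kn.rep_eq scaleC_kn.rep_eq clinear_add[OF clinear_envelope_lift[OF lie_hom_Rep_lie_V]]
       clinear_scale[OF clinear_envelope_lift[OF lie_hom_Rep_lie_V]])

lemma UV_map_one: "UV_map 1 = 1"
  and UV_map_mult: "UV_map (u * v) = UV_map u * UV_map v"
  and UV_map_X: "UV_map (X_UV l) = X_kn l"
  by (rule Rep_kn_eqI; simp add: Rep_UV_map one_kn.rep_eq times_kn.rep_eq X_kn.rep_eq X_V.rep_eq
      envelope_lift_one[OF lie_hom_Rep_lie_V] envelope_lift_mult[OF lie_hom_Rep_lie_V] envelope_lift_of[OF lie_hom_Rep_lie_V])+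

lemma kab_inclusion_V_act:
  "kab_inclusion (V_act (X_V l) f) = X_kn l * kab_inclusion f - kab_inclusion f * X_kn l"
  by (rule Rep_kn_eqI) (simp add: Rep_kab_inclusion Rep_V_act minus_kn.rep_eq times_kn.rep_eq X_kn.rep_eq X_V.rep_eq)

lemma clinear_V_act: "clinear (V_act x)"
  by (rule cbilinear_apply(2)[OF cbilinear_V_act clinear_ident])

lemma lie_hom_V_act: "lie_hom (\<lambda>x. Abs_endo (V_act x))"
proof (rule lie_hom_commutingI)
  show "clinear (\<lambda>x. Abs_endo (V_act x))"
    by (rule clinearI; rule endo_eqI)
       (simp_all add: apply_Abs_endo clinear_V_act plus_endo.rep_eq scaleC_endo.rep_eq cbilinearD[OF cbilinear_V_act])
  show "Abs_endo (V_act x) * Abs_endo (V_act y) = Abs_endo (V_act y) * Abs_endo (V_act x)" for x y :: "'n::finite lie_V"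
    by (rule endo_eqI) (simp add: times_endo.rep_eq apply_Abs_endo clinear_V_act V_act_commute[of x y])
qed

lemma UV_act_eq: "u \<triangleright> f = apply_endo (envelope_lift (\<lambda>x. Abs_endo (V_act x)) u) f"
  unfolding UV_act_def by (rule envelope_act_eq[OF clinear_V_act])

lemma cbilinear_UV_act: "cbilinear (\<triangleright>)"
  unfolding UV_act_eq
  by (intro cbilinear_by_args clinear_apply_endo clinear_compose[OF clinear_apply_endo_left]
      clinear_envelope_lift[OF lie_hom_V_act])

lemma UV_act_one: "1 \<triangleright> f = f"
  and UV_act_X_mult: "(envelope_of x * u) \<triangleright> f = V_act x (u \<triangleright> f)"
  by (simp_all add: UV_act_eq envelope_lift_one[OF lie_hom_V_act] envelope_lift_mult[OF lie_hom_V_act]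
      envelope_lift_of[OF lie_hom_V_act] one_endo.rep_eq times_endo.rep_eq apply_Abs_endo clinear_V_act)

lemma envelope_comult_one': "envelope_comult 1 = 1 \<otimes>\<^sub>t 1"
  by (simp add: envelope_comult_one one_tensor_def)

text \<open>
  The Leibniz rule for iterated derivatives: \<open>X\<^sub>l (u \<triangleright> g) = (X\<^sub>l u \<triangleright> g) + (u \<triangleright> g) X\<^sub>l\<close> as operators, and the two summands
  match those of \<open>\<Delta>(X\<^sub>l u)\<close>.
\<close>

lemma UV_leibniz:
  "tensor_lift (\<lambda>u1 u2. kab_inclusion (u1 \<triangleright> g) * UV_map u2) (envelope_comult u) = UV_map u * kab_inclusion g"
proof (rule UV_clinear_ext[where u = u])
  let ?F = "\<lambda>u1 u2. kab_inclusion (u1 \<triangleright> g) * UV_map u2"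
  have F: "cbilinear ?F"
    by (intro cbilinear_by_args clinear_intros clinear_compose[OF clinear_kab_inclusion]
        cbilinear_apply[OF cbilinear_UV_act] clinear_UV_map)
  show "clinear (\<lambda>u. tensor_lift ?F (envelope_comult u))"
    by (rule clinear_compose[OF clinear_tensor_lift[OF F] clinear_envelope_comult])
  show "clinear (\<lambda>u. UV_map u * kab_inclusion g)"
    by (intro clinear_intros clinear_UV_map)
  show "tensor_lift ?F (envelope_comult 1) = UV_map 1 * kab_inclusion g"
    by (simp add: envelope_comult_one' tensor_lift_elem[OF F] UV_act_one UV_map_one)
  fix l u assume IH: "tensor_lift ?F (envelope_comult u) = UV_map u * kab_inclusion g"
  have "tensor_lift ?F (envelope_comult (X_UV l * u)) = tensor_lift (\<lambda>u1 u2. X_kn l * ?F u1 u2) (envelope_comult u)"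
    unfolding tensor_lift_comult_of_mult[OF F]
    by (simp add: UV_act_X_mult kab_inclusion_V_act UV_map_mult UV_map_X algebra_simps)
  also have "\<dots> = X_kn l * tensor_lift ?F (envelope_comult u)"
    by (rule clinear_tensor_lift_fun[symmetric]) (intro clinear_intros)
  finally show "tensor_lift ?F (envelope_comult (X_UV l * u)) = UV_map (X_UV l * u) * kab_inclusion g"
    by (simp add: IH UV_map_mult UV_map_X mult.assoc)
qed

section \<open>The coaction\<close>

text \<open>
  The product rule for \<open>u = X\<^sub>l\<close> prescribes the operator \<open>v\<^sub>0 \<otimes> v\<^sub>1 \<mapsto> X\<^sub>k v\<^sub>0 \<otimes> \<sigma>\<^sup>k\<^sub>l v\<^sub>1 + v\<^sub>0 \<otimes> [X\<^sub>l, v\<^sub>1]\<close>. These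
  operators commute, as \<open>[X\<^sub>l, \<sigma>\<^sup>k\<^sub>m]\<close> is symmetric in \<open>l\<close> and \<open>m\<close>. So they define an action of \<open>\<U>(V)\<close>, and the
  coaction is the orbit of \<open>1 \<otimes> 1\<close>.
\<close>

definition coaction_step :: "'n::finite lie_V \<Rightarrow> ('n UV, 'n kab) tensor \<Rightarrow> ('n UV, 'n kab) tensor" where
  "coaction_step x = tensor_lift (\<lambda>v0 v1.
     (\<Sum>l\<in>UNIV. lie_V_coord l x *\<^sub>C (\<Sum>k\<in>UNIV. (X_UV k * v0) \<otimes>\<^sub>t (sigma_kab k l * v1)))
     + v0 \<otimes>\<^sub>t V_act x v1)"

lemma cbilinear_coaction_step_aux: "cbilinear (\<lambda>v0 v1.
     (\<Sum>l\<in>UNIV. lie_V_coord l x *\<^sub>C (\<Sum>k\<in>UNIV. (X_UV k * v0) \<otimes>\<^sub>t (sigma_kab k l * v1)))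
     + v0 \<otimes>\<^sub>t V_act x v1)"
  by (intro cbilinear_by_args clinear_intros cbilinear_apply[OF cbilinear_V_act])

lemma cbilinear_coaction_step: "cbilinear coaction_step"
  unfolding coaction_step_def
  by (rule cbilinear_by_args, rule clinear_tensor_lift[OF cbilinear_coaction_step_aux])
     (intro clinear_intros clinear_lie_V_coord cbilinear_apply[OF cbilinear_V_act])

lemmas clinear_coaction_step = cbilinear_apply(2)[OF cbilinear_coaction_step clinear_ident]

lemma coaction_step_X_V: "coaction_step (X_V l) (v0 \<otimes>\<^sub>t v1) =
  (\<Sum>k\<in>UNIV. (X_UV k * v0) \<otimes>\<^sub>t (sigma_kab k l * v1)) + v0 \<otimes>\<^sub>t V_act (X_V l) v1"
proof -
  have "(\<Sum>m\<in>UNIV. lie_V_coord m (X_V l) *\<^sub>C (\<Sum>k\<in>UNIV. (X_UV k * v0) \<otimes>\<^sub>t (sigma_kab k m * v1))) =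
      (\<Sum>m\<in>UNIV. if l = m then (\<Sum>k\<in>UNIV. (X_UV k * v0) \<otimes>\<^sub>t (sigma_kab k l * v1)) else 0)"
    by (intro sum.cong) (auto simp: lie_V_coord_X_V scaleC_one)
  then show ?thesis
    unfolding coaction_step_def tensor_lift_elem[OF cbilinear_coaction_step_aux] by simp
qed

lemma coaction_step_commute: "coaction_step x (coaction_step y t) = coaction_step y (coaction_step x t)"
proof -
  note lin = cbilinear_apply(1)[OF cbilinear_coaction_step clinear_ident] clinear_coaction_step
  have elem: "coaction_step (X_V l) (coaction_step (X_V m) (v0 \<otimes>\<^sub>t v1)) =
     (\<Sum>k\<in>UNIV. \<Sum>j\<in>UNIV. (X_UV j * (X_UV k * v0)) \<otimes>\<^sub>t (sigma_kab j l * (sigma_kab k m * v1)))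
     + (\<Sum>k\<in>UNIV. (X_UV k * v0) \<otimes>\<^sub>t (V_act (X_V l) (sigma_kab k m) * v1))
     + (\<Sum>k\<in>UNIV. (X_UV k * v0) \<otimes>\<^sub>t (sigma_kab k m * V_act (X_V l) v1))
     + (\<Sum>k\<in>UNIV. (X_UV k * v0) \<otimes>\<^sub>t (sigma_kab k l * V_act (X_V m) v1))
     + v0 \<otimes>\<^sub>t V_act (X_V l) (V_act (X_V m) v1)" for l m :: 'a and v0 v1
    by (simp add: coaction_step_X_V clinear_add[OF lin(2)] clinear_sum[OF lin(2)] V_act_mult tensor_add_right
        sum.distrib add.assoc)
  have swap: "(\<Sum>k\<in>UNIV. \<Sum>j\<in>UNIV. (X_UV j * (X_UV k * v0)) \<otimes>\<^sub>t (sigma_kab j l * (sigma_kab k m * v1)))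
    = (\<Sum>k\<in>UNIV. \<Sum>j\<in>UNIV. (X_UV j * (X_UV k * v0)) \<otimes>\<^sub>t (sigma_kab j m * (sigma_kab k l * v1)))"
    for l m :: 'a and v0 v1
    by (subst sum.swap) (simp add: mult.assoc[symmetric] UV_commute[of "X_V i" "X_V j" for i j]
        kab_commute[of "sigma_kab i l" "sigma_kab j m" for i j])
  have gen: "coaction_step (X_V l) (coaction_step (X_V m) t) = coaction_step (X_V m) (coaction_step (X_V l) t)" for l m :: 'a and t
  proof (rule tensor_ext[where t = t])
    fix v0 :: "'a UV" and v1 :: "'a kab"
    show "coaction_step (X_V l) (coaction_step (X_V m) (v0 \<otimes>\<^sub>t v1)) = coaction_step (X_V m) (coaction_step (X_V l) (v0 \<otimes>\<^sub>t v1))"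
      unfolding elem swap[of v0 l m v1] sigma_kab_derivative[of l _ m] V_act_commute[of "X_V l" "X_V m"] by simp
  qed (intro clinear_compose[OF lin(2)] lin(2))+
  have "coaction_step x (coaction_step (X_V m) t) = coaction_step (X_V m) (coaction_step x t)" for m t
    by (rule lie_V_clinear_ext[where x = x])
       (intro lin(1), intro clinear_compose[OF lin(2)] lin(1), rule gen)
  then show ?thesis
    by - (rule lie_V_clinear_ext[where x = y], intro clinear_compose[OF lin(2)] lin(1), intro lin(1))
qed

lemma lie_hom_coaction_step: "lie_hom (\<lambda>x. Abs_endo (coaction_step x))"
proof (rule lie_hom_commutingI)
  show "clinear (\<lambda>x. Abs_endo (coaction_step x))"
    by (rule clinearI; rule endo_eqI)
       (simp_all add: apply_Abs_endo clinear_coaction_step plus_endo.rep_eq scaleC_endo.rep_eq cbilinearD[OF cbilinear_coaction_step])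
  show "Abs_endo (coaction_step x) * Abs_endo (coaction_step y) = Abs_endo (coaction_step y) * Abs_endo (coaction_step x)"
    for x y :: "'n::finite lie_V"
    by (rule endo_eqI) (simp add: times_endo.rep_eq apply_Abs_endo clinear_coaction_step coaction_step_commute[of x y])
qed

definition coaction_orbit :: "'n::finite UV \<Rightarrow> ('n UV, 'n kab) tensor" where
  "coaction_orbit u = apply_endo (envelope_lift (\<lambda>x. Abs_endo (coaction_step x)) u) (1 \<otimes>\<^sub>t 1)"

lemma clinear_coaction_orbit: "clinear coaction_orbit"
  unfolding coaction_orbit_def
  by (intro clinear_compose[OF clinear_apply_endo_left] clinear_envelope_lift[OF lie_hom_coaction_step])

lemma coaction_orbit_one: "coaction_orbit 1 = 1 \<otimes>\<^sub>t 1"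
  and coaction_orbit_X_mult: "coaction_orbit (envelope_of x * u) = coaction_step x (coaction_orbit u)"
  by (simp_all add: coaction_orbit_def envelope_lift_one[OF lie_hom_coaction_step] envelope_lift_mult[OF lie_hom_coaction_step]
      envelope_lift_of[OF lie_hom_coaction_step] one_endo.rep_eq times_endo.rep_eq apply_Abs_endo clinear_coaction_step)

lemma coaction_orbit_X_V:
  "coaction_orbit (X_UV l) = (\<Sum>k\<in>UNIV. X_UV k \<otimes>\<^sub>t sigma_kab k l)"
  using coaction_orbit_X_mult[of "X_V l" 1]
  by (simp add: coaction_orbit_one coaction_step_X_V V_act_one tensor_zero_right)

lemma tensor_lift_coaction_step:
  assumes R: "cbilinear R"
  shows "tensor_lift R (coaction_step (X_V l) t) = tensor_lift (\<lambda>a b.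
    (\<Sum>k\<in>UNIV. R (X_UV k * a) (sigma_kab k l * b)) + R a (V_act (X_V l) b)) t"
proof (rule tensor_ext[where t = t])
  have R': "cbilinear (\<lambda>a b. (\<Sum>k\<in>UNIV. R (X_UV k * a) (sigma_kab k l * b)) + R a (V_act (X_V l) b))"
    by (intro cbilinear_by_args clinear_intros cbilinear_apply[OF R] cbilinear_apply[OF cbilinear_V_act])
  note lin = clinear_tensor_lift[OF R]
  show "clinear (\<lambda>t. tensor_lift R (coaction_step (X_V l) t))"
    by (rule clinear_compose[OF lin clinear_coaction_step])
  show "clinear (tensor_lift (\<lambda>a b. (\<Sum>k\<in>UNIV. R (X_UV k * a) (sigma_kab k l * b)) + R a (V_act (X_V l) b)))"
    by (rule clinear_tensor_lift[OF R'])
  show "tensor_lift R (coaction_step (X_V l) (a \<otimes>\<^sub>t b)) = tensor_lift (\<lambda>a b.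
    (\<Sum>k\<in>UNIV. R (X_UV k * a) (sigma_kab k l * b)) + R a (V_act (X_V l) b)) (a \<otimes>\<^sub>t b)" for a b
    by (simp add: coaction_step_X_V tensor_lift_elem[OF R] tensor_lift_elem[OF R'] clinear_add[OF lin] clinear_sum[OF lin])
qed

lemma tensor_lift_elem_id: "tensor_lift (\<lambda>x y. x \<otimes>\<^sub>t y) t = t"
  by (rule tensor_ext[where t = t])
     (simp_all add: clinear_tensor_lift cbilinear_tensor_elem clinear_ident tensor_lift_elem)

text \<open>
  The product rule, by induction on \<open>u\<close>: both sides turn into their image under the step operator of \<open>X\<^sub>l\<close> when \<open>u\<close>
  is replaced by \<open>X\<^sub>l u\<close>. On the right this uses that \<open>X\<^sub>l\<close> acts as a derivation on \<open>u\<^sub>(\<^sub>1\<^sub>)\<^sub>\<langle>\<^sub>1\<^sub>\<rangle> (u\<^sub>(\<^sub>2\<^sub>) \<triangleright> v\<^sub>\<langle>\<^sub>1\<^sub>\<rangle>)\<close>.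
\<close>

lemma coaction_orbit_mult: "coaction_orbit (u * v) =
   tensor_lift (\<lambda>u1 u2. tensor_lift (\<lambda>u10 u11. tensor_lift (\<lambda>v0 v1.
      (u10 * v0) \<otimes>\<^sub>t (u11 * (u2 \<triangleright> v1))) (coaction_orbit v)) (coaction_orbit u1)) (envelope_comult u)"
proof -
  define R where "R a b w = tensor_lift (\<lambda>v0 v1. (a * v0) \<otimes>\<^sub>t (b * (w \<triangleright> v1))) (coaction_orbit v)"
    for a :: "'a UV" and b w
  define H where "H u1 u2 = tensor_lift (\<lambda>a b. R a b u2) (coaction_orbit u1)" for u1 u2
  have R: "cbilinear (\<lambda>a b. R a b w)" for w
    unfolding R_def by (intro cbilinear_by_args clinear_intros cbilinear_apply[OF cbilinear_UV_act])
  have H: "cbilinear H"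
    unfolding H_def
    by (intro cbilinear_by_args clinear_compose[OF clinear_tensor_lift[OF R]] clinear_coaction_orbit)
      (unfold R_def, intro clinear_intros cbilinear_apply[OF cbilinear_UV_act])
  have step: "coaction_step (X_V l) (R a b w) =
      (\<Sum>k\<in>UNIV. R (X_UV k * a) (sigma_kab k l * b) w) + R a (V_act (X_V l) b) w + R a b (X_UV l * w)"
    for l a b w
    unfolding R_def clinear_tensor_lift_fun[OF clinear_coaction_step]
    by (simp add: coaction_step_X_V V_act_mult UV_act_X_mult tensor_add_right mult.assoc add.assoc
        tensor_lift_add_fun tensor_lift_sum_fun)
  have "coaction_orbit (u * v) = tensor_lift H (envelope_comult u)"
  proof (rule UV_clinear_ext[where u = u])
    show "clinear (\<lambda>u. coaction_orbit (u * v))"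
      by (intro clinear_compose[OF clinear_coaction_orbit] clinear_intros)
    show "clinear (\<lambda>u. tensor_lift H (envelope_comult u))"
      by (rule clinear_compose[OF clinear_tensor_lift[OF H] clinear_envelope_comult])
    show "coaction_orbit (1 * v) = tensor_lift H (envelope_comult 1)"
      by (simp add: envelope_comult_one' tensor_lift_elem[OF H])
         (simp add: H_def coaction_orbit_one tensor_lift_elem[OF R], simp add: R_def UV_act_one tensor_lift_elem_id)
    fix l u assume IH: "coaction_orbit (u * v) = tensor_lift H (envelope_comult u)"
    have "coaction_orbit (X_UV l * u * v) = coaction_step (X_V l) (tensor_lift H (envelope_comult u))"
      by (simp add: mult.assoc coaction_orbit_X_mult IH)
    also have "\<dots> = tensor_lift (\<lambda>u1 u2. tensor_lift (\<lambda>a b. coaction_step (X_V l) (R a b u2)) (coaction_orbit u1)) (envelope_comult u)"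
      unfolding H_def by (simp add: clinear_tensor_lift_fun[OF clinear_coaction_step])
    also have "\<dots> = tensor_lift (\<lambda>u1 u2. H (X_UV l * u1) u2 + H u1 (X_UV l * u2)) (envelope_comult u)"
      unfolding H_def coaction_orbit_X_mult tensor_lift_coaction_step[OF R] step by (simp add: tensor_lift_add_fun)
    also have "\<dots> = tensor_lift H (envelope_comult (X_UV l * u))"
      by (rule tensor_lift_comult_of_mult[OF H, symmetric])
    finally show "coaction_orbit (X_UV l * u * v) = tensor_lift H (envelope_comult (X_UV l * u))" .
  qed
  then show ?thesis unfolding H_def R_def .
qed

text \<open>
  Conversely the prescribed values and the product rule determine \<open>\<rho>(X\<^sub>l u)\<close> from \<open>\<rho>(u)\<close>, so the coaction is unique.
\<close>

lemma coaction_eq: "coaction = (coaction_orbit :: 'n::finite UV \<Rightarrow> _)"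
  unfolding coaction_def
proof (rule the_equality)
  fix \<rho> :: "'n UV \<Rightarrow> ('n UV, 'n kab) tensor"
  assume \<rho>: "clinear \<rho> \<and> \<rho> 1 = 1 \<otimes>\<^sub>t 1 \<and>
     (\<forall>l. \<rho> (X_UV l) = (\<Sum>k\<in>UNIV. X_UV k \<otimes>\<^sub>t sigma_kab k l)) \<and>
     (\<forall>u v. \<rho> (u * v) =
        tensor_lift (\<lambda>u1 u2. tensor_lift (\<lambda>u10 u11. tensor_lift (\<lambda>v0 v1.
          (u10 * v0) \<otimes>\<^sub>t (u11 * (u2 \<triangleright> v1))) (\<rho> v)) (\<rho> u1)) (envelope_comult u))"
  have H: "cbilinear (\<lambda>u1 u2. tensor_lift (\<lambda>u10 u11. tensor_lift (\<lambda>v0 v1. (u10 * v0) \<otimes>\<^sub>t (u11 * (u2 \<triangleright> v1))) t) (\<rho>' u1))"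
    if "clinear \<rho>'" for t and \<rho>' :: "'n UV \<Rightarrow> ('n UV, 'n kab) tensor"
    by (intro cbilinear_by_args clinear_intros cbilinear_apply[OF cbilinear_UV_act] that)
  note lin = clinear_add[OF clinear_tensor_lift[OF H]]
  show "\<rho> = coaction_orbit"
  proof
    fix u show "\<rho> u = coaction_orbit u"
    proof (rule UV_clinear_ext[where u = u])
      fix l u assume "\<rho> u = coaction_orbit u"
      then show "\<rho> (X_UV l * u) = coaction_orbit (X_UV l * u)"
        using \<rho> unfolding coaction_orbit_mult
        by (simp add: envelope_comult_of lin tensor_lift_elem[OF H] clinear_coaction_orbit coaction_orbit_X_V coaction_orbit_one)
    qed (use \<rho> in \<open>simp_all add: clinear_coaction_orbit coaction_orbit_one\<close>)
  qed
qed (simp add: clinear_coaction_orbit coaction_orbit_one coaction_orbit_X_V flip: coaction_orbit_mult)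

section \<open>The bialgebra map\<close>

lemma tensor_swap_mult: "tensor_swap (s * t) = tensor_swap s * tensor_swap t"
  for s t :: "('a::complex_algebra_1, 'b::complex_algebra_1) tensor"
proof -
  have "tensor_swap ((x \<otimes>\<^sub>t y) * t) = tensor_swap (x \<otimes>\<^sub>t y) * tensor_swap t" for x :: 'a and y :: 'b
    by (rule tensor_ext[where t = t],
        rule clinear_compose[OF clinear_tensor_swap cbilinear_apply(2)[OF cbilinear_times clinear_ident]],
        rule cbilinear_apply(2)[OF cbilinear_times clinear_tensor_swap])
       (simp add: tensor_mult_elem' tensor_swap_elem)
  then show ?thesis
    by - (rule tensor_ext[where t = s],
        rule clinear_compose[OF clinear_tensor_swap cbilinear_apply(1)[OF cbilinear_times clinear_ident]],
        rule cbilinear_apply(1)[OF cbilinear_times clinear_tensor_swap])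
qed

text \<open>
  The sum \<open>u\<^sub>(\<^sub>1\<^sub>)\<^sub>\<langle>\<^sub>0\<^sub>\<rangle> \<otimes> u\<^sub>(\<^sub>1\<^sub>)\<^sub>\<langle>\<^sub>1\<^sub>\<rangle> u\<^sub>(\<^sub>2\<^sub>)\<close> of operators is multiplicative in \<open>u\<close>, and for \<open>u = X\<^sub>l\<close> it is the
  opposite coproduct \<open>1 \<otimes> X\<^sub>l + X\<^sub>k \<otimes> \<sigma>\<^sup>k\<^sub>l\<close>.
\<close>

lemma UV_coproduct:
  "tensor_lift (\<lambda>u1 u2. tensor_lift (\<lambda>u10 u11. UV_map u10 \<otimes>\<^sub>t (kab_inclusion u11 * UV_map u2)) (coaction_orbit u1)) (envelope_comult u)
    = tensor_swap (kn_comult (UV_map u))"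
proof -
  define R where "R w a b = UV_map a \<otimes>\<^sub>t (kab_inclusion b * UV_map w)" for a :: "'a UV" and b :: "'a kab" and w
  define H where "H u1 u2 = tensor_lift (R u2) (coaction_orbit u1)" for u1 u2
  have R: "cbilinear (R w)" for w
    unfolding R_def by (intro cbilinear_by_args clinear_intros clinear_UV_map clinear_kab_inclusion)
  have H: "cbilinear H"
    unfolding H_def
    by (intro cbilinear_by_args clinear_compose[OF clinear_tensor_lift[OF R]] clinear_coaction_orbit)
      (unfold R_def, intro clinear_intros clinear_UV_map)
  have "tensor_lift H (envelope_comult u) = tensor_swap (kn_comult (UV_map u))"
  proof (rule UV_clinear_ext[where u = u])
    show "clinear (\<lambda>u. tensor_lift H (envelope_comult u))"
      by (rule clinear_compose[OF clinear_tensor_lift[OF H] clinear_envelope_comult])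
    show "clinear (\<lambda>u. tensor_swap (kn_comult (UV_map u)))"
      by (intro clinear_compose[OF clinear_tensor_swap] clinear_compose[OF kn.clinear_comult] clinear_UV_map)
    have "kn_comult 1 = 1 \<otimes>\<^sub>t (1 :: 'a kn)"
      using bialgebra.comult_unit[OF bialgebra_kn] by (simp add: kn_bialgebra_def)
    then show "tensor_lift H (envelope_comult 1) = tensor_swap (kn_comult (UV_map 1))"
      by (simp add: envelope_comult_one' tensor_lift_elem[OF H] UV_map_one tensor_swap_elem)
         (simp add: H_def coaction_orbit_one tensor_lift_elem[OF R], simp add: R_def UV_map_one kab_inclusion_one)
    fix l :: 'a and u assume IH: "tensor_lift H (envelope_comult u) = tensor_swap (kn_comult (UV_map u))"
    define W where "W = 1 \<otimes>\<^sub>t X_kn l + (\<Sum>k\<in>UNIV. X_kn k \<otimes>\<^sub>t sigma_kn k l)"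
    have W: "clinear (\<lambda>t. W * t)" by (intro clinear_intros)
    have "kn_comult (X_kn l) = X_kn l \<otimes>\<^sub>t 1 + (\<Sum>k\<in>UNIV. sigma_kn k l \<otimes>\<^sub>t X_kn k)"
      by (rule kn.comult_eqI) (simp add: X_kn.rep_eq is_coproduct_X_kn)
    then have swap_X: "tensor_swap (kn_comult (X_kn l)) = W"
      by (simp add: W_def clinear_add[OF clinear_tensor_swap] clinear_sum[OF clinear_tensor_swap] tensor_swap_elem)
    have pointwise: "W * R w a b =
        (\<Sum>k\<in>UNIV. R w (X_UV k * a) (sigma_kab k l * b)) + R w a (V_act (X_V l) b) + R (X_UV l * w) a b" for a b w
    proof -
      have "(\<Sum>k\<in>UNIV. X_kn k \<otimes>\<^sub>t sigma_kn k l) * R w a b = (\<Sum>k\<in>UNIV. R w (X_UV k * a) (sigma_kab k l * b))"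
        by (simp add: R_def sum_distrib_right tensor_mult_elem' UV_map_mult UV_map_X kab_inclusion_mult
            kab_inclusion_sigma mult.assoc)
      moreover have "(1 \<otimes>\<^sub>t X_kn l) * R w a b = R w a (V_act (X_V l) b) + R (X_UV l * w) a b"
        by (simp add: R_def tensor_mult_elem' UV_map_mult UV_map_X kab_inclusion_V_act left_diff_distrib mult.assoc
            flip: tensor_add_right)
      ultimately show ?thesis by (simp add: W_def distrib_right add_ac)
    qed
    have "tensor_lift H (envelope_comult (X_UV l * u)) =
        tensor_lift (\<lambda>u1 u2. H (X_UV l * u1) u2 + H u1 (X_UV l * u2)) (envelope_comult u)"
      by (rule tensor_lift_comult_of_mult[OF H])
    also have "\<dots> = tensor_lift (\<lambda>u1 u2. tensor_lift (\<lambda>a b. W * R u2 a b) (coaction_orbit u1)) (envelope_comult u)"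
      unfolding H_def coaction_orbit_X_mult tensor_lift_coaction_step[OF R] pointwise by (simp add: tensor_lift_add_fun)
    also have "\<dots> = W * tensor_lift H (envelope_comult u)"
      unfolding H_def by (simp add: clinear_tensor_lift_fun[OF W])
    finally show "tensor_lift H (envelope_comult (X_UV l * u)) =
        tensor_swap (kn_comult (UV_map (X_UV l * u)))"
      by (simp add: IH UV_map_mult UV_map_X comult_kn_mult tensor_swap_mult swap_X)
  qed
  then show ?thesis unfolding H_def R_def .
qed

lemma cbilinear_I: "cbilinear (\<lambda>f u. kab_inclusion f * UV_map u)"
  by (intro cbilinear_by_args clinear_intros clinear_kab_inclusion clinear_UV_map)

lemma I_map_eq: "I_map = tensor_lift (\<lambda>f u. kab_inclusion f * UV_map u)"
proof -
  have "Abs_kn (Rep_kab f * envelope_lift Rep_lie_V u) = kab_inclusion f * UV_map u" for f :: "'a kab" and u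
    by (metis Rep_UV_map Rep_kab_inclusion Rep_kn_inverse times_kn.rep_eq)
  then show ?thesis by (simp add: I_map_def)
qed

lemma clinear_I_map: "clinear I_map"
  and I_map_elem: "I_map (f \<otimes>\<^sub>t u) = kab_inclusion f * UV_map u"
  unfolding I_map_eq by (rule clinear_tensor_lift[OF cbilinear_I]) (rule tensor_lift_elem[OF cbilinear_I])

lemma I_map_mult: "I_map (bmult bicrossed_product s t) = I_map s * I_map t"
proof -
  have "tensor_lift (\<lambda>u1 u2. kab_inclusion (f * (u1 \<triangleright> g)) * UV_map (u2 * v)) (envelope_comult u) =
      (kab_inclusion f * UV_map u) * (kab_inclusion g * UV_map v)" for f g :: "'a kab" and u v
  proof -
    have L: "clinear (\<lambda>k. kab_inclusion f * k * UV_map v)" by (intro clinear_intros)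
    have "tensor_lift (\<lambda>u1 u2. kab_inclusion (f * (u1 \<triangleright> g)) * UV_map (u2 * v)) (envelope_comult u) =
        tensor_lift (\<lambda>u1 u2. kab_inclusion f * (kab_inclusion (u1 \<triangleright> g) * UV_map u2) * UV_map v) (envelope_comult u)"
      by (simp add: kab_inclusion_mult UV_map_mult mult.assoc)
    also have "\<dots> = kab_inclusion f * (UV_map u * kab_inclusion g) * UV_map v"
      by (simp only: clinear_tensor_lift_fun[OF L, symmetric] UV_leibniz)
    finally show ?thesis by (simp add: mult.assoc)
  qed
  then have "I_map (bmult bicrossed_product s t) =
      tensor_lift (\<lambda>f u. tensor_lift (\<lambda>g v. (kab_inclusion f * UV_map u) * (kab_inclusion g * UV_map v)) t) s"
    by (simp add: bicrossed_product_def clinear_tensor_lift_fun[OF clinear_I_map] I_map_elem)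
  also have "\<dots> = tensor_lift (\<lambda>f u. (kab_inclusion f * UV_map u) * I_map t) s"
    by (simp add: I_map_eq clinear_tensor_lift_fun[OF cbilinear_apply(2)[OF cbilinear_times clinear_ident]])
  also have "\<dots> = I_map s * I_map t"
    by (simp add: I_map_eq clinear_tensor_lift_fun[OF cbilinear_apply(1)[OF cbilinear_times clinear_ident]])
  finally show ?thesis .
qed

lemma I_map_comult:
  "tensor_swap (kn_comult (I_map x)) = tensor_map I_map I_map (bcomult bicrossed_product x)"
proof -
  define D where "D f u = tensor_lift (\<lambda>f1 f2. tensor_lift (\<lambda>u1 u2. tensor_lift (\<lambda>u10 u11.
       (f1 \<otimes>\<^sub>t u10) \<otimes>\<^sub>t ((f2 * u11) \<otimes>\<^sub>t u2)) (coaction_orbit u1)) (envelope_comult u)) (tensor_swap (kab_comult f))"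
    for f :: "'a kab" and u
  have D: "cbilinear D"
    unfolding D_def
    by (intro cbilinear_by_args clinear_intros clinear_compose[OF clinear_tensor_swap] kab.clinear_comult
        clinear_envelope_comult clinear_coaction_orbit)
  have bcomult: "bcomult bicrossed_product = tensor_lift D"
    by (simp add: bicrossed_product_def D_def[abs_def] coaction_eq F_K_def co_opposite_def kab_bialgebra_def)
  have map: "clinear (tensor_map I_map I_map)"
    by (intro clinear_tensor_map clinear_I_map)
  have elem: "tensor_swap (kn_comult (kab_inclusion f * UV_map u)) = tensor_map I_map I_map (D f u)" for f u
  proof -
    let ?M = "tensor_swap (kn_comult (UV_map u))"
    have mult: "clinear (\<lambda>t. (kab_inclusion f1 \<otimes>\<^sub>t kab_inclusion f2) * t)" for f1 f2 :: "'a kab" by (intro clinear_intros)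
    have "tensor_map I_map I_map (D f u) = tensor_lift (\<lambda>f1 f2. tensor_lift (\<lambda>u1 u2. tensor_lift (\<lambda>u10 u11.
        (kab_inclusion f1 \<otimes>\<^sub>t kab_inclusion f2) * (UV_map u10 \<otimes>\<^sub>t (kab_inclusion u11 * UV_map u2))) (coaction_orbit u1))
        (envelope_comult u)) (tensor_swap (kab_comult f))"
      by (simp add: D_def clinear_tensor_lift_fun[OF map] tensor_map_elem clinear_I_map I_map_elem tensor_mult_elem'
          kab_inclusion_mult mult.assoc)
    also have "\<dots> = tensor_lift (\<lambda>f1 f2. (kab_inclusion f1 \<otimes>\<^sub>t kab_inclusion f2) * ?M) (tensor_swap (kab_comult f))"
      by (simp only: clinear_tensor_lift_fun[OF mult, symmetric] UV_coproduct)
    also have "\<dots> = tensor_map kab_inclusion kab_inclusion (tensor_swap (kab_comult f)) * ?M"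
      unfolding tensor_map_def
      by (rule clinear_tensor_lift_fun[OF cbilinear_apply(1)[OF cbilinear_times clinear_ident], symmetric])
    also have "\<dots> = tensor_swap (kn_comult (kab_inclusion f * UV_map u))"
      by (simp add: comult_kn_mult tensor_swap_mult comult_kab_inclusion tensor_swap_map clinear_kab_inclusion)
    finally show ?thesis by simp
  qed
  show ?thesis
  proof (rule tensor_ext[where t = x])
    show "clinear (\<lambda>x :: ('a kab, 'a UV) tensor. tensor_swap (kn_comult (I_map x)))"
      by (intro clinear_compose[OF clinear_tensor_swap] clinear_compose[OF kn.clinear_comult] clinear_I_map)
    show "clinear (\<lambda>x :: ('a kab, 'a UV) tensor. tensor_map I_map I_map (bcomult bicrossed_product x))"
      unfolding bcomult by (rule clinear_compose[OF map clinear_tensor_lift[OF D]])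
  qed (simp add: bcomult tensor_lift_elem[OF D] I_map_elem elem)
qed

lemma operator_counit_UV_map: "operator_counit (Rep_kn (UV_map u)) = envelope_counit u"
proof (rule UV_clinear_ext[where u = u])
  show "clinear (\<lambda>u. operator_counit (Rep_kn (UV_map u)))"
    by (rule clinear_compose[OF kn.clinear_counit clinear_UV_map])
  show "clinear envelope_counit" by (rule clinear_envelope_counit)
  show "operator_counit (Rep_kn (UV_map 1)) = envelope_counit 1"
    by (simp add: UV_map_one one_kn.rep_eq operator_counit_one envelope_counit_one)
  fix l :: 'a and u
  have "operator_counit (X_op l) = 0"
    by (rule operator_counit_eqI[OF kn.natural[of "X_kn l", unfolded X_kn.rep_eq] has_counit_X_op])
  then show "operator_counit (Rep_kn (UV_map (X_UV l * u))) = envelope_counit (X_UV l * u)"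
    by (simp add: UV_map_mult UV_map_X operator_counit_kn_mult X_kn.rep_eq envelope_counit_mult envelope_counit_of)
qed

lemma I_map_counit: "operator_counit (Rep_kn (I_map x)) = bcounit bicrossed_product x"
proof (rule tensor_ext[where t = x])
  have bil: "cbilinear (\<lambda>f u. operator_counit (Rep_kab f) * envelope_counit u)"
    by (intro cbilinear_by_args clinear_intros kab.clinear_counit clinear_envelope_counit)
  have bcounit: "bcounit bicrossed_product = tensor_lift (\<lambda>f u. operator_counit (Rep_kab f) * envelope_counit u)"
    by (simp add: bicrossed_product_def F_K_def co_opposite_def kab_bialgebra_def)
  show "clinear (\<lambda>x. operator_counit (Rep_kn (I_map x)))"
    by (rule clinear_compose[OF kn.clinear_counit clinear_I_map])
  show "clinear (bcounit bicrossed_product)"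
    unfolding bcounit by (rule clinear_tensor_lift[OF bil])
  show "operator_counit (Rep_kn (I_map (f \<otimes>\<^sub>t u))) = bcounit bicrossed_product (f \<otimes>\<^sub>t u)" for f u
    by (simp add: bcounit tensor_lift_elem[OF bil] I_map_elem operator_counit_kn_mult operator_counit_UV_map Rep_kab_inclusion)
qed

section \<open>Bijectivity\<close>

text \<open>The image is a subalgebra that contains the generators.\<close>

lemma I_map_surj: "\<exists>t. I_map t = (k :: 'n::finite kn)"
proof -
  have "\<exists>t. Rep_kn (I_map t) = T" if "T \<in> kn_set" for T :: "'n crossed endo"
    using that
  proof (induction rule: generated_subalgebra.induct)
    case (gen T)
    have "Rep_kn (I_map (1 \<otimes>\<^sub>t X_UV l)) = X_op l" for l :: 'n
      by (simp add: I_map_elem kab_inclusion_one UV_map_X X_kn.rep_eq)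
    moreover have "Rep_kn (I_map (sigma_kab i j \<otimes>\<^sub>t 1)) = sigma_op i [j]" for i j :: 'n
      by (simp add: I_map_elem UV_map_one Rep_kab_inclusion sigma_kab.rep_eq)
    moreover have "Rep_kn (I_map (Abs_kab sigma_inv_op \<otimes>\<^sub>t 1)) = (sigma_inv_op :: 'n crossed endo)"
    proof -
      have "(sigma_inv_op :: 'n crossed endo) \<in> kab_set" by (rule generated_subalgebra.gen) blast
      then show ?thesis by (simp add: I_map_elem UV_map_one Rep_kab_inclusion Abs_kab_inverse)
    qed
    ultimately show ?case using gen by blast
  next
    case one
    have "Rep_kn (I_map (1 \<otimes>\<^sub>t 1)) = (1 :: 'n crossed endo)"
      by (simp add: I_map_elem UV_map_one kab_inclusion_one one_kn.rep_eq)
    then show ?case by blast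
  next
    case (add S T)
    then show ?case using clinear_add[OF clinear_I_map] plus_kn.rep_eq by metis
  next
    case (scale T c)
    then show ?case using clinear_scale[OF clinear_I_map] scaleC_kn.rep_eq by metis
  next
    case (mult S T)
    then show ?case using I_map_mult times_kn.rep_eq by metis
  qed
  from this[OF Rep_kn[of k]] show ?thesis by (auto dest: Rep_kn_eqI)
qed

text \<open>As the \<open>X\<^sub>l\<close> commute, a monomial in them depends only on the multiset of its factors.\<close>

definition UV_monomial :: "'n::finite multiset \<Rightarrow> 'n UV" where
  "UV_monomial M = fold_mset (\<lambda>l u. X_UV l * u) 1 M"

lemma UV_monomial_empty: "UV_monomial {#} = 1"
  by (simp add: UV_monomial_def)

lemma UV_monomial_add: "UV_monomial (add_mset l M) = X_UV l * UV_monomial M"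
proof -
  interpret comp_fun_commute "\<lambda>l u. X_UV l * (u :: 'a UV)"
    by standard (simp add: fun_eq_iff UV_commute flip: mult.assoc)
  show ?thesis by (simp add: UV_monomial_def)
qed

lemma UV_spanned_by_monomials: "\<exists>p. u = linear_extension UV_monomial p"
proof (induction u rule: UV_induct)
  case one
  have "1 = linear_extension UV_monomial (Poly_Mapping.single {#} 1)"
    by (simp only: linear_extension_single UV_monomial_empty scaleC_one)
  then show ?case by blast
next
  case (X_mult l u)
  then obtain p where u: "u = linear_extension UV_monomial p" by blast
  let ?s = "linear_extension (\<lambda>M. Poly_Mapping.single (add_mset l M) 1)"
  have "X_UV l * linear_extension UV_monomial p = linear_extension UV_monomial (?s p)"
    by (rule poly_mapping_clinear_ext[where p = p],
        rule cbilinear_apply(2)[OF cbilinear_times clinear_linear_extension],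
        rule clinear_compose[OF clinear_linear_extension clinear_linear_extension])
       (simp add: linear_extension_single UV_monomial_add scaleC_one)
  then show ?case using u by blast
next
  case (add u v)
  then show ?case using clinear_add[OF clinear_linear_extension] by metis
next
  case (scale c u)
  then show ?case using clinear_scale[OF clinear_linear_extension] by metis
qed

text \<open>
  Derivatives of a monomial function: a nonzero multiple of a lower monomial as long as no exponent is exceeded,
  and \<open>0\<close> afterwards. The truncated differences in the exponents are harmless because then \<open>c = 0\<close>.
\<close>

lemma UV_monomial_germ:
  assumes h: "\<forall>\<^sub>F y in nhds x. Rep_test_function h y = of_real (monomial_at x a y)"
  shows "\<exists>c. (c \<noteq> 0 \<longleftrightarrow> (\<forall>k. count M k \<le> a k)) \<and>
    (\<forall>\<^sub>F y in nhds x. coef (apply_endo (Rep_kn (UV_map (UV_monomial M))) (monom_U \<phi> h)) \<phi> y =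
      of_real (c * monomial_at x (\<lambda>k. a k - count M k) y))"
proof (induction M)
  case empty
  show ?case
    using h by (intro exI[of _ 1]) (simp add: UV_monomial_empty UV_map_one one_kn.rep_eq one_endo.rep_eq coef_monom_U)
next
  case (add l M)
  then obtain c where c: "c \<noteq> 0 \<longleftrightarrow> (\<forall>k. count M k \<le> a k)"
    and germ: "\<forall>\<^sub>F y in nhds x. coef (apply_endo (Rep_kn (UV_map (UV_monomial M))) (monom_U \<phi> h)) \<phi> y =
      of_real (c * monomial_at x (\<lambda>k. a k - count M k) y)" by blast
  let ?c = "c * real (a l - count M l)"
  let ?m = "monomial_at x (\<lambda>k. a k - count M k)"
  have count: "(\<lambda>k. a k - count M k)(l := (a l - count M l) - 1) = (\<lambda>k. a k - count (add_mset l M) k)"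
    by (auto simp: fun_eq_iff)
  have "partial l (\<lambda>y. of_real (c * ?m y) :: complex) y = of_real (?c * monomial_at x (\<lambda>k. a k - count (add_mset l M) k) y)" for y
  proof -
    have sm: "smooth (\<lambda>y. c * ?m y)"
      by (intro smooth_mult smooth_const smooth_monomial_at)
    have "partial l (\<lambda>y. c * ?m y) y = c * partial l ?m y"
      by (simp add: partial_bounded_linear[OF bounded_linear_mult_right[of c] smooth_differentiable[OF smooth_monomial_at]])
    then show ?thesis
      using smooth_differentiable[OF sm] by (simp only: partial_of_real partial_monomial_at count mult.assoc)
  qed
  then have "\<forall>\<^sub>F y in nhds x. coef (apply_endo (Rep_kn (UV_map (UV_monomial (add_mset l M)))) (monom_U \<phi> h)) \<phi> y =
      of_real (?c * monomial_at x (\<lambda>k. a k - count (add_mset l M) k) y)"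
    using partial_cong_germ[OF germ, of l]
    by (simp add: UV_monomial_add UV_map_mult UV_map_X times_kn.rep_eq X_kn.rep_eq times_endo.rep_eq coef_X_op)
  moreover have "?c \<noteq> 0 \<longleftrightarrow> (\<forall>k. count (add_mset l M) k \<le> a k)"
  proof
    assume *: "?c \<noteq> 0"
    then have "\<forall>k. count M k \<le> a k" "count M l < a l" using c by auto
    then show "\<forall>k. count (add_mset l M) k \<le> a k" by auto
  next
    assume *: "\<forall>k. count (add_mset l M) k \<le> a k"
    have "\<forall>k. count M k \<le> a k" using * by (metis count_add_mset le_SucI Suc_leD)
    moreover have "count M l < a l" using *[rule_format, of l] by simp
    ultimately show "?c \<noteq> 0" using c by simp
  qed
  ultimately show ?case by blast
qed

text \<open>
  Applied to the monomial function with exponents \<open>a\<close> centred at \<open>x\<close> and evaluated at \<open>x\<close>, among the monomials in the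
  \<open>X\<^sub>l\<close> only the one with exponents \<open>a\<close> survives. So these evaluations read off all coefficients.
\<close>

lemma separating_UV: "separating {\<lambda>u. kn.ev \<phi> x h (UV_map u) | h. True}"
  unfolding separating_def
proof (intro conjI ballI allI impI)
  show "clinear f" if "f \<in> {\<lambda>u. kn.ev \<phi> x h (UV_map u) | h. True}" for f
    using that by (auto intro: clinear_compose[OF kn.clinear_ev clinear_UV_map])
  fix u :: "'a UV" assume zero: "\<forall>f\<in>{\<lambda>u. kn.ev \<phi> x h (UV_map u) | h. True}. f u = 0"
  obtain p where u: "u = linear_extension UV_monomial p" using UV_spanned_by_monomials by blast
  have "Poly_Mapping.lookup p N = 0" for N
  proof -
    obtain h where h: "\<forall>\<^sub>F y in nhds x. Rep_test_function h y = of_real (monomial_at x (count N) y)"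
      using ex_test_function_germ[OF smooth_bounded_linear[OF bounded_linear_of_real smooth_monomial_at]] by blast
    have ev: "kn.ev \<phi> x h (UV_map (UV_monomial M)) \<noteq> 0 \<longleftrightarrow> M = N" for M
    proof -
      obtain c where c: "c \<noteq> 0 \<longleftrightarrow> (\<forall>k. count M k \<le> count N k)"
        and "\<forall>\<^sub>F y in nhds x. coef (apply_endo (Rep_kn (UV_map (UV_monomial M))) (monom_U \<phi> h)) \<phi> y =
          of_real (c * monomial_at x (\<lambda>k. count N k - count M k) y)"
        using UV_monomial_germ[OF h, of M \<phi>] by blast
      from eventually_nhds_x_imp_x[OF this(2)]
      have "kn.ev \<phi> x h (UV_map (UV_monomial M)) = of_real (c * monomial_at x (\<lambda>k. count N k - count M k) x)"
        by (simp add: kn.ev_def)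
      moreover have "monomial_at x (\<lambda>k. count N k - count M k) x \<noteq> 0 \<longleftrightarrow> (\<forall>k. count N k \<le> count M k)"
        by (auto simp: monomial_at_def not_less)
      ultimately show ?thesis
        using c by (auto simp: multiset_eq_iff intro: antisym)
    qed
    have "(\<lambda>u. kn.ev \<phi> x h (UV_map u)) \<in> {\<lambda>u. kn.ev \<phi> x h (UV_map u) | h. True}" by blast
    from zero[rule_format, OF this] have "0 = kn.ev \<phi> x h (UV_map u)" by simp
    also have "\<dots> = (\<Sum>M\<in>Poly_Mapping.keys p. Poly_Mapping.lookup p M * kn.ev \<phi> x h (UV_map (UV_monomial M)))"
      unfolding u linear_extension_def
      by (simp add: clinear_sum[OF clinear_UV_map] clinear_scale[OF clinear_UV_map] clinear_sum[OF kn.clinear_ev]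
          clinear_scale[OF kn.clinear_ev] scaleC_complex_def)
    also have "\<dots> = (\<Sum>M\<in>Poly_Mapping.keys p. if M = N then Poly_Mapping.lookup p N * kn.ev \<phi> x h (UV_map (UV_monomial N)) else 0)"
      by (intro sum.cong) (use ev in auto)
    finally show ?thesis using ev[of N] by (auto simp: in_keys_iff split: if_splits)
  qed
  then have "p = 0" by (intro poly_mapping_eqI) simp
  then show "u = 0" unfolding u by (simp add: linear_extension_def)
qed

text \<open>
  At \<open>h' U\<^sup>*\<^bsub>\<phi>\<^esub>\<close> and \<open>x\<close> the operator \<open>f u\<close> takes the value of \<open>f\<close> at \<open>(\<phi>, x)\<close> times the value of \<open>u\<close> on \<open>h'\<close> at \<open>x\<close>, which is a
  product of functionals on the two factors. For a given \<open>(\<phi>, x)\<close> the second ones still separate \<open>\<U>(V)\<close>.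
\<close>

lemma I_map_eq_0:
  assumes "I_map t = 0"
  shows "t = 0"
proof -
  have mult: "kab.ev \<phi> x h f * kn.ev \<phi> x h' (UV_map u) = Rep_test_function h x * kn.ev \<phi> x h' (kab_inclusion f * UV_map u)"
    for \<phi> x h h' f and u :: "'a UV"
  proof -
    obtain F where "is_multiplication (Rep_kab f) F" using kab_set_multiplication[OF Rep_kab] by blast
    then show ?thesis
      by (simp add: kab.ev_def kn.ev_def is_multiplication_def Rep_kab_inclusion times_kn.rep_eq times_endo.rep_eq coef_monom_U)
  qed
  show ?thesis
  proof (rule tensor_eq_0I[OF kab.separating_evs])
    fix f :: "'a kab \<Rightarrow> complex" assume "f \<in> kab.evs"
    then obtain \<phi> x h where f: "f = kab.ev \<phi> x h" unfolding kab.evs_def by blast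
    have "tensor_functional f g t = 0" if g: "g \<in> {\<lambda>u. kn.ev \<phi> x h' (UV_map u) | h'. True}" for g
    proof -
      obtain h' where g': "g = (\<lambda>u. kn.ev \<phi> x h' (UV_map u))" using g by blast
      have lin: "clinear (\<lambda>k. Rep_test_function h x * kn.ev \<phi> x h' k)"
        by (intro clinear_intros kn.clinear_ev)
      have "tensor_functional f g t = Rep_test_function h x * kn.ev \<phi> x h' (I_map t)"
        unfolding tensor_functional_def f g' mult I_map_eq
        by (rule clinear_tensor_lift_fun[OF lin, symmetric])
      then show ?thesis by (simp add: assms clinear_zero[OF kn.clinear_ev])
    qed
    then show "\<exists>G. separating G \<and> (\<forall>g\<in>G. tensor_functional f g t = 0)"
      using separating_UV by blast
  qed
qed

lemma bij_I_map: "bij (I_map :: ('n::finite kab, 'n UV) tensor \<Rightarrow> 'n kn)"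
proof (rule bijI)
  show "inj (I_map :: ('n kab, 'n UV) tensor \<Rightarrow> 'n kn)"
  proof (rule injI)
    fix s t :: "('n kab, 'n UV) tensor" assume "I_map s = I_map t"
    then have "I_map (s - t) = 0" by (simp add: clinear_diff[OF clinear_I_map])
    from I_map_eq_0[OF this] show "s = t" by simp
  qed
  show "surj (I_map :: ('n kab, 'n UV) tensor \<Rightarrow> 'n kn)"
    using I_map_surj unfolding surj_def by metis
qed

theorem proposition1p5:
  shows "bialgebra_iso (bicrossed_product :: ('n::finite kab, 'n UV) tensor bialg)
           (co_opposite kn_bialgebra) (I_map :: ('n kab, 'n UV) tensor \<Rightarrow> 'n kn)"
proof (rule bialgebra_iso_transport)
  show "bialgebra (co_opposite (kn_bialgebra :: 'n kn bialg))"
    by (rule bialgebra_co_opposite[OF bialgebra_kn])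
  show "I_map (bunit bicrossed_product :: ('n kab, 'n UV) tensor) = bunit (co_opposite kn_bialgebra)"
    by (simp add: bicrossed_product_def co_opposite_def kn_bialgebra_def I_map_elem UV_map_one kab_inclusion_one)
qed (simp_all add: clinear_I_map bij_I_map I_map_mult I_map_comult I_map_counit co_opposite_def kn_bialgebra_def)

end
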